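(* Let $\ell\ge1$, $k\ge2$ and $d\ge1$ be integers, and consider the operator $\mathcal{P}$ acting on the space $\mathcal{F}$ (both defined in the context). (1) If $g(\boldsymbol x)=\sum_{\boldsymbol m\in\mathbb{Z}_+^d}\alpha(\boldsymbol m)H_{\boldsymbol m}(\boldsymbol x)\in L^2(\mathbb{R}^d,\mathrm{d}\gamma_d)$ and if $\varphi:\mathcal{M}\to\mathbb{C}$ is defined by $\varphi(M)=\prod_{i=1}^{\ell}\prod_{j=1}^{k}\alpha(\boldsymbol m^{i,j})$ for any $M=[\boldsymbol m^{i,j}]\in\mathcal{M}$, then $$\int_{-1/2}^{1/2}\bigg(\int_{\mathbb{R}^d}|\mathcal{H}^t g(\boldsymbol x)|^{2k}\,\mathrm{d}\gamma_d(\boldsymbol x)\bigg)^{\ell}\mathrm{d}t=\langle\varphi,\mathcal{P}\varphi\rangle_{\mathcal{F}}\quad\text{and}\quad\bigg(\int_{\mathbb{R}^d}|g(\boldsymbol x)|^2\,\mathrm{d}\gamma_d(\boldsymbol x)\bigg)^{k\ell}=\|\varphi\|_{\mathcal{F}}^2 .$$ (2) Let $S\ge0$ be an integer and let $\mathcal{P}_S$ be the restriction of $\mathcal{P}$ to $\mathcal{F}_S$ (recall that $\mathcal{P}(\mathcal{F}_S)\subset\mathcal{F}_S$). Then $\mathcal{P}_S^2=\mathcal{P}_S$ (hence $\mathcal{P}_S$ is a projection) if and only if $(k-1)\ell d/2=1$. In this case, $\mathcal{P}$ is well-defined on the whole of $\mathcal{F}$ and it is also a projection. (3) In general, if $\mu:=(k-1)\ell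 d/2>1$, then $$\|\mathcal{P}_S\|_{\mathcal{F}_S\to\mathcal{F}_S}=\frac{\mu(\mu+1)\cdots(\mu+\lfloor S/2\rfloor-1)}{\lfloor S/2\rfloor!}\sim\frac{S^{\mu-1}}{2^{\mu-1}\Gamma(\mu)},\qquad S\to\infty,$$ where the equality holds for every integer $S\ge0$. In particular, $\mathcal{P}$ is not bounded on $\mathcal{F}$ for $\mu>1$.
   Context: Notation: $\mathbb{Z}_+=\{0,1,2,\dots\}$; for $\boldsymbol m=(m_1,\dots,m_d)\in\mathbb{Z}_+^d$, $|\boldsymbol m|=m_1+\dots+m_d$ and $\boldsymbol m!=m_1!\cdots m_d!$. $\mathrm{d}\gamma_d(\boldsymbol x)=(2\pi)^{-d/2}e^{-\|\boldsymbol x\|^2/2}\,\mathrm{d}\boldsymbol x$. $H_m(x)$ are the monic orthogonal (Hermite) polynomials for $(2\pi)^{-1/2}e^{-x^2/2}\,\mathrm{d}x$ on $\mathbb{R}$, and $H_{\boldsymbol m}(\boldsymbol x)=H_{m_1}(x_1)\cdots H_{m_d}(x_d)$; these form an orthogonal basis of $L^2(\mathbb{R}^d,\mathrm{d}\gamma_d)$ with $\int|H_{\boldsymbol m}|^2\,\mathrm{d}\gamma_d=\boldsymbol m!$. Set $\lambda=\sqrt{1/k}$. For $t\in\mathbb{R}$, $\mathcal{H}^t$ is the linear operator on $L^2(\mathbb{R}^d,\mathrm{d}\gamma_d)$ determined by $\mathcal{H}^t:H_{\boldsymbol m}(\boldsymbol x)\mapsto e^{2\pi|\boldsymbol m|it}H_{\boldsymbol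 m}(\lambda\boldsymbol x)$. $\mathcal{M}$ is the set of $\ell\times k$ matrices $M=[\boldsymbol m^{i,j}]$ ($1\le i\le\ell$, $1\le j\le k$) with entries $\boldsymbol m^{i,j}\in\mathbb{Z}_+^d$; put $|M|=\sum_{i,j}|\boldsymbol m^{i,j}|$ and $M!=\prod_{i,j}\boldsymbol m^{i,j}!$. $\mathcal{F}$ is the Hilbert space of functions $\varphi:\mathcal{M}\to\mathbb{C}$ with $\sum_{M\in\mathcal{M}}|\varphi(M)|^2M!<\infty$, with inner product $\langle\varphi,\psi\rangle_{\mathcal{F}}=\sum_{M\in\mathcal{M}}\varphi(M)\overline{\psi(M)}M!$ and norm $\|\cdot\|_{\mathcal F}$. The operator $\mathcal{P}$ maps a function $\varphi:\mathcal{M}\to\mathbb{C}$ to the function $\mathcal{P}\varphi:\mathcal{M}\to\mathbb{C}$, $$\mathcal{P}\varphi(M)=\sum_{N\in\mathcal{M},\,|N|=|M|}\varphi(N)\frac{P(M,N)}{M!},$$ where, for $M=[\boldsymbol m^{i,j}]$ and $N=[\boldsymbol n^{i,j}]$, $$P(M,N)=\int_{(\mathbb{R}^d)^\ell}\prod_{i=1}^{\ell}\prod_{j=1}^{k}H_{\boldsymbol m^{i,j}}(\lambda\boldsymbol x^i)H_{\boldsymbol n^{i,j}}(\lambda\boldsymbol x^i)\,\mathrm{d}\gamma_d(\boldsymbol x^1)\cdots\mathrm{d}\gamma_d(\boldsymbol x^\ell).$$ Depending on $\ell,k,d$, the operator $\mathcal{P}$ may be unbounded, hence not defined on the whole of $\mathcal{F}$.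 For each integer $S\ge0$, $\mathcal{F}_S$ is the (finite-dimensional) subspace of functions $\varphi:\mathcal{M}\to\mathbb{C}$ with $\varphi(M)=0$ whenever $|M|\ne S$. One has $\mathcal{P}(\mathcal{F}_S)\subset\mathcal{F}_S$, the spaces $\mathcal{F}_S$ are mutually orthogonal, and $\mathcal{F}$ is the closure of their direct sum. The empty product (case $\lfloor S/2\rfloor=0$) equals $1$.
   Formalization: In (2), the equivalence for a single S is stated only for S ≥ 2, since P_0 and P_1 are always projections whatever (k-1)ℓd/2 is; also stated: P_S²=P_S for all S ≥ 0 if and only if (k-1)ℓd/2=1. *)

theory Defs
  imports "HOL-Probability.Probability" "HOL-Computational_Algebra.Polynomial"
    "HOL-Library.Landau_Symbols"
begin

text \<open>
  The integers \<open>d\<close>, \<open>k\<close>, \<open>l\<close> are the cardinalities of the finite index types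
  \<open>'d\<close>, \<open>'k\<close>, \<open>'l\<close>. A multi-index is an element of \<open>nat ^ 'd\<close>, and the set of
  \<open>l \<times> k\<close> matrices with multi-index entries is the whole type \<open>nat ^ 'd ^ 'k ^ 'l\<close>;
  the entry in row \<open>i :: 'l\<close> and column \<open>j :: 'k\<close> is \<open>M $ i $ j\<close>.
\<close>

subsection \<open>Hermite polynomials and the Gaussian measure\<close>

definition hermite :: "nat \<Rightarrow> real poly" where
  "hermite = (THE H. (\<forall>n. degree (H n) = n \<and> lead_coeff (H n) = 1) \<and>
     (\<forall>m n. m \<noteq> n \<longrightarrow>
        (\<integral>x. poly (H m) x * poly (H n) x \<partial>density lborel std_normal_density) = 0))"

definition hermite_multi :: "nat ^ 'd \<Rightarrow> real ^ 'd \<Rightarrow> real" where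
  "hermite_multi m x = (\<Prod>r\<in>UNIV. poly (hermite (m $ r)) (x $ r))"

definition gauss :: "(real ^ 'd) measure" where
  "gauss = density lborel
     (\<lambda>x. ennreal ((2 * pi) powr (- real CARD('d) / 2) * exp (- (norm x)\<^sup>2 / 2)))"

definition mdeg :: "nat ^ 'd \<Rightarrow> nat" where
  "mdeg m = (\<Sum>r\<in>UNIV. m $ r)"

subsection \<open>The space \<open>L\<^sup>2\<close> of the Gaussian measure\<close>

text \<open>Elements of \<open>L\<^sup>2\<close> are represented by functions; equality in \<open>L\<^sup>2\<close> is equality almost
  everywhere.\<close>

definition L2 :: "(real ^ 'd \<Rightarrow> complex) set" where
  "L2 = {g \<in> borel_measurable borel. integrable gauss (\<lambda>x. (norm (g x))\<^sup>2)}"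

definition L2_norm :: "(real ^ 'd \<Rightarrow> complex) \<Rightarrow> real" where
  "L2_norm g = sqrt (\<integral>x. (norm (g x))\<^sup>2 \<partial>gauss)"

text \<open>\<open>g = (\<Sum>m. \<alpha> m H\<^sub>m)\<close> with unconditional convergence in \<open>L\<^sup>2\<close>.\<close>

definition hermite_expansion :: "(real ^ 'd \<Rightarrow> complex) \<Rightarrow> (nat ^ 'd \<Rightarrow> complex) \<Rightarrow> bool" where
  "hermite_expansion g \<alpha> \<longleftrightarrow>
     ((\<lambda>A. L2_norm (\<lambda>x. g x - (\<Sum>m\<in>A. \<alpha> m * of_real (hermite_multi m x)))) \<longlongrightarrow> 0)
       (finite_subsets_at_top UNIV)"

text \<open>A linear operator on \<open>L\<^sup>2\<close> is determined by its values on the orthogonal basis \<open>H\<^sub>m\<close> once it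
  is bounded. Linearity and boundedness together make \<open>T\<close> compatible with almost everywhere
  equality, so \<open>hermite_flow k t g\<close> is unique up to a null set.\<close>

definition is_hermite_flow ::
    "nat \<Rightarrow> real \<Rightarrow> ((real ^ 'd \<Rightarrow> complex) \<Rightarrow> (real ^ 'd \<Rightarrow> complex)) \<Rightarrow> bool" where
  "is_hermite_flow k t T \<longleftrightarrow>
     (\<forall>g\<in>L2. T g \<in> L2) \<and>
     (\<forall>g\<in>L2. \<forall>h\<in>L2. \<forall>a b. AE x in gauss. T (\<lambda>y. a * g y + b * h y) x = a * T g x + b * T h x) \<and>
     (\<exists>C. \<forall>g\<in>L2. L2_norm (T g) \<le> C * L2_norm g) \<and>
     (\<forall>m. AE x in gauss. T (\<lambda>y. of_real (hermite_multi m y)) x =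
        exp (2 * of_real pi * of_nat (mdeg m) * \<i> * of_real t) *
        of_real (hermite_multi m (sqrt (1 / real k) *\<^sub>R x)))"

definition hermite_flow ::
    "nat \<Rightarrow> real \<Rightarrow> (real ^ 'd \<Rightarrow> complex) \<Rightarrow> (real ^ 'd \<Rightarrow> complex)" where
  "hermite_flow k t = (SOME T. is_hermite_flow k t T)"

subsection \<open>The Hilbert space of functions of matrices\<close>

definition Mdeg :: "nat ^ 'd ^ 'k ^ 'l \<Rightarrow> nat" where
  "Mdeg M = (\<Sum>i\<in>UNIV. \<Sum>j\<in>UNIV. mdeg (M $ i $ j))"

definition Mfact :: "nat ^ 'd ^ 'k ^ 'l \<Rightarrow> real" where
  "Mfact M = (\<Prod>i\<in>UNIV. \<Prod>j\<in>UNIV. \<Prod>r\<in>UNIV. fact (M $ i $ j $ r))"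

definition F_space :: "(nat ^ 'd ^ 'k ^ 'l \<Rightarrow> complex) set" where
  "F_space = {\<phi>. (\<lambda>M. (norm (\<phi> M))\<^sup>2 * Mfact M) summable_on UNIV}"

definition F_inner ::
    "(nat ^ 'd ^ 'k ^ 'l \<Rightarrow> complex) \<Rightarrow> (nat ^ 'd ^ 'k ^ 'l \<Rightarrow> complex) \<Rightarrow> complex" where
  "F_inner \<phi> \<psi> = (\<Sum>\<^sub>\<infinity>M. \<phi> M * cnj (\<psi> M) * of_real (Mfact M))"

definition F_norm :: "(nat ^ 'd ^ 'k ^ 'l \<Rightarrow> complex) \<Rightarrow> real" where
  "F_norm \<phi> = sqrt (\<Sum>\<^sub>\<infinity>M. (norm (\<phi> M))\<^sup>2 * Mfact M)"

definition F_deg :: "nat \<Rightarrow> (nat ^ 'd ^ 'k ^ 'l \<Rightarrow> complex) set" where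
  "F_deg S = {\<phi>. \<forall>M. Mdeg M \<noteq> S \<longrightarrow> \<phi> M = 0}"

subsection \<open>The operator\<close>

definition P_kernel :: "nat ^ 'd ^ 'k ^ 'l \<Rightarrow> nat ^ 'd ^ 'k ^ 'l \<Rightarrow> real" where
  "P_kernel M N =
     (\<integral>x. (\<Prod>i\<in>UNIV. \<Prod>j\<in>UNIV.
        hermite_multi (M $ i $ j) (sqrt (1 / real CARD('k)) *\<^sub>R x i) *
        hermite_multi (N $ i $ j) (sqrt (1 / real CARD('k)) *\<^sub>R x i))
      \<partial>(\<Pi>\<^sub>M i\<in>(UNIV :: 'l set). gauss))"

definition P_op ::
    "(nat ^ 'd ^ 'k ^ 'l \<Rightarrow> complex) \<Rightarrow> (nat ^ 'd ^ 'k ^ 'l \<Rightarrow> complex)" where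
  "P_op \<phi> M = (\<Sum>N | Mdeg N = Mdeg M. \<phi> N * of_real (P_kernel M N / Mfact M))"

text \<open>The series for \<open>F_inner \<phi> (P_op \<phi>)\<close> need not converge absolutely when \<open>P_op \<phi>\<close> lies outside
  \<open>F_space\<close>. Since \<open>P_op\<close> preserves every \<open>F_deg S\<close>, it splits into the blocks below, and
  \<open>P_form\<close> sums those blocks in \<open>[0, \<infinity>]\<close>.\<close>

definition P_block :: "nat \<Rightarrow> (nat ^ 'd ^ 'k ^ 'l \<Rightarrow> complex) \<Rightarrow> complex" where
  "P_block S \<phi> = (\<Sum>M | Mdeg M = S. \<phi> M * cnj (P_op \<phi> M) * of_real (Mfact M))"

definition P_form :: "(nat ^ 'd ^ 'k ^ 'l \<Rightarrow> complex) \<Rightarrow> ennreal" where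
  "P_form \<phi> = (\<Sum>S. ennreal (Re (P_block S \<phi>)))"

subsection \<open>Projections, boundedness and operator norms\<close>

definition is_projection_on ::
    "(nat ^ 'd ^ 'k ^ 'l \<Rightarrow> complex) set \<Rightarrow>
     ((nat ^ 'd ^ 'k ^ 'l \<Rightarrow> complex) \<Rightarrow> (nat ^ 'd ^ 'k ^ 'l \<Rightarrow> complex)) \<Rightarrow> bool" where
  "is_projection_on V T \<longleftrightarrow>
     (\<forall>\<phi>\<in>V. T \<phi> \<in> V) \<and>
     (\<forall>\<phi>\<in>V. \<forall>\<psi>\<in>V. \<forall>a b. T (\<lambda>M. a * \<phi> M + b * \<psi> M) = (\<lambda>M. a * T \<phi> M + b * T \<psi> M)) \<and>
     (\<forall>\<phi>\<in>V. T (T \<phi>) = T \<phi>) \<and>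
     (\<forall>\<phi>\<in>V. \<forall>\<psi>\<in>V. F_inner (T \<phi>) \<psi> = F_inner \<phi> (T \<psi>))"

definition bounded_on ::
    "(nat ^ 'd ^ 'k ^ 'l \<Rightarrow> complex) set \<Rightarrow>
     ((nat ^ 'd ^ 'k ^ 'l \<Rightarrow> complex) \<Rightarrow> (nat ^ 'd ^ 'k ^ 'l \<Rightarrow> complex)) \<Rightarrow> bool" where
  "bounded_on V T \<longleftrightarrow> (\<exists>C. \<forall>\<phi>\<in>V. F_norm (T \<phi>) \<le> C * F_norm \<phi>)"

text \<open>The supremum is meaningful only for \<open>T\<close> that is \<open>bounded_on\<close> \<open>V\<close>.\<close>

definition op_norm_on ::
    "(nat ^ 'd ^ 'k ^ 'l \<Rightarrow> complex) set \<Rightarrow>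
     ((nat ^ 'd ^ 'k ^ 'l \<Rightarrow> complex) \<Rightarrow> (nat ^ 'd ^ 'k ^ 'l \<Rightarrow> complex)) \<Rightarrow> real" where
  "op_norm_on V T = Sup {F_norm (T \<phi>) | \<phi>. \<phi> \<in> V \<and> F_norm \<phi> \<le> 1}"

end

theory Submission
  imports Defs "HOL-Real_Asymp.Real_Asymp"
begin

text \<open>
  The kernel \<open>P(M,N)\<close> has an explicit Gaussian generating function, and that function diagonalizes
  the operator.

  \<^bold>\<open>The spectrum.\<close> Write \<open>a = (i,j,r)\<close> for the position of a number in a matrix of multi-indices, and
  read a function \<open>\<phi>\<close> supported in one degree as the polynomial \<open>\<Sum>\<^sub>M \<phi>(M) w\<^sup>M\<close> in variables \<open>w\<^sub>a\<close>. Let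
  \<open>u\<close> be the vector obtained from \<open>w\<close> by averaging over \<open>j\<close>, and \<open>v = w - u\<close>. Integration by parts
  (\<open>stein\<close>) gives a recursion for \<open>P(M,N)\<close> in \<open>M\<close> (\<open>kernel_mi_step\<close>) that says
  \<open>\<Sum> P(M,N) w\<^sup>M w'\<^sup>N / (M! N!) = exp (u \<cdot> u' - |v|\<^sup>2 / 2 - |v'|\<^sup>2 / 2)\<close>.
  Up to restriction to the degree of \<open>f\<close>, the operator applies the differential operator \<open>f(\<partial>/\<partial>w')\<close> to
  this exponential and puts \<open>w' = 0\<close>. Take \<open>f = |v|\<^sup>2\<^sup>p h(u)\<close> with \<open>h\<close> homogeneous of degree \<open>S - 2p\<close>.
  The result is \<open>h(u) e\<close> to the \<open>- |v|\<^sup>2 / 2\<close>, times the value at \<open>0\<close> of the \<open>p\<close>-th power of the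
  Laplacian in \<open>v\<close> of that Gaussian. The vector \<open>v\<close> ranges over a space of dimension
  \<open>(k-1) l d = 2\<mu>\<close>, so this value is \<open>(-2)\<^sup>p \<mu>(\<mu>+1)\<dots>(\<mu>+p-1)\<close>; and the part of degree \<open>S\<close> of the Gaussian
  factor contributes \<open>(-1/2)\<^sup>p |v|\<^sup>2\<^sup>p / p!\<close>. Hence \<open>f\<close> is an eigenvector with eigenvalue
  \<open>\<mu>(\<mu>+1)\<dots>(\<mu>+p-1) / p!\<close> (\<open>kernel_op_eigenfunction\<close>). The same recursion shows that the range of
  the operator in degree \<open>S\<close> is spanned by such \<open>f\<close> with \<open>p \<le> S/2\<close> (\<open>kernel_column_homspan\<close>), and
  the operator is selfadjoint for the weight \<open>M!\<close>.

  For \<open>\<mu> = 1\<close> all these eigenvalues are \<open>1\<close>, which makes the operator an orthogonal projection. For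
  \<open>\<mu> \<noteq> 1\<close> the eigenvalue \<open>\<mu>\<close>, present from degree \<open>2\<close> on, is different from \<open>0\<close> and \<open>1\<close>. For \<open>\<mu> > 1\<close>
  the eigenvalues increase with \<open>p\<close>, so the norm in degree \<open>S\<close> is the one with \<open>p = \<lfloor>S/2\<rfloor>\<close>; its growth
  is that of Euler's product for the Gamma function (\<open>eigenvalue_asymp\<close>).

  \<^bold>\<open>The integral identity.\<close> For a finite Hermite sum \<open>g\<close>, expanding the powers turns the spatial
  integrals into \<open>P(M,N)\<close>, and the integration over \<open>t\<close> keeps the pairs with \<open>|M| = |N|\<close>
  (\<open>energy_finite\<close>). For general \<open>g\<close> the truncated series converge in \<open>L\<^sup>2\<close>, but nothing
  guarantees convergence in \<open>L\<^sup>p\<close> for larger \<open>p\<close>, and both sides of the identity may be infinite. The two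
  inequalities are therefore obtained separately from the lower semicontinuity of the integral as a
  functional of \<open>g\<close> (\<open>energy_lsc\<close>). One direction (\<open>energy_le_P_form\<close>) damps the series by
  \<open>e\<close> to the \<open>- \<delta> |m|\<close>, which beats the polynomial growth of the operator norms, truncates, and lets \<open>\<delta> \<rightarrow> 0\<close>. The
  other (\<open>P_form_le_energy\<close>) uses the Fejer means of the series: they are finite sums, and limits
  of averages over shifts of \<open>t\<close>, so by convexity they do not increase the integral.
\<close>

section \<open>Hermite polynomials in one variable\<close>

abbreviation std_gauss :: "real measure" where
  "std_gauss \<equiv> density lborel (\<lambda>x. ennreal (std_normal_density x))"

definition gauss_expect :: "real poly \<Rightarrow> real" where
  "gauss_expect p = (\<integral>x. poly p x \<partial>std_gauss)"

lemma borel_measurable_poly [measurable]: "poly (p :: real poly) \<in> borel_measurable borel"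
  by (intro borel_measurable_continuous_onI continuous_on_poly continuous_on_id)

lemma integrable_poly_std_gauss: "integrable std_gauss (poly p)"
proof -
  have "integrable lborel (\<lambda>x. \<Sum>i\<le>degree p. coeff p i * (std_normal_density x * x ^ i))"
    by (intro Bochner_Integration.integrable_sum integrable_mult_right integrable_std_normal_moment)
  also have "(\<lambda>x. \<Sum>i\<le>degree p. coeff p i * (std_normal_density x * x ^ i)) =
      (\<lambda>x. std_normal_density x * poly p x)"
    by (intro ext) (simp add: poly_altdef sum_distrib_left mult_ac)
  finally show ?thesis
    by (subst integrable_density) auto
qed

lemma gauss_expect_add: "gauss_expect (p + q) = gauss_expect p + gauss_expect q"
  unfolding gauss_expect_def poly_add
  by (intro Bochner_Integration.integral_add integrable_poly_std_gauss)

lemma gauss_expect_diff: "gauss_expect (p - q) = gauss_expect p - gauss_expect q"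
  unfolding gauss_expect_def poly_diff
  by (intro Bochner_Integration.integral_diff integrable_poly_std_gauss)

lemma gauss_expect_smult: "gauss_expect (smult c p) = c * gauss_expect p"
  unfolding gauss_expect_def poly_smult by simp

lemma gauss_expect_0 [simp]: "gauss_expect 0 = 0"
  using gauss_expect_smult[of 0 0] by simp

lemma gauss_expect_sum: "gauss_expect (\<Sum>i\<in>A. p i) = (\<Sum>i\<in>A. gauss_expect (p i))"
  by (induction A rule: infinite_finite_induct) (auto simp: gauss_expect_add)

lemma gauss_expect_monom:
  "gauss_expect (monom 1 n) = (\<integral>x. std_normal_density x * x ^ n \<partial>lborel)"
  unfolding gauss_expect_def by (subst integral_density) (auto simp: poly_monom)

lemma gauss_expect_1: "gauss_expect 1 = 1"
  using gauss_expect_monom[of 0] integral_std_normal_moment_even[of 0] by (simp add: monom_0 one_pCons)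

lemma gauss_moment_step:
  "gauss_expect (monom 1 (Suc n)) = real n * gauss_expect (monom 1 (n - 1))"
proof (cases "even n")
  case True
  then obtain k where k: "n = 2 * k" by (elim evenE)
  show ?thesis
  proof (cases k)
    case 0
    then show ?thesis using integral_std_normal_moment_odd[of 0] k by (simp add: gauss_expect_monom)
  next
    case (Suc j)
    then have "Suc n = 2 * k + 1" "n - 1 = 2 * j + 1" using k by auto
    then show ?thesis
      by (simp only: gauss_expect_monom integral_std_normal_moment_odd)
  qed
next
  case False
  then obtain k where k: "n = 2 * k + 1" by (elim oddE)
  then have "Suc n = 2 * Suc k" "n - 1 = 2 * k" by auto
  then have "gauss_expect (monom 1 (Suc n)) = fact (2 * Suc k) / (2 ^ Suc k * fact (Suc k))"
    "gauss_expect (monom 1 (n - 1)) = fact (2 * k) / (2 ^ k * fact k)"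
    by (simp_all only: gauss_expect_monom integral_std_normal_moment_even)
  moreover have "fact (2 * Suc k) / (2 ^ Suc k * fact (Suc k)) =
      (2 * real k + 1) * (fact (2 * k) / (2 ^ k * fact k))"
    by (simp add: divide_simps)
  ultimately show ?thesis using k by (simp only: of_nat_add of_nat_mult of_nat_numeral of_nat_1)
qed

text \<open>
  By linearity this is the recursion between the moments of the normal distribution, which
  \<open>gauss_moment_step\<close> reads off from their closed form.
\<close>

lemma stein: "gauss_expect (pCons 0 p) = gauss_expect (pderiv p)"
proof -
  have 1: "gauss_expect (pCons 0 (monom c n)) = gauss_expect (pderiv (monom c n))" for c n
  proof -
    have "gauss_expect (pCons 0 (monom c n)) = gauss_expect (smult c (monom 1 (Suc n)))"
      by (simp add: smult_monom monom_Suc)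
    also have "\<dots> = gauss_expect (smult (of_nat n * c) (monom 1 (n - 1)))"
      by (simp add: gauss_expect_smult gauss_moment_step)
    finally show ?thesis by (simp add: pderiv_monom smult_monom)
  qed
  have pC: "pCons 0 (sum f A) = (\<Sum>i\<in>A. pCons 0 (f i))" for f :: "nat \<Rightarrow> real poly" and A
  proof -
    have "[:0, 1:] * sum f A = (\<Sum>i\<in>A. [:0, 1:] * f i)" by (rule sum_distrib_left)
    then show ?thesis by simp
  qed
  have pd: "pderiv (sum f A) = (\<Sum>i\<in>A. pderiv (f i))" for f :: "nat \<Rightarrow> real poly" and A
    by (induction A rule: infinite_finite_induct) (auto simp: pderiv_add)
  have "gauss_expect (pCons 0 (\<Sum>i\<le>degree p. monom (coeff p i) i)) =
      gauss_expect (pderiv (\<Sum>i\<le>degree p. monom (coeff p i) i))"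
    by (simp only: pC pd gauss_expect_sum 1)
  then show ?thesis by (simp only: poly_as_sum_of_monoms)
qed

primrec hermite_poly :: "nat \<Rightarrow> real poly" where
  "hermite_poly 0 = 1"
| "hermite_poly (Suc n) = pCons 0 (hermite_poly n) - pderiv (hermite_poly n)"

lemma hermite_poly_degree_lead: "degree (hermite_poly n) = n \<and> lead_coeff (hermite_poly n) = 1"
proof (induction n)
  case (Suc n)
  have nz: "hermite_poly n \<noteq> 0" using Suc by auto
  have c1: "degree (pCons 0 (hermite_poly n)) = Suc n" using Suc nz by simp
  have c2: "degree (pderiv (hermite_poly n)) < Suc n"
    using Suc degree_pderiv[of "hermite_poly n"] by auto
  have d: "degree (hermite_poly (Suc n)) = Suc n"
    unfolding hermite_poly.simps using c1 c2 degree_add_eq_left[of "- pderiv (hermite_poly n)" "pCons 0 (hermite_poly n)"] by simp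
  moreover have "coeff (hermite_poly n) n = 1" using Suc by metis
  then have "coeff (hermite_poly (Suc n)) (Suc n) = 1"
    using c2 by (simp add: coeff_eq_0 coeff_pCons)
  ultimately show ?case by simp
qed simp

lemma pderiv_hermite_poly: "pderiv (hermite_poly (Suc n)) = smult (of_nat (Suc n)) (hermite_poly n)"
proof (induction n)
  case 0
  show ?case by (simp add: pderiv_pCons one_pCons)
next
  case (Suc n)
  have "pderiv (hermite_poly (Suc (Suc n))) =
      hermite_poly (Suc n) + pCons 0 (pderiv (hermite_poly (Suc n))) - pderiv (pderiv (hermite_poly (Suc n)))"
    by (subst hermite_poly.simps(2)) (simp only: pderiv_diff pderiv_pCons)
  also have "\<dots> = hermite_poly (Suc n) + smult (of_nat (Suc n)) (hermite_poly (Suc n))"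
    unfolding Suc.IH by (simp only: pderiv_smult smult_diff_right smult_pCons mult_zero_right hermite_poly.simps add_diff_eq)
  also have "\<dots> = smult (of_nat (Suc (Suc n))) (hermite_poly (Suc n))"
    by (simp only: of_nat_Suc[of "Suc n"] smult_add_left smult_1_left)
  finally show ?case .
qed

lemma pderiv_hermite_poly_pred: "pderiv (hermite_poly n) = smult (of_nat n) (hermite_poly (n - 1))"
proof (cases n)
  case (Suc k)
  then show ?thesis by (simp only: pderiv_hermite_poly diff_Suc_1)
qed simp

text \<open>
  The operators \<open>q \<mapsto> x q - q'\<close>, which raises the Hermite index, and \<open>q \<mapsto> q'\<close> are adjoint to each
  other: this is Stein's identity for the product \<open>H\<^sub>n q\<close>.
\<close>

lemma gauss_expect_hermite_poly_step: "gauss_expect (hermite_poly (Suc n) * q) = gauss_expect (hermite_poly n * pderiv q)"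
proof -
  have "gauss_expect (hermite_poly (Suc n) * q) = gauss_expect (pCons 0 (hermite_poly n * q)) - gauss_expect (pderiv (hermite_poly n) * q)"
    by (simp add: left_diff_distrib gauss_expect_diff)
  also have "\<dots> = gauss_expect (hermite_poly n * pderiv q)"
    by (simp only: stein pderiv_mult gauss_expect_add mult.commute[of q "pderiv (hermite_poly n)"] add_diff_cancel_right')
  finally show ?thesis .
qed

lemma hermite_poly_orthogonal: "gauss_expect (hermite_poly m * hermite_poly n) = (if m = n then fact n else 0)"
proof (induction m arbitrary: n)
  case 0
  show ?case
  proof (cases n)
    case (Suc k)
    have "gauss_expect (hermite_poly n * 1) = gauss_expect (hermite_poly k * pderiv 1)"
      unfolding Suc by (rule gauss_expect_hermite_poly_step)
    then show ?thesis using Suc by (simp del: hermite_poly.simps(2))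
  qed (simp add: gauss_expect_1)
next
  case (Suc m)
  have "gauss_expect (hermite_poly (Suc m) * hermite_poly n) = real n * gauss_expect (hermite_poly m * hermite_poly (n - 1))"
    by (simp only: gauss_expect_hermite_poly_step pderiv_hermite_poly_pred mult_smult_right gauss_expect_smult)
  also have "\<dots> = (if Suc m = n then fact n else 0)"
    unfolding Suc by (cases n) auto
  finally show ?case .
qed

text \<open>
  Monic polynomials \<open>H 0, \<dots>, H n\<close> with \<open>H m\<close> of degree \<open>m\<close> span the polynomials of degree at most \<open>n\<close>;
  the induction on \<open>n\<close> removes the leading term.
\<close>

lemma gauss_expect_orthogonal_low_degree:
  assumes "\<And>m. m \<le> n \<Longrightarrow> gauss_expect (q * H m) = 0" "\<And>m. degree (H m) = m \<and> lead_coeff (H m) = 1"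
    "degree p \<le> n"
  shows "gauss_expect (q * p) = 0"
  using assms(1,3)
proof (induction n arbitrary: p)
  case 0
  then obtain a where "p = [:a:]" by (auto elim: degree_eq_zeroE)
  moreover obtain b where "H 0 = [:b:]" using assms(2)[of 0] by (auto elim: degree_eq_zeroE)
  moreover have "b = 1" using calculation assms(2)[of 0] by simp
  ultimately have "q * p = smult a (q * H 0)" by simp
  then show ?case using 0 by (simp add: gauss_expect_smult)
next
  case (Suc n)
  \<comment> \<open>Subtracting the leading term lowers the degree.\<close>
  define r where "r = p - smult (coeff p (Suc n)) (H (Suc n))"
  have dr: "degree r \<le> n"
  proof (rule degree_le, intro allI impI)
    fix i assume "n < i"
    then show "coeff r i = 0"
      using Suc.prems(2) assms(2)[of "Suc n"]
      by (cases "i = Suc n") (auto simp: r_def coeff_eq_0)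
  qed
  have "gauss_expect (q * r) = 0" using Suc dr by auto
  moreover have "q * p = q * r + smult (coeff p (Suc n)) (q * H (Suc n))"
    by (simp add: r_def algebra_simps)
  ultimately show ?case using Suc.prems(1)[of "Suc n"] by (simp add: gauss_expect_add gauss_expect_smult)
qed

text \<open>
  A polynomial that vanishes almost everywhere has infinitely many zeros.
\<close>

lemma gauss_expect_square_pos:
  assumes "gauss_expect (p * p) = 0"
  shows "p = 0"
proof (rule ccontr)
  assume "p \<noteq> 0"
  have fin: "finite {x. poly p x = 0}" by (rule poly_roots_finite[OF \<open>p \<noteq> 0\<close>])
  have "(AE x in std_gauss. poly (p * p) x = 0)"
    using assms integrable_poly_std_gauss[of "p * p"] unfolding gauss_expect_def
    by (subst (asm) integral_nonneg_eq_0_iff_AE) auto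
  then have "AE x in lborel. poly p x = 0"
    by (subst (asm) AE_density) (auto simp: normal_density_pos)
  moreover have "AE x in lborel. x \<notin> {x. poly p x = 0}"
    by (rule AE_not_in) (use fin in \<open>auto intro: finite_imp_null_set_lborel\<close>)
  ultimately have "AE x in (lborel :: real measure). False" by eventually_elim auto
  then show False by (simp add: ae_filter_eq_bot_iff flip: trivial_limit_def)
qed

text \<open>
  Two orthogonal monic families agree: the difference \<open>r\<close> of their \<open>n\<close>-th members has degree below
  \<open>n\<close>, hence is orthogonal to both, and so to itself.
\<close>

lemma hermite_eq_hermite_poly: "hermite = hermite_poly"
  unfolding hermite_def
proof (rule the_equality, goal_cases)
  case 1
  have "(\<integral>x. poly (hermite_poly m) x * poly (hermite_poly n) x \<partial>std_gauss) = 0" if "m \<noteq> n" for m n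
    using hermite_poly_orthogonal[of m n] that by (simp add: gauss_expect_def)
  then show ?case using hermite_poly_degree_lead by blast
next
  case (2 H)
  then have deg: "\<And>n. degree (H n) = n \<and> lead_coeff (H n) = 1"
    and orth: "\<And>m n. m \<noteq> n \<Longrightarrow> gauss_expect (H m * H n) = 0"
    unfolding gauss_expect_def poly_mult by blast+
  show ?case
  proof
    fix n
    show "H n = hermite_poly n"
    proof (cases n)
      case 0
      obtain b where "H 0 = [:b:]" using deg[of 0] by (auto elim: degree_eq_zeroE)
      then show ?thesis using deg[of 0] 0 by (simp add: one_pCons)
    next
      case (Suc k)
      define r where "r = H n - hermite_poly n"
      have dr: "degree r \<le> k"
      proof (rule degree_le, intro allI impI)
        fix i assume "k < i"
        then show "coeff r i = 0"
          using Suc deg[of n] hermite_poly_degree_lead[of n]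
          by (cases "i = n") (auto simp: r_def coeff_eq_0 simp del: hermite_poly.simps(2))
      qed
      have "gauss_expect (H n * r) = 0"
        by (rule gauss_expect_orthogonal_low_degree[OF _ deg dr]) (use orth Suc in auto)
      moreover have "gauss_expect (hermite_poly n * r) = 0"
        by (rule gauss_expect_orthogonal_low_degree[OF _ hermite_poly_degree_lead dr]) (use hermite_poly_orthogonal Suc in \<open>auto simp del: hermite_poly.simps(2)\<close>)
      ultimately have "gauss_expect (r * r) = 0"
        unfolding r_def by (simp add: left_diff_distrib gauss_expect_diff)
      then show ?thesis using gauss_expect_square_pos r_def by fastforce
    qed
  qed
qed

section \<open>Functions of multi-indices as polynomials\<close>

definition mi_deg :: "('a::finite \<Rightarrow> nat) \<Rightarrow> nat" where
  "mi_deg n = (\<Sum>a\<in>UNIV. n a)"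

definition mi_fact :: "('a::finite \<Rightarrow> nat) \<Rightarrow> real" where
  "mi_fact n = (\<Prod>a\<in>UNIV. fact (n a))"

text \<open>
  A function \<open>f\<close> of multi-indices stands for the formal power series \<open>\<Sum>\<^sub>n f(n) w\<^sup>n\<close> in variables indexed by
  \<open>'a\<close>. Under this reading \<open>mulX a\<close> is multiplication by \<open>w\<^sub>a\<close> and \<open>derX a\<close> is the partial derivative with
  respect to \<open>w\<^sub>a\<close>.
\<close>

type_synonym 'a mfun = "('a \<Rightarrow> nat) \<Rightarrow> complex"

definition mulX :: "'a \<Rightarrow> 'a mfun \<Rightarrow> 'a mfun" where
  "mulX a f n = (if n a = 0 then 0 else f (n(a := n a - 1)))"

definition derX :: "'a \<Rightarrow> 'a mfun \<Rightarrow> 'a mfun" where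
  "derX a f n = of_nat (Suc (n a)) * f (n(a := Suc (n a)))"

lemma mi_deg_Suc: "mi_deg (n(a := Suc (n a))) = Suc (mi_deg n)"
proof -
  have "mi_deg (n(a := Suc (n a))) = (\<Sum>b\<in>UNIV. n b + (if b = a then 1 else 0))"
    unfolding mi_deg_def by (rule sum.cong) auto
  then show ?thesis by (simp add: mi_deg_def sum.distrib)
qed

lemma mi_fact_Suc: "mi_fact (n(a := Suc (n a))) = real (Suc (n a)) * mi_fact n"
proof -
  have "mi_fact (n(a := Suc (n a))) = (\<Prod>b\<in>UNIV. fact (n b) * (if b = a then real (Suc (n b)) else 1))"
    unfolding mi_fact_def by (rule prod.cong) (auto simp: algebra_simps)
  then show ?thesis by (simp add: mi_fact_def prod.distrib)
qed

lemma mi_pred_decomp: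
  assumes "n a \<noteq> 0"
  obtains n' where "n = n'(a := Suc (n' a))" "n(a := n a - 1) = n'"
proof
  show "n = (n(a := n a - 1))(a := Suc ((n(a := n a - 1)) a))" using assms by auto
qed simp

lemma mi_deg_pred: "n a \<noteq> 0 \<Longrightarrow> Suc (mi_deg (n(a := n a - 1))) = mi_deg n"
  by (elim mi_pred_decomp) (simp add: mi_deg_Suc)

lemma mi_fact_pos: "mi_fact n > 0"
  unfolding mi_fact_def by (intro prod_pos) auto

lemma le_mi_deg: "n a \<le> mi_deg n"
  unfolding mi_deg_def by (rule member_le_sum) auto

lemma mi_deg_0_iff: "mi_deg n = 0 \<longleftrightarrow> n = (\<lambda>_. 0)"
  unfolding mi_deg_def by auto

lemma finite_mi_deg [simp]: "finite {n :: 'a::finite \<Rightarrow> nat. mi_deg n = S}"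
proof (rule finite_subset)
  show "{n :: 'a \<Rightarrow> nat. mi_deg n = S} \<subseteq> Pi\<^sub>E UNIV (\<lambda>_. {..S})"
    using le_mi_deg by (auto simp: PiE_def Pi_def)
  show "finite (Pi\<^sub>E (UNIV :: 'a set) (\<lambda>_. {..S}))" by (rule finite_PiE) auto
qed

lemma mulX_zero_fun [simp]: "mulX a (\<lambda>n. 0) = (\<lambda>n. 0)"
  by (auto simp: mulX_def)

lemma mulX_add: "mulX a (\<lambda>n. f n + g n) = (\<lambda>n. mulX a f n + mulX a g n)"
  by (auto simp: mulX_def)

lemma mulX_cmul: "mulX a (\<lambda>n. c * f n) = (\<lambda>n. c * mulX a f n)"
  by (auto simp: mulX_def)

lemma mulX_sum: "mulX a (\<lambda>n. \<Sum>b\<in>B. g b n) = (\<lambda>n. \<Sum>b\<in>B. mulX a (g b) n)"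
  by (auto simp: mulX_def)

lemma derX_add: "derX a (\<lambda>n. f n + g n) = (\<lambda>n. derX a f n + derX a g n)"
  by (auto simp: derX_def algebra_simps)

lemma derX_cmul: "derX a (\<lambda>n. c * f n) = (\<lambda>n. c * derX a f n)"
  by (auto simp: derX_def algebra_simps)

lemma derX_sum: "derX a (\<lambda>n. \<Sum>b\<in>B. g b n) = (\<lambda>n. \<Sum>b\<in>B. derX a (g b) n)"
  by (auto simp: derX_def sum_distrib_left)

lemma mulX_commute: "mulX a (mulX b f) = mulX b (mulX a f)"
  by (cases "a = b") (auto simp: mulX_def fun_upd_twist)

lemma derX_mulX: "derX a (mulX b f) = (\<lambda>n. mulX b (derX a f) n + (if a = b then f n else 0))"
proof
  fix n
  show "derX a (mulX b f) n = mulX b (derX a f) n + (if a = b then f n else 0)"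
  proof (cases "a = b")
    case True
    then show ?thesis by (cases "n a") (auto simp: mulX_def derX_def algebra_simps fun_upd_idem)
  next
    case False
    then show ?thesis by (auto simp: mulX_def derX_def fun_upd_twist)
  qed
qed

lemma mulX_local:
  assumes "\<And>m. mi_deg m = S \<Longrightarrow> f m = g m" "mi_deg n = Suc S"
  shows "mulX a f n = mulX a g n"
  using assms mi_deg_pred[of n a] by (auto simp: mulX_def)

lemma mulX_support:
  assumes "\<And>m. f m \<noteq> 0 \<Longrightarrow> mi_deg m = S" "mulX a f n \<noteq> 0"
  shows "mi_deg n = Suc S"
  using assms mi_deg_pred[of n a] by (auto simp: mulX_def split: if_splits)

lemma euler_operator: "(\<Sum>a\<in>UNIV. mulX a (derX a f) n) = of_nat (mi_deg n) * f n"
proof -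
  have "mulX a (derX a f) n = of_nat (n a) * f n" for a
    by (auto simp: mulX_def derX_def)
  then show ?thesis by (simp add: mi_deg_def sum_distrib_right)
qed

text \<open>
  Together with \<open>sum_derX_reindex\<close> this moves a multiplication or a derivative from one factor of
  a sum over a degree to the other. There \<open>n(a := n a - 1)\<close> is a true predecessor or is multiplied
  by \<open>0\<close>.
\<close>

lemma sum_mulX_reindex:
  "(\<Sum>n | mi_deg n = Suc S. mulX a f n * g n) = (\<Sum>n | mi_deg n = S. f n * g (n(a := Suc (n a))))"
proof -
  have pred: "mi_deg (n(a := n a - 1)) = S" if "mi_deg n = Suc S" "n a \<noteq> 0" for n
    using mi_deg_pred[of n a] that by simp
  have "(\<Sum>n | mi_deg n = Suc S. mulX a f n * g n) =
      (\<Sum>n | mi_deg n = Suc S \<and> n a \<noteq> 0. f (n(a := n a - 1)) * g n)"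
    by (rule sum.mono_neutral_cong_right) (auto simp: mulX_def)
  also have "\<dots> = (\<Sum>n | mi_deg n = S. f n * g (n(a := Suc (n a))))"
    by (rule sum.reindex_bij_witness[where i = "\<lambda>n. n(a := Suc (n a))" and j = "\<lambda>n. n(a := n a - 1)"])
      (use pred in \<open>auto simp: mi_deg_Suc\<close>)
  finally show ?thesis .
qed

lemma sum_derX_reindex:
  "(\<Sum>n | mi_deg n = Suc S. of_nat (n a) * f n * g (n(a := n a - 1))) = (\<Sum>n | mi_deg n = S. derX a f n * g n)"
proof -
  have "(\<Sum>n | mi_deg n = Suc S. of_nat (n a) * f n * g (n(a := n a - 1))) =
      (\<Sum>n | mi_deg n = Suc S. mulX a g n * (of_nat (n a) * f n))"
    by (rule sum.cong) (auto simp: mulX_def)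
  also have "\<dots> = (\<Sum>n | mi_deg n = S. derX a f n * g n)"
    unfolding sum_mulX_reindex by (simp add: derX_def mult_ac)
  finally show ?thesis .
qed

section \<open>Kernels with a Gaussian generating function\<close>

text \<open>
  The matrix \<open>Q\<close> is a projection of rank \<open>2\<mu>\<close>. Put \<open>v = Q w\<close> and \<open>u = w - v\<close>. The last assumption is the
  first-order differential equation
  \<open>\<partial>G/\<partial>w\<^sub>a = (u'\<^sub>a - v\<^sub>a) G\<close> for the generating function \<open>G = \<Sum> P m n w\<^sup>m w'\<^sup>n / (m! n!)\<close>. With
  \<open>P_0_0\<close> and the symmetry of \<open>P\<close> it says that
  \<open>G = exp (u \<cdot> u' - |v|\<^sup>2 / 2 - |v'|\<^sup>2 / 2)\<close>. The proofs work with the recursion, hence with finite sums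
  of coefficients. The assumption \<open>Q_not_id\<close> provides a nonzero \<open>u\<^sub>a\<close>.
\<close>

locale gauss_kernel =
  fixes Q :: "'a::finite \<Rightarrow> 'a \<Rightarrow> complex" and P :: "('a \<Rightarrow> nat) \<Rightarrow> ('a \<Rightarrow> nat) \<Rightarrow> real" and \<mu> :: real
  assumes Q_sym: "Q a b = Q b a"
    and Q_idem: "(\<Sum>c\<in>UNIV. Q a c * Q c b) = Q a b"
    and Q_trace: "(\<Sum>a\<in>UNIV. Q a a) = of_real (2 * \<mu>)"
    and mu_pos: "\<mu> > 0"
    and Q_not_id: "\<exists>a. Q a a \<noteq> 1"
    and P_0_0: "P (\<lambda>_. 0) (\<lambda>_. 0) = 1"
    and P_sym: "P m n = P n m"
    and P_step: "complex_of_real (P (m(a := Suc (m a))) n) =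
      (\<Sum>b\<in>UNIV. ((if a = b then 1 else 0) - Q a b) * of_nat (n b) * of_real (P m (n(b := n b - 1)))) -
      (\<Sum>b\<in>UNIV. Q a b * of_nat (m b) * of_real (P (m(b := m b - 1)) n))"
begin

definition R :: "'a \<Rightarrow> 'a \<Rightarrow> complex" where
  "R a b = (if a = b then 1 else 0) - Q a b"

lemma R_sym: "R a b = R b a"
  using Q_sym[of a b] by (auto simp: R_def)

lemma Q_R: "(\<Sum>c\<in>UNIV. Q a c * R c b) = 0"
proof -
  have "(\<Sum>c\<in>UNIV. Q a c * R c b) = (\<Sum>c\<in>UNIV. (if c = b then Q a c else 0)) - (\<Sum>c\<in>UNIV. Q a c * Q c b)"
    unfolding sum_subtractf[symmetric] by (rule sum.cong) (auto simp: R_def algebra_simps)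
  then show ?thesis by (simp add: Q_idem)
qed

lemma R_Q: "(\<Sum>c\<in>UNIV. R a c * Q c b) = 0"
  using Q_R[of b a] Q_sym R_sym by (simp add: mult.commute)

lemma R_R: "(\<Sum>c\<in>UNIV. R a c * R c b) = R a b"
proof -
  have "(\<Sum>c\<in>UNIV. R a c * R c b) = (\<Sum>c\<in>UNIV. (if c = a then R c b else 0)) - (\<Sum>c\<in>UNIV. Q a c * R c b)"
    unfolding sum_subtractf[symmetric] by (rule sum.cong) (auto simp: R_def[of a] algebra_simps)
  then show ?thesis by (simp add: Q_R)
qed

text \<open>
  In the variables \<open>u\<close> and \<open>v\<close>: \<open>mulR a\<close> and \<open>mulQ a\<close> multiply by \<open>u\<^sub>a\<close> and \<open>v\<^sub>a\<close>, \<open>derQ a\<close> differentiates in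
  the direction of column \<open>a\<close> of \<open>Q\<close>, \<open>quad\<close> multiplies by \<open>|v|\<^sup>2\<close>, and \<open>eulerQ\<close> is the Euler operator
  \<open>v \<cdot> \<partial>/\<partial>v\<close>. All these identities are commutation rules of multiplications and derivatives.
\<close>

definition mulR :: "'a \<Rightarrow> 'a mfun \<Rightarrow> 'a mfun" where
  "mulR a f = (\<lambda>n. \<Sum>b\<in>UNIV. R a b * mulX b f n)"
definition mulQ :: "'a \<Rightarrow> 'a mfun \<Rightarrow> 'a mfun" where
  "mulQ a f = (\<lambda>n. \<Sum>b\<in>UNIV. Q a b * mulX b f n)"
definition derQ :: "'a \<Rightarrow> 'a mfun \<Rightarrow> 'a mfun" where
  "derQ a f = (\<lambda>n. \<Sum>b\<in>UNIV. Q a b * derX b f n)"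
definition quad :: "'a mfun \<Rightarrow> 'a mfun" where
  "quad f = (\<lambda>n. \<Sum>a\<in>UNIV. mulQ a (mulX a f) n)"
definition eulerQ :: "'a mfun \<Rightarrow> 'a mfun" where
  "eulerQ f = (\<lambda>n. \<Sum>a\<in>UNIV. mulX a (derQ a f) n)"

lemmas lin_simps = mulX_add mulX_cmul mulX_sum derX_add derX_cmul derX_sum

lemma mulQ_add: "mulQ a (\<lambda>n. f n + g n) = (\<lambda>n. mulQ a f n + mulQ a g n)"
  and derQ_add: "derQ a (\<lambda>n. f n + g n) = (\<lambda>n. derQ a f n + derQ a g n)"
  by (simp_all add: mulQ_def derQ_def lin_simps distrib_left sum.distrib)

lemma mulR_cmul: "mulR a (\<lambda>n. c * f n) = (\<lambda>n. c * mulR a f n)"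
  and mulQ_cmul: "mulQ a (\<lambda>n. c * f n) = (\<lambda>n. c * mulQ a f n)"
  and derQ_cmul: "derQ a (\<lambda>n. c * f n) = (\<lambda>n. c * derQ a f n)"
  by (simp_all add: mulR_def mulQ_def derQ_def lin_simps sum_distrib_left mult_ac)

lemma mulR_sum: "mulR a (\<lambda>n. \<Sum>b\<in>B. g b n) = (\<lambda>n. \<Sum>b\<in>B. mulR a (g b) n)"
  and mulQ_sum: "mulQ a (\<lambda>n. \<Sum>b\<in>B. g b n) = (\<lambda>n. \<Sum>b\<in>B. mulQ a (g b) n)"
  and derQ_sum: "derQ a (\<lambda>n. \<Sum>b\<in>B. g b n) = (\<lambda>n. \<Sum>b\<in>B. derQ a (g b) n)"
  unfolding mulR_def mulQ_def derQ_def lin_simps sum_distrib_left by (rule ext, rule sum.swap)+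

lemma quad_add: "quad (\<lambda>n. f n + g n) = (\<lambda>n. quad f n + quad g n)"
  by (simp add: quad_def lin_simps mulQ_add sum.distrib)

lemma quad_cmul: "quad (\<lambda>n. c * f n) = (\<lambda>n. c * quad f n)"
  by (simp add: quad_def lin_simps mulQ_cmul sum_distrib_left)

lemma quad_sum: "quad (\<lambda>n. \<Sum>b\<in>B. g b n) = (\<lambda>n. \<Sum>b\<in>B. quad (g b) n)"
  unfolding quad_def lin_simps mulQ_sum by (rule ext, rule sum.swap)

lemma quadp_add: "(quad ^^ p) (\<lambda>n. f n + g n) = (\<lambda>n. (quad ^^ p) f n + (quad ^^ p) g n)"
  by (induction p) (auto simp: quad_add)

lemma quadp_cmul: "(quad ^^ p) (\<lambda>n. c * f n) = (\<lambda>n. c * (quad ^^ p) f n)"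
  by (induction p) (auto simp: quad_cmul)

lemma quadp_zero: "(quad ^^ p) (\<lambda>n. 0) = (\<lambda>n. 0)"
  using quadp_cmul[of p 0 "\<lambda>n. 0"] by simp

lemma mulX_mulQ: "mulX b (mulQ a f) = mulQ a (mulX b f)"
  by (simp add: mulQ_def lin_simps mulX_commute[of b])

lemma mulX_mulR: "mulX b (mulR a f) = mulR a (mulX b f)"
  by (simp add: mulR_def lin_simps mulX_commute[of b])

lemma mulX_quad: "mulX b (quad f) = quad (mulX b f)"
  by (simp add: quad_def mulX_sum mulX_mulQ mulX_commute[of b])

lemma mulQ_mulR: "mulQ a (mulR b f) = mulR b (mulQ a f)"
  unfolding mulQ_def mulX_mulR by (simp add: mulR_sum mulR_cmul)

lemma quad_mulR: "quad (mulR b f) = mulR b (quad f)"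
  by (simp add: quad_def mulR_sum mulX_mulR mulQ_mulR)

lemma quadp_mulR: "(quad ^^ p) (mulR b f) = mulR b ((quad ^^ p) f)"
  by (induction p) (auto simp: quad_mulR)

lemma derQ_mulX: "derQ a (mulX b f) = (\<lambda>n. mulX b (derQ a f) n + Q a b * f n)"
proof
  fix n
  have "derQ a (mulX b f) n = (\<Sum>c\<in>UNIV. Q a c * mulX b (derX c f) n + (if c = b then Q a c * f n else 0))"
    unfolding derQ_def derX_mulX by (rule sum.cong) (auto simp: algebra_simps)
  then show "derQ a (mulX b f) n = mulX b (derQ a f) n + Q a b * f n"
    by (simp add: sum.distrib derQ_def lin_simps)
qed

lemma derQ_mulR: "derQ a (mulR c f) = mulR c (derQ a f)"
proof
  fix n
  have "derQ a (mulR c f) n = (\<Sum>b\<in>UNIV. R c b * mulX b (derQ a f) n) + (\<Sum>b\<in>UNIV. R c b * Q b a) * f n"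
    unfolding mulR_def derQ_sum derQ_cmul derQ_mulX sum_distrib_right sum.distrib[symmetric]
    by (rule sum.cong) (auto simp: algebra_simps Q_sym[of a])
  then show "derQ a (mulR c f) n = mulR c (derQ a f) n" by (simp add: R_Q mulR_def)
qed

lemma derQ_mulQ: "derQ a (mulQ c f) = (\<lambda>n. mulQ c (derQ a f) n + Q a c * f n)"
proof
  fix n
  have "derQ a (mulQ c f) n = (\<Sum>b\<in>UNIV. Q c b * mulX b (derQ a f) n) + (\<Sum>b\<in>UNIV. Q c b * Q b a) * f n"
    unfolding mulQ_def derQ_sum derQ_cmul derQ_mulX sum_distrib_right sum.distrib[symmetric]
    by (rule sum.cong) (auto simp: algebra_simps Q_sym[of a])
  then show "derQ a (mulQ c f) n = mulQ c (derQ a f) n + Q a c * f n" by (simp add: Q_idem mulQ_def Q_sym[of a])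
qed

lemma Q_mulQ: "(\<Sum>c\<in>UNIV. Q a c * mulQ c f n) = mulQ a f n"
proof -
  have "(\<Sum>c\<in>UNIV. Q a c * mulQ c f n) = (\<Sum>b\<in>UNIV. (\<Sum>c\<in>UNIV. Q a c * Q c b) * mulX b f n)"
    unfolding mulQ_def sum_distrib_left sum_distrib_right by (subst sum.swap) (simp add: mult.assoc)
  then show ?thesis by (simp add: Q_idem mulQ_def)
qed

lemma Q_derQ: "(\<Sum>c\<in>UNIV. Q a c * derQ c f n) = derQ a f n"
proof -
  have "(\<Sum>c\<in>UNIV. Q a c * derQ c f n) = (\<Sum>b\<in>UNIV. (\<Sum>c\<in>UNIV. Q a c * Q c b) * derX b f n)"
    unfolding derQ_def sum_distrib_left sum_distrib_right by (subst sum.swap) (simp add: mult.assoc)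
  then show ?thesis by (simp add: Q_idem derQ_def)
qed

lemma R_derQ: "(\<Sum>c\<in>UNIV. R a c * derQ c f n) = 0"
proof -
  have "(\<Sum>c\<in>UNIV. R a c * derQ c f n) = (\<Sum>b\<in>UNIV. (\<Sum>c\<in>UNIV. R a c * Q c b) * derX b f n)"
    unfolding derQ_def sum_distrib_left sum_distrib_right by (subst sum.swap) (simp add: mult.assoc)
  then show ?thesis by (simp add: R_Q)
qed

lemma Q_mulR: "(\<Sum>c\<in>UNIV. Q a c * mulR c f n) = 0"
proof -
  have "(\<Sum>c\<in>UNIV. Q a c * mulR c f n) = (\<Sum>b\<in>UNIV. (\<Sum>c\<in>UNIV. Q a c * R c b) * mulX b f n)"
    unfolding mulR_def sum_distrib_left sum_distrib_right by (subst sum.swap) (simp add: mult.assoc)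
  then show ?thesis by (simp add: Q_R)
qed

lemma R_mulR: "(\<Sum>c\<in>UNIV. R a c * mulR c f n) = mulR a f n"
proof -
  have "(\<Sum>c\<in>UNIV. R a c * mulR c f n) = (\<Sum>b\<in>UNIV. (\<Sum>c\<in>UNIV. R a c * R c b) * mulX b f n)"
    unfolding mulR_def sum_distrib_left sum_distrib_right by (subst sum.swap) (simp add: mult.assoc)
  then show ?thesis by (simp add: R_R mulR_def)
qed

lemma derQ_quad: "derQ a (quad f) = (\<lambda>n. quad (derQ a f) n + 2 * mulQ a f n)"
proof
  fix n
  have "derQ a (quad f) n = (\<Sum>c\<in>UNIV. mulQ c (mulX c (derQ a f)) n + Q a c * mulQ c f n + Q a c * mulX c f n)"
    unfolding quad_def derQ_sum derQ_mulQ derQ_mulX mulQ_add mulQ_cmul ..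
  also have "\<dots> = quad (derQ a f) n + mulQ a f n + mulQ a f n"
    unfolding sum.distrib Q_mulQ by (simp add: quad_def mulQ_def)
  finally show "derQ a (quad f) n = quad (derQ a f) n + 2 * mulQ a f n" by simp
qed

lemma eulerQ_quad: "eulerQ (quad f) = (\<lambda>n. quad (eulerQ f) n + 2 * quad f n)"
proof
  fix n
  have "eulerQ (quad f) n = (\<Sum>a\<in>UNIV. quad (mulX a (derQ a f)) n + 2 * mulQ a (mulX a f) n)"
    unfolding eulerQ_def derQ_quad mulX_add mulX_cmul mulX_quad mulX_mulQ ..
  also have "\<dots> = quad (eulerQ f) n + 2 * quad f n"
    unfolding sum.distrib eulerQ_def quad_sum by (simp add: quad_def sum_distrib_left)
  finally show "eulerQ (quad f) n = quad (eulerQ f) n + 2 * quad f n" .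
qed

text \<open>
  The coefficient of \<open>w'\<^sup>n / n!\<close> in the generating function, as a power series in \<open>w\<close>.
\<close>

definition kernel_column :: "('a \<Rightarrow> nat) \<Rightarrow> 'a mfun" where
  "kernel_column n m = of_real (P m n / mi_fact m)"

lemma pred_over_fact:
  "of_nat (m b) * of_real (P (m(b := m b - 1)) n) / of_real (mi_fact m) = mulX b (kernel_column n) m"
proof (cases "m b = 0")
  case False
  then obtain m' where m': "m = m'(b := Suc (m' b))" "m(b := m b - 1) = m'" by (rule mi_pred_decomp)
  have "of_real (mi_fact m) = (of_nat (Suc (m' b)) :: complex) * of_real (mi_fact m')"
    unfolding m'(1) mi_fact_Suc by (simp only: of_real_mult of_real_of_nat_eq)
  moreover have "m b = Suc (m' b)" using m'(1) by (metis fun_upd_same)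
  moreover from this have "m(b := m' b) = m'" using m'(2) by simp
  ultimately show ?thesis using False mi_fact_pos[of m']
    by (simp add: mulX_def kernel_column_def del: of_nat_Suc)
qed (simp add: mulX_def)

lemma kernel_column_step:
  "kernel_column (n(a := Suc (n a))) m = mulR a (kernel_column n) m - (\<Sum>b\<in>UNIV. Q a b * (of_nat (n b) * kernel_column (n(b := n b - 1)) m))"
proof -
  have "kernel_column (n(a := Suc (n a))) m = complex_of_real (P (n(a := Suc (n a))) m) / of_real (mi_fact m)"
    unfolding kernel_column_def P_sym[of m] by simp
  also have "\<dots> = (\<Sum>b\<in>UNIV. R a b * (of_nat (m b) * of_real (P (m(b := m b - 1)) n) / of_real (mi_fact m))) -
     (\<Sum>b\<in>UNIV. Q a b * (of_nat (n b) * (of_real (P m (n(b := n b - 1))) / of_real (mi_fact m))))"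
    unfolding P_step diff_divide_distrib sum_divide_distrib R_def P_sym[of n] P_sym[of m]
    by (simp add: mult_ac)
  also have "\<dots> = mulR a (kernel_column n) m - (\<Sum>b\<in>UNIV. Q a b * (of_nat (n b) * kernel_column (n(b := n b - 1)) m))"
    unfolding pred_over_fact by (simp add: mulR_def kernel_column_def)
  finally show ?thesis .
qed

lemma derX_kernel_column_0: "derX a (kernel_column (\<lambda>_. 0)) m = - mulQ a (kernel_column (\<lambda>_. 0)) m"
proof -
  have "derX a (kernel_column (\<lambda>_. 0)) m = complex_of_real (P (m(a := Suc (m a))) (\<lambda>_. 0)) / of_real (mi_fact m)"
    unfolding derX_def kernel_column_def mi_fact_Suc using mi_fact_pos[of m] by (simp add: field_simps del: of_nat_Suc)
  also have "\<dots> = - (\<Sum>b\<in>UNIV. Q a b * (of_nat (m b) * of_real (P (m(b := m b - 1)) (\<lambda>_. 0)) / of_real (mi_fact m)))"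
    unfolding P_step by (simp add: sum_divide_distrib mult_ac)
  finally show ?thesis unfolding pred_over_fact by (simp add: mulQ_def)
qed

text \<open>
  For a polynomial \<open>f\<close> of degree \<open>S\<close> this is the power series \<open>f(\<partial>/\<partial>w') G\<close> at \<open>w' = 0\<close>. All degrees of the
  result are kept, since the rules below relate results of one degree to inputs of different degrees.
\<close>

definition kernel_apply :: "nat \<Rightarrow> 'a mfun \<Rightarrow> 'a mfun" where
  "kernel_apply S f = (\<lambda>m. \<Sum>n | mi_deg n = S. f n * kernel_column n m)"

lemma kernel_apply_add: "kernel_apply S (\<lambda>n. f n + g n) = (\<lambda>m. kernel_apply S f m + kernel_apply S g m)"
  by (simp add: kernel_apply_def distrib_right sum.distrib)

lemma kernel_apply_cmul: "kernel_apply S (\<lambda>n. c * f n) = (\<lambda>m. c * kernel_apply S f m)"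
  by (simp add: kernel_apply_def sum_distrib_left mult_ac)

lemma kernel_apply_sum: "kernel_apply S (\<lambda>n. \<Sum>b\<in>B. g b n) = (\<lambda>m. \<Sum>b\<in>B. kernel_apply S (g b) m)"
  unfolding kernel_apply_def sum_distrib_right by (rule ext, rule sum.swap)

lemma kernel_apply_mulX_0: "kernel_apply (Suc 0) (mulX a f) = mulR a (kernel_apply 0 f)"
proof
  fix m
  have "kernel_apply (Suc 0) (mulX a f) m = (\<Sum>n | mi_deg n = 0. f n * mulR a (kernel_column n) m)"
    unfolding kernel_apply_def sum_mulX_reindex
    by (rule sum.cong) (use kernel_column_step[of "\<lambda>_. 0" a m] in \<open>auto simp: mi_deg_0_iff\<close>)
  then show "kernel_apply (Suc 0) (mulX a f) m = mulR a (kernel_apply 0 f) m"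
    by (simp add: kernel_apply_def mulR_sum mulR_cmul)
qed

text \<open>
  An additional factor \<open>w'\<^sub>a\<close> in \<open>f\<close> is an additional derivative of \<open>G\<close>, which produces
  \<open>u\<^sub>a - v'\<^sub>a\<close>; at \<open>w' = 0\<close> the second term only survives when a derivative falls on it, and this
  is \<open>derQ a f\<close>. Projecting with \<open>R\<close> and \<open>Q\<close> separates the two terms in \<open>kernel_apply_mulR\<close> and
  \<open>kernel_apply_mulQ\<close>.
\<close>

lemma kernel_apply_mulX: "kernel_apply (Suc (Suc S)) (mulX a f) = (\<lambda>m. mulR a (kernel_apply (Suc S) f) m - kernel_apply S (derQ a f) m)"
proof
  fix m
  have "kernel_apply (Suc (Suc S)) (mulX a f) m = (\<Sum>n | mi_deg n = Suc S. f n * mulR a (kernel_column n) m -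
      (\<Sum>b\<in>UNIV. Q a b * (of_nat (n b) * f n * kernel_column (n(b := n b - 1)) m)))"
    unfolding kernel_apply_def sum_mulX_reindex kernel_column_step
    by (rule sum.cong) (auto simp: right_diff_distrib sum_distrib_left mult_ac)
  also have "\<dots> = mulR a (kernel_apply (Suc S) f) m -
      (\<Sum>b\<in>UNIV. Q a b * (\<Sum>n | mi_deg n = Suc S. of_nat (n b) * f n * kernel_column (n(b := n b - 1)) m))"
    unfolding sum_subtractf kernel_apply_def mulR_sum mulR_cmul sum_distrib_left by (subst (2) sum.swap) simp
  also have "(\<Sum>b\<in>UNIV. Q a b * (\<Sum>n | mi_deg n = Suc S. of_nat (n b) * f n * kernel_column (n(b := n b - 1)) m)) =
      kernel_apply S (derQ a f) m"
  proof -
    have "(\<Sum>n | mi_deg n = Suc S. of_nat (n b) * f n * kernel_column (n(b := n b - 1)) m) = kernel_apply S (derX b f) m" for b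
      using sum_derX_reindex[where g = "\<lambda>n. kernel_column n m"] by (simp add: kernel_apply_def)
    then show ?thesis by (simp add: derQ_def kernel_apply_sum kernel_apply_cmul)
  qed
  finally show "kernel_apply (Suc (Suc S)) (mulX a f) m = mulR a (kernel_apply (Suc S) f) m - kernel_apply S (derQ a f) m" .
qed

lemma kernel_apply_mulR: "kernel_apply (Suc S) (mulR c f) = mulR c (kernel_apply S f)"
proof
  fix m
  show "kernel_apply (Suc S) (mulR c f) m = mulR c (kernel_apply S f) m"
  proof (cases S)
    case 0
    have "kernel_apply (Suc 0) (mulR c f) m = (\<Sum>b\<in>UNIV. R c b * mulR b (kernel_apply 0 f) m)"
      by (subst mulR_def) (simp add: kernel_apply_sum kernel_apply_cmul kernel_apply_mulX_0)
    then show ?thesis using 0 by (simp add: R_mulR)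
  next
    case (Suc T)
    have "kernel_apply (Suc S) (mulR c f) m = (\<Sum>b\<in>UNIV. R c b * mulR b (kernel_apply S f) m) - (\<Sum>b\<in>UNIV. R c b * kernel_apply T (derQ b f) m)"
      unfolding Suc by (subst mulR_def) (simp add: kernel_apply_sum kernel_apply_cmul kernel_apply_mulX right_diff_distrib sum_subtractf)
    \<comment> \<open>Combining the directions of \<open>v\<close> with the coefficients \<open>R\<close> gives \<open>0\<close>, since \<open>R Q = 0\<close>.\<close>
    also have "(\<Sum>b\<in>UNIV. R c b * kernel_apply T (derQ b f) m) = kernel_apply T (\<lambda>n. \<Sum>b\<in>UNIV. R c b * derQ b f n) m"
      by (simp add: kernel_apply_sum kernel_apply_cmul)
    also have "\<dots> = 0" unfolding R_derQ by (simp add: kernel_apply_def)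
    finally show ?thesis by (simp add: R_mulR)
  qed
qed

lemma kernel_apply_mulQ: "kernel_apply (Suc (Suc S)) (mulQ c f) = (\<lambda>m. - kernel_apply S (derQ c f) m)"
proof
  fix m
  have "kernel_apply (Suc (Suc S)) (mulQ c f) m = (\<Sum>b\<in>UNIV. Q c b * mulR b (kernel_apply (Suc S) f) m) - (\<Sum>b\<in>UNIV. Q c b * kernel_apply S (derQ b f) m)"
    by (subst mulQ_def) (simp add: kernel_apply_sum kernel_apply_cmul kernel_apply_mulX right_diff_distrib sum_subtractf)
  also have "(\<Sum>b\<in>UNIV. Q c b * kernel_apply S (derQ b f) m) = kernel_apply S (\<lambda>n. \<Sum>b\<in>UNIV. Q c b * derQ b f n) m"
    by (simp add: kernel_apply_sum kernel_apply_cmul)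
  finally show "kernel_apply (Suc (Suc S)) (mulQ c f) m = - kernel_apply S (derQ c f) m" by (simp add: Q_mulR Q_derQ)
qed

text \<open>
  By \<open>kernel_apply_mulQ\<close> one of the two factors \<open>v\<close> turns into \<open>- \<partial>/\<partial>v\<close>, and
  \<open>- \<partial>/\<partial>v \<cdot> (v f) = - (v \<cdot> \<partial>/\<partial>v + 2\<mu>) f\<close>: the trace of \<open>Q\<close> is the dimension in which
  \<open>v\<close> varies. This is where \<open>\<mu>\<close> enters.
\<close>

lemma kernel_apply_quad: "kernel_apply (Suc (Suc S)) (quad f) = (\<lambda>m. - kernel_apply S (\<lambda>n. eulerQ f n + of_real (2 * \<mu>) * f n) m)"
proof
  fix m
  have "kernel_apply (Suc (Suc S)) (quad f) m = - kernel_apply S (\<lambda>n. \<Sum>a\<in>UNIV. mulX a (derQ a f) n + Q a a * f n) m"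
    unfolding quad_def kernel_apply_sum kernel_apply_mulQ derQ_mulX by (simp add: sum_negf)
  then show "kernel_apply (Suc (Suc S)) (quad f) m = - kernel_apply S (\<lambda>n. eulerQ f n + of_real (2 * \<mu>) * f n) m"
    by (simp only: sum.distrib eulerQ_def sum_distrib_right[symmetric] Q_trace)
qed

definition unit_fun :: "'a mfun" where
  "unit_fun n = (if n = (\<lambda>_. 0) then 1 else 0)"

text \<open>
  The homogeneous polynomials of degree \<open>a\<close> in the variables \<open>u\<close> alone.
\<close>

inductive ufree :: "nat \<Rightarrow> 'a mfun \<Rightarrow> bool" where
  ufree_one: "ufree 0 unit_fun"
| ufree_zero: "ufree a (\<lambda>n. 0)"
| ufree_add: "ufree a f \<Longrightarrow> ufree a g \<Longrightarrow> ufree a (\<lambda>n. f n + g n)"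
| ufree_cmul: "ufree a f \<Longrightarrow> ufree a (\<lambda>n. c * f n)"
| ufree_mulR: "ufree a f \<Longrightarrow> ufree (Suc a) (mulR b f)"

lemma mulR_support:
  assumes "\<And>m. f m \<noteq> 0 \<Longrightarrow> mi_deg m = S" "mulR a f n \<noteq> 0"
  shows "mi_deg n = Suc S"
proof -
  obtain b where "mulX b f n \<noteq> 0"
    using assms(2) unfolding mulR_def by (metis (mono_tags, lifting) mult_zero_right sum.neutral)
  then show ?thesis using mulX_support assms(1) by blast
qed

lemma quad_support:
  assumes "\<And>m. f m \<noteq> 0 \<Longrightarrow> mi_deg m = S" "quad f n \<noteq> 0"
  shows "mi_deg n = Suc (Suc S)"
proof -
  obtain a where "mulQ a (mulX a f) n \<noteq> 0"
    using assms(2) unfolding quad_def by (metis (mono_tags, lifting) sum.neutral)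
  then obtain b where "mulX b (mulX a f) n \<noteq> 0"
    unfolding mulQ_def by (metis (mono_tags, lifting) mult_zero_right sum.neutral)
  then show ?thesis using mulX_support[of "mulX a f" "Suc S"] mulX_support[of f S] assms(1) by blast
qed

lemma quadp_support:
  assumes "\<And>m. f m \<noteq> 0 \<Longrightarrow> mi_deg m = S" "(quad ^^ p) f n \<noteq> 0"
  shows "mi_deg n = S + 2 * p"
  using assms(2)
proof (induction p arbitrary: n)
  case (Suc p)
  then show ?case using quad_support[of "(quad ^^ p) f" "S + 2 * p" n] by auto
qed (use assms(1) in auto)

lemma ufree_support: "ufree a h \<Longrightarrow> h n \<noteq> 0 \<Longrightarrow> mi_deg n = a"
proof (induction arbitrary: n rule: ufree.induct)
  case (ufree_mulR a f b)
  then show ?case using mulR_support[of f a b n] by blast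
next
  case (ufree_add a f g)
  then show ?case by (cases "f n = 0") auto
qed (auto simp: unit_fun_def mi_deg_0_iff split: if_splits)

lemma ufree_derQ: "ufree a h \<Longrightarrow> derQ b h = (\<lambda>n. 0)"
proof (induction rule: ufree.induct)
  case ufree_one
  have "derX c unit_fun = (\<lambda>n. 0)" for c
    by (auto simp: derX_def unit_fun_def fun_eq_iff)
  then show ?case by (simp add: derQ_def)
next
  case (ufree_mulR a f c)
  then show ?case by (simp add: derQ_mulR) (simp add: mulR_def)
qed (auto simp: derQ_add derQ_cmul, simp add: derQ_def derX_def)

lemma eulerQ_quadp:
  assumes "ufree a h"
  shows "eulerQ ((quad ^^ p) h) = (\<lambda>n. of_nat (2 * p) * (quad ^^ p) h n)"
proof (induction p)
  case 0
  show ?case using ufree_derQ[OF assms] by (simp add: eulerQ_def)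
next
  case (Suc p)
  show ?case by (simp add: eulerQ_quad Suc quad_cmul algebra_simps)
qed

text \<open>
  Since \<open>|v|\<^sup>2\<^sup>p h(u)\<close> has degree \<open>2p\<close> in \<open>v\<close>, the step from \<open>p\<close> to \<open>p + 1\<close> contributes the
  factor \<open>- (2p + 2\<mu>)\<close>.
\<close>

lemma kernel_apply_quadp:
  assumes "ufree a h"
  shows "kernel_apply (a + 2 * p) ((quad ^^ p) h) = (\<lambda>m. (- 2) ^ p * of_real (pochhammer \<mu> p) * kernel_apply a h m)"
proof (induction p)
  case (Suc p)
  have "kernel_apply (a + 2 * Suc p) ((quad ^^ Suc p) h) = (\<lambda>m. - kernel_apply (a + 2 * p) (\<lambda>n. of_real (2 * (\<mu> + of_nat p)) * (quad ^^ p) h n) m)"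
    by (simp add: kernel_apply_quad eulerQ_quadp[OF assms] algebra_simps)
  then show ?case unfolding kernel_apply_cmul Suc by (simp add: pochhammer_Suc algebra_simps)
qed simp

text \<open>
  The coefficients of \<open>e\<close> to the \<open>- |v|\<^sup>2 / 2\<close> as a series in \<open>|v|\<^sup>2\<close>.
\<close>

definition exp_coeff :: "nat \<Rightarrow> complex" where
  "exp_coeff q = (- 1 / 2) ^ q / fact q"

lemma exp_coeff_0 [simp]: "exp_coeff 0 = 1"
  by (simp add: exp_coeff_def)

lemma exp_coeff_Suc: "of_nat (2 * Suc q) * exp_coeff (Suc q) = - exp_coeff q"
proof -
  have "of_nat (2 * Suc q) = (2 * of_nat (Suc q) :: complex)"
    by (simp only: of_nat_mult of_nat_numeral)
  then show ?thesis by (simp add: exp_coeff_def divide_simps del: of_nat_Suc)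
qed

lemma unit_fun_support: "unit_fun n \<noteq> 0 \<Longrightarrow> mi_deg n = 0"
  by (auto simp: unit_fun_def mi_deg_def split: if_splits)

text \<open>
  At \<open>w' = 0\<close> the generating function is the Gaussian in \<open>v\<close>. The proof compares coefficients:
  summing \<open>w\<^sub>a \<partial>G/\<partial>w\<^sub>a = - w\<^sub>a v\<^sub>a G\<close> over \<open>a\<close> gives \<open>|m|\<close> times the coefficient at \<open>m\<close> on the left, by Euler's
  identity, and coefficients of lower degree on the right. Terms with \<open>2q \<noteq> |m|\<close> vanish, so any
  cutoff \<open>K \<ge> |m|\<close> may be used.
\<close>

lemma kernel_column_0_expansion:
  "mi_deg m \<le> K \<Longrightarrow> kernel_column (\<lambda>_. 0) m = (\<Sum>q\<le>K. exp_coeff q * (quad ^^ q) unit_fun m)"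
proof (induction "mi_deg m" arbitrary: m K rule: less_induct)
  case less
  let ?p = "kernel_column (\<lambda>_. 0)"
  show ?case
  proof (cases "mi_deg m = 0")
    case True
    then have m: "m = (\<lambda>_. 0)" by (simp add: mi_deg_0_iff)
    have "(\<Sum>q\<le>K. exp_coeff q * (quad ^^ q) unit_fun m) = (\<Sum>q\<in>{0}. exp_coeff q * (quad ^^ q) unit_fun m)"
      by (rule sum.mono_neutral_right) (use quadp_support[OF unit_fun_support, where n = m] True in auto)
    also have "\<dots> = ?p m" by (simp add: m unit_fun_def kernel_column_def P_0_0 mi_fact_def)
    finally show ?thesis by simp
  next
    case False
    \<comment> \<open>The cutoff term has degree \<open>2 (K + 1) > |m|\<close>, so the shift of the summation index loses nothing.\<close>
    have zero: "(quad ^^ Suc K) unit_fun m = 0"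
      using quadp_support[OF unit_fun_support, where p = "Suc K" and n = m] less.prems by fastforce
    have IH: "?p m' = (\<Sum>q\<le>K. exp_coeff q * (quad ^^ q) unit_fun m')" if "mi_deg m' < mi_deg m" for m'
      by (rule less.hyps[OF that]) (use that less.prems in simp)
    have "of_nat (mi_deg m) * ?p m = - quad ?p m"
      unfolding euler_operator[symmetric] quad_def mulX_mulQ[symmetric]
      by (auto simp: derX_kernel_column_0 mulX_def simp flip: sum_negf intro!: sum.cong)
    also have "quad ?p m = quad (\<lambda>m. \<Sum>q\<le>K. exp_coeff q * (quad ^^ q) unit_fun m) m"
    proof -
      have "mulX b (mulX a ?p) m = mulX b (mulX a (\<lambda>m. \<Sum>q\<le>K. exp_coeff q * (quad ^^ q) unit_fun m)) m" for a b
      proof (cases "m b = 0")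
        case False
        then have l: "mi_deg (m(b := m b - 1)) < mi_deg m" using mi_deg_pred[of m b] by simp
        show ?thesis
        proof (cases "(m(b := m b - 1)) a = 0")
          case False
          have "mi_deg ((m(b := m b - 1))(a := (m(b := m b - 1)) a - 1)) < mi_deg m"
            using mi_deg_pred[of "m(b := m b - 1)" a, OF False] l by linarith
          then show ?thesis unfolding mulX_def by (auto simp: IH)
        qed (use False in \<open>auto simp: mulX_def\<close>)
      qed (auto simp: mulX_def)
      then show ?thesis by (simp add: quad_def mulQ_def)
    qed
    also have "\<dots> = (\<Sum>q\<le>K. exp_coeff q * (quad ^^ Suc q) unit_fun m)"
      by (simp add: quad_sum quad_cmul)
    also have "- \<dots> = - (\<Sum>q<K. exp_coeff q * (quad ^^ Suc q) unit_fun m)"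
      using zero by (simp add: lessThan_Suc_atMost[symmetric])
    also have "\<dots> = (\<Sum>q<K. of_nat (2 * Suc q) * exp_coeff (Suc q) * (quad ^^ Suc q) unit_fun m)"
      unfolding sum_negf[symmetric]
      by (simp only: exp_coeff_Suc mult_minus_left)
    also have "\<dots> = (\<Sum>q\<le>K. of_nat (2 * q) * exp_coeff q * (quad ^^ q) unit_fun m)"
      unfolding lessThan_Suc_atMost[symmetric] sum.lessThan_Suc_shift by simp
    also have "\<dots> = (\<Sum>q\<le>K. of_nat (mi_deg m) * (exp_coeff q * (quad ^^ q) unit_fun m))"
    proof (rule sum.cong[OF refl])
      fix q
      show "of_nat (2 * q) * exp_coeff q * (quad ^^ q) unit_fun m = of_nat (mi_deg m) * (exp_coeff q * (quad ^^ q) unit_fun m)"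
        using quadp_support[OF unit_fun_support, where p = q and n = m] by (cases "(quad ^^ q) unit_fun m = 0") auto
    qed
    finally show ?thesis using False by (simp add: sum_distrib_left[symmetric])
  qed
qed

text \<open>
  A factor \<open>u\<^sub>a\<close> passes through \<open>kernel_apply\<close>, so \<open>h(u)\<close> is sent to \<open>h(u)\<close> times the Gaussian in \<open>v\<close>.
\<close>

lemma kernel_apply_ufree_expansion:
  assumes "ufree a h" "mi_deg m \<le> K"
  shows "kernel_apply a h m = (\<Sum>q\<le>K. exp_coeff q * (quad ^^ q) h m)"
  using assms
proof (induction arbitrary: m rule: ufree.induct)
  case ufree_one
  have "{n :: 'a \<Rightarrow> nat. mi_deg n = 0} = {\<lambda>_. 0}" by (auto simp: mi_deg_0_iff)
  then have "kernel_apply 0 unit_fun m = kernel_column (\<lambda>_. 0) m" by (simp add: kernel_apply_def unit_fun_def)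
  then show ?case using kernel_column_0_expansion ufree_one by simp
next
  case (ufree_mulR a f b)
  have "mulR b (kernel_apply a f) m = mulR b (\<lambda>m. \<Sum>q\<le>K. exp_coeff q * (quad ^^ q) f m) m"
  proof -
    have "mulX c (kernel_apply a f) m = mulX c (\<lambda>m. \<Sum>q\<le>K. exp_coeff q * (quad ^^ q) f m) m" for c
    proof (cases "m c = 0")
      case False
      then have "mi_deg (m(c := m c - 1)) \<le> K"
        using ufree_mulR.prems mi_deg_pred[of m c] by simp
      then show ?thesis using False by (simp only: mulX_def ufree_mulR.IH)
    qed (simp add: mulX_def)
    then show ?thesis by (simp add: mulR_def)
  qed
  then show ?case by (simp add: kernel_apply_mulR quadp_mulR mulR_sum mulR_cmul)
next
  case (ufree_add a f g)
  then show ?case by (simp add: kernel_apply_add quadp_add distrib_left sum.distrib)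
next
  case (ufree_cmul a f c)
  then show ?case by (simp add: kernel_apply_cmul quadp_cmul sum_distrib_left mult_ac)
qed (simp_all add: kernel_apply_def quadp_zero)

definition eig :: "nat \<Rightarrow> real" where
  "eig p = pochhammer \<mu> p / fact p"

text \<open>
  Restricting the result to the degree of the input: this is \<open>P_op\<close> in the coordinates \<open>w\<close>.
\<close>

definition kernel_op :: "'a mfun \<Rightarrow> 'a mfun" where
  "kernel_op f = (\<lambda>m. kernel_apply (mi_deg m) f m)"

lemma kernel_apply_ufree_diag:
  assumes "ufree a h" "mi_deg m = a + 2 * p"
  shows "kernel_apply a h m = exp_coeff p * (quad ^^ p) h m"
proof -
  have "kernel_apply a h m = (\<Sum>q\<le>mi_deg m. exp_coeff q * (quad ^^ q) h m)"
    by (rule kernel_apply_ufree_expansion[OF assms(1) order_refl])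
  also have "\<dots> = (\<Sum>q\<in>{p}. exp_coeff q * (quad ^^ q) h m)"
    by (rule sum.mono_neutral_right) (use quadp_support[OF ufree_support[OF assms(1)], where n = m] assms(2) in auto)
  finally show ?thesis by simp
qed

text \<open>
  The factors \<open>(-2)\<^sup>p\<close> from the derivatives at \<open>0\<close> and \<open>(-1/2)\<^sup>p\<close> from the Gaussian cancel.
\<close>

lemma kernel_op_eigenfunction:
  assumes "ufree a h" "mi_deg m = a + 2 * p"
  shows "kernel_op ((quad ^^ p) h) m = of_real (eig p) * (quad ^^ p) h m"
proof -
  have "(- 2) ^ p * (- 1 / 2) ^ p = (1::complex)"
    by (simp flip: power_mult_distrib)
  then show ?thesis
    unfolding kernel_op_def assms(2) kernel_apply_quadp[OF assms(1)] kernel_apply_ufree_diag[OF assms]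
    by (simp add: eig_def exp_coeff_def divide_simps)
qed

section \<open>The range of the kernel operator and its spectral decomposition\<close>

text \<open>
  The span of the eigenfunctions \<open>|v|\<^sup>2\<^sup>p h\<^sub>p(u)\<close> in degree \<open>S\<close>. Values of \<open>f\<close> in other degrees are left
  free, which allows the columns of the kernel, power series with terms of all degrees, to be
  treated degree by degree.
\<close>

definition homspan :: "nat \<Rightarrow> 'a mfun set" where
  "homspan S = {f. \<exists>h. (\<forall>p\<le>S div 2. ufree (S - 2 * p) (h p)) \<and>
     (\<forall>m. mi_deg m = S \<longrightarrow> f m = (\<Sum>p\<le>S div 2. (quad ^^ p) (h p) m))}"

lemma homspan_zero: "(\<lambda>n. 0) \<in> homspan S"
  unfolding homspan_def
  by (rule CollectI, rule exI[of _ "\<lambda>p n. 0"]) (auto intro: ufree_zero simp: quadp_zero)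

lemma homspan_add: "f \<in> homspan S \<Longrightarrow> g \<in> homspan S \<Longrightarrow> (\<lambda>n. f n + g n) \<in> homspan S"
  unfolding homspan_def mem_Collect_eq
proof (elim exE conjE, goal_cases)
  case (1 h k)
  then show ?case
    by (intro exI[of _ "\<lambda>p n. h p n + k p n"]) (auto intro: ufree_add simp: quadp_add sum.distrib)
qed

lemma homspan_cmul: "f \<in> homspan S \<Longrightarrow> (\<lambda>n. c * f n) \<in> homspan S"
  unfolding homspan_def mem_Collect_eq
proof (elim exE conjE, goal_cases)
  case (1 h)
  then show ?case
    by (intro exI[of _ "\<lambda>p n. c * h p n"]) (auto intro: ufree_cmul simp: quadp_cmul sum_distrib_left)
qed

lemma homspan_sum: "(\<And>b. b \<in> B \<Longrightarrow> g b \<in> homspan S) \<Longrightarrow> (\<lambda>n. \<Sum>b\<in>B. g b n) \<in> homspan S"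
  by (induction B rule: infinite_finite_induct) (auto intro: homspan_add homspan_zero)

text \<open>
  A multiple of \<open>u\<^sub>a\<close> has no term of degree \<open>0\<close>.
\<close>

lemma homspan_mulR_0: "mulR a f \<in> homspan 0"
  unfolding homspan_def mem_Collect_eq
  by (rule exI[of _ "\<lambda>p n. 0"]) (auto intro: ufree_zero simp: mi_deg_0_iff mulR_def mulX_def)

lemma homspan_mulR: "f \<in> homspan S \<Longrightarrow> mulR a f \<in> homspan (Suc S)"
  unfolding homspan_def mem_Collect_eq
proof (elim exE conjE, goal_cases)
  case (1 h)
  \<comment> \<open>If \<open>S\<close> is odd, degree \<open>S + 1\<close> has one more component, and it is \<open>0\<close> here.\<close>
  define k where "k p = (if p \<le> S div 2 then mulR a (h p) else (\<lambda>n. 0))" for p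
  have "ufree (Suc S - 2 * p) (k p)" if "p \<le> Suc S div 2" for p
  proof (cases "p \<le> S div 2")
    case True
    then have "Suc S - 2 * p = Suc (S - 2 * p)" by auto
    then show ?thesis using 1(1) True by (auto simp: k_def intro: ufree_mulR)
  qed (auto simp: k_def intro: ufree_zero)
  moreover have "mulR a f m = (\<Sum>p\<le>Suc S div 2. (quad ^^ p) (k p) m)" if "mi_deg m = Suc S" for m
  proof -
    have "mulR a f m = mulR a (\<lambda>m. \<Sum>p\<le>S div 2. (quad ^^ p) (h p) m) m"
      unfolding mulR_def using mulX_local[of S f "\<lambda>m. \<Sum>p\<le>S div 2. (quad ^^ p) (h p) m"] 1(2) that by auto
    also have "\<dots> = (\<Sum>p\<le>S div 2. (quad ^^ p) (k p) m)"
      by (simp add: mulR_sum k_def quadp_mulR)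
    also have "\<dots> = (\<Sum>p\<le>Suc S div 2. (quad ^^ p) (k p) m)"
      by (rule sum.mono_neutral_left) (auto simp: k_def quadp_zero)
    finally show ?thesis .
  qed
  ultimately show ?case by blast
qed

lemma kernel_column_0_homspan: "kernel_column (\<lambda>_. 0) \<in> homspan S"
proof -
  \<comment> \<open>In degree \<open>S\<close> the Gaussian has a single term, with \<open>p = S/2\<close>, and none if \<open>S\<close> is odd.\<close>
  define h where "h p = (if 2 * p = S then (\<lambda>n. exp_coeff p * unit_fun n) else (\<lambda>n. 0))" for p
  have "ufree (S - 2 * p) (h p)" if "p \<le> S div 2" for p
    unfolding h_def using ufree_cmul[OF ufree_one, of "exp_coeff p"]
    by (auto intro: ufree_zero)
  moreover have "kernel_column (\<lambda>_. 0) m = (\<Sum>p\<le>S div 2. (quad ^^ p) (h p) m)" if "mi_deg m = S" for m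
  proof -
    have "kernel_column (\<lambda>_. 0) m = (\<Sum>q\<le>S. exp_coeff q * (quad ^^ q) unit_fun m)"
      by (rule kernel_column_0_expansion) (use that in simp)
    also have "\<dots> = (\<Sum>q\<le>S div 2. (quad ^^ q) (h q) m)"
    proof (rule sum.mono_neutral_cong_right)
      show "\<forall>i\<in>{..S} - {..S div 2}. exp_coeff i * (quad ^^ i) unit_fun m = 0"
        using quadp_support[OF unit_fun_support, where n = m] that by fastforce
      fix p assume "p \<in> {..S div 2}"
      show "exp_coeff p * (quad ^^ p) unit_fun m = (quad ^^ p) (h p) m"
        using quadp_support[OF unit_fun_support, where p = p and n = m] that by (cases "2 * p = S") (auto simp: h_def quadp_cmul quadp_zero)
    qed auto
    finally show ?thesis .
  qed
  ultimately show ?thesis unfolding homspan_def by blast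
qed

text \<open>
  Raising an index of \<open>n\<close> multiplies the column by \<open>u\<^sub>a\<close> and adds columns of lower degree in \<open>n\<close>. So no
  power of \<open>v\<close> other than those of \<open>|v|\<^sup>2\<close> in the column of \<open>0\<close> can appear.
\<close>

lemma kernel_column_homspan: "kernel_column n \<in> homspan S"
proof (induction "mi_deg n" arbitrary: n S rule: less_induct)
  case less
  show ?case
  proof (cases "mi_deg n = 0")
    case True
    then show ?thesis using kernel_column_0_homspan by (simp add: mi_deg_0_iff)
  next
    case False
    then obtain a where "n a \<noteq> 0" by (auto simp: mi_deg_def)
    then obtain n' where n': "n = n'(a := Suc (n' a))" by (rule mi_pred_decomp)
    have dn: "mi_deg n = Suc (mi_deg n')" unfolding n' by (rule mi_deg_Suc)
    have mulR: "mulR a (kernel_column n') \<in> homspan S"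
      by (cases S) (use less.hyps[of n'] dn in \<open>auto intro: homspan_mulR homspan_mulR_0\<close>)
    have "(\<lambda>m. \<Sum>b\<in>UNIV. (- (Q a b * of_nat (n' b))) * kernel_column (n'(b := n' b - 1)) m) \<in> homspan S"
    proof (rule homspan_sum)
      fix b
      show "(\<lambda>m. (- (Q a b * of_nat (n' b))) * kernel_column (n'(b := n' b - 1)) m) \<in> homspan S"
      proof (cases "n' b = 0")
        case False
        then have "mi_deg (n'(b := n' b - 1)) < mi_deg n" using mi_deg_pred[of n' b] dn by simp
        then show ?thesis by (intro homspan_cmul less.hyps)
      qed (simp add: homspan_zero)
    qed
    from homspan_add[OF mulR this]
    have "(\<lambda>m. mulR a (kernel_column n') m - (\<Sum>b\<in>UNIV. Q a b * (of_nat (n' b) * kernel_column (n'(b := n' b - 1)) m))) \<in> homspan S"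
      by (simp add: sum_negf mult.assoc)
    then show ?thesis unfolding n' kernel_column_step[abs_def] .
  qed
qed

lemma kernel_op_homspan: "\<exists>g. g \<in> homspan S \<and> (\<forall>m. mi_deg m = S \<longrightarrow> kernel_op f m = g m)"
  by (rule exI[of _ "kernel_apply S f"]) (auto simp: kernel_op_def kernel_apply_def intro!: homspan_sum homspan_cmul kernel_column_homspan)

definition mi_inner :: "nat \<Rightarrow> 'a mfun \<Rightarrow> 'a mfun \<Rightarrow> complex" where
  "mi_inner S f g = (\<Sum>m | mi_deg m = S. f m * cnj (g m) * of_real (mi_fact m))"

definition mi_nsq :: "nat \<Rightarrow> 'a mfun \<Rightarrow> real" where
  "mi_nsq S f = (\<Sum>m | mi_deg m = S. (norm (f m))\<^sup>2 * mi_fact m)"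

lemma mi_nsq_nonneg: "mi_nsq S f \<ge> 0"
  unfolding mi_nsq_def by (intro sum_nonneg mult_nonneg_nonneg) (auto intro: less_imp_le mi_fact_pos)

lemma mi_inner_self: "mi_inner S f f = of_real (mi_nsq S f)"
  unfolding mi_inner_def mi_nsq_def of_real_sum
  by (intro sum.cong refl) (simp add: complex_norm_square[symmetric] del: of_real_power)

lemma mi_inner_cong:
  "(\<And>m. mi_deg m = S \<Longrightarrow> f m = f' m) \<Longrightarrow> (\<And>m. mi_deg m = S \<Longrightarrow> g m = g' m) \<Longrightarrow> mi_inner S f g = mi_inner S f' g'"
  unfolding mi_inner_def by (intro sum.cong) auto

lemma mi_inner_cauchy_schwarz: "norm (mi_inner S f g) \<le> sqrt (mi_nsq S f) * sqrt (mi_nsq S g)"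
proof -
  let ?a = "\<lambda>f m. norm (f m) * sqrt (mi_fact m)"
  have sq: "(?a f m)\<^sup>2 = (norm (f m))\<^sup>2 * mi_fact m" for f :: "'a mfun" and m
    using mi_fact_pos[of m] by (simp add: power_mult_distrib)
  have "norm (mi_inner S f g) \<le> (\<Sum>m | mi_deg m = S. norm (f m * cnj (g m) * of_real (mi_fact m)))"
    unfolding mi_inner_def by (rule norm_sum)
  also have "\<dots> = (\<Sum>m | mi_deg m = S. ?a f m * ?a g m)"
  proof (rule sum.cong[OF refl])
    fix m :: "'a \<Rightarrow> nat"
    have "sqrt (mi_fact m) * sqrt (mi_fact m) = mi_fact m" using mi_fact_pos[of m] by simp
    then have "norm (f m) * norm (g m) * mi_fact m = ?a f m * ?a g m"
      by (metis mult.assoc mult.left_commute)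
    then show "norm (f m * cnj (g m) * of_real (mi_fact m)) = ?a f m * ?a g m"
      using mi_fact_pos[of m] by (simp add: norm_mult)
  qed
  finally have 1: "norm (mi_inner S f g) \<le> (\<Sum>m | mi_deg m = S. ?a f m * ?a g m)" .
  have "(\<Sum>m | mi_deg m = S. ?a f m * ?a g m)\<^sup>2 \<le> mi_nsq S f * mi_nsq S g"
    using Cauchy_Schwarz_ineq_sum[of "?a f" "?a g" "{m. mi_deg m = S}"] unfolding sq mi_nsq_def .
  then have "(\<Sum>m | mi_deg m = S. ?a f m * ?a g m) \<le> sqrt (mi_nsq S f * mi_nsq S g)"
    by (rule real_le_rsqrt)
  with 1 show ?thesis by (simp add: real_sqrt_mult)
qed

lemma mi_inner_kernel_op: "mi_inner S (kernel_op f) g = (\<Sum>m | mi_deg m = S. \<Sum>n | mi_deg n = S. f n * cnj (g m) * of_real (P m n))"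
  unfolding mi_inner_def kernel_op_def kernel_apply_def
proof (rule sum.cong[OF refl], goal_cases)
  case (1 m)
  then have "(\<Sum>n | mi_deg n = mi_deg m. f n * kernel_column n m) * cnj (g m) * of_real (mi_fact m) =
     (\<Sum>n | mi_deg n = S. f n * kernel_column n m * cnj (g m) * of_real (mi_fact m))"
    by (simp add: sum_distrib_right)
  also have "\<dots> = (\<Sum>n | mi_deg n = S. f n * cnj (g m) * of_real (P m n))"
    using mi_fact_pos[of m] by (intro sum.cong refl) (simp add: kernel_column_def)
  finally show ?case .
qed

lemma mi_inner_cnj: "cnj (mi_inner S f g) = mi_inner S g f"
  unfolding mi_inner_def by (simp add: mult_ac)

lemma kernel_op_selfadjoint: "mi_inner S (kernel_op f) g = mi_inner S f (kernel_op g)"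
proof -
  have "mi_inner S f (kernel_op g) = cnj (mi_inner S (kernel_op g) f)" by (simp add: mi_inner_cnj)
  also have "\<dots> = (\<Sum>m | mi_deg m = S. \<Sum>n | mi_deg n = S. f m * cnj (g n) * of_real (P n m))"
    unfolding mi_inner_kernel_op by (simp add: mult_ac P_sym)
  also have "\<dots> = mi_inner S (kernel_op f) g"
    unfolding mi_inner_kernel_op by (rule sum.swap)
  finally show ?thesis by simp
qed

lemma kernel_op_cong: "(\<And>n. mi_deg n = mi_deg m \<Longrightarrow> f n = g n) \<Longrightarrow> kernel_op f m = kernel_op g m"
  unfolding kernel_op_def kernel_apply_def by (intro sum.cong) auto

lemma kernel_op_sum: "kernel_op (\<lambda>n. \<Sum>b\<in>B. g b n) = (\<lambda>m. \<Sum>b\<in>B. kernel_op (g b) m)"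
  by (simp add: kernel_op_def kernel_apply_sum)

lemma mi_inner_sum_left: "mi_inner S (\<lambda>n. \<Sum>b\<in>B. g b n) f = (\<Sum>b\<in>B. mi_inner S (g b) f)"
  unfolding mi_inner_def sum_distrib_right by (rule sum.swap)

lemma mi_inner_sum_right: "mi_inner S f (\<lambda>n. \<Sum>b\<in>B. g b n) = (\<Sum>b\<in>B. mi_inner S f (g b))"
  unfolding mi_inner_def cnj_sum sum_distrib_left sum_distrib_right by (rule sum.swap)

lemma mi_inner_cmul_left: "mi_inner S (\<lambda>n. c * f n) g = c * mi_inner S f g"
  by (simp add: mi_inner_def sum_distrib_left mult_ac)

lemma eig_Suc: "eig (Suc p) = eig p * ((\<mu> + real p) / (real p + 1))"
  by (simp add: eig_def pochhammer_Suc field_simps)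

lemma eig_0: "eig 0 = 1"
  by (simp add: eig_def)

lemma eig_pos: "eig p > 0"
  unfolding eig_def using mu_pos by (simp add: pochhammer_pos)

lemma eig_strict_mono: "\<mu> > 1 \<Longrightarrow> strict_mono eig"
  unfolding strict_mono_Suc_iff eig_Suc using eig_pos by (simp add: field_simps)

lemma eig_strict_antimono: "\<mu> < 1 \<Longrightarrow> strict_mono (\<lambda>p. - eig p)"
  unfolding strict_mono_Suc_iff eig_Suc using eig_pos by (simp add: field_simps)

lemma eig_eq_1: "\<mu> = 1 \<Longrightarrow> eig p = 1"
  using eig_pos[of 0] unfolding eig_def by (simp add: pochhammer_fact[symmetric])

lemma eig_inj: "\<mu> \<noteq> 1 \<Longrightarrow> eig p = eig q \<Longrightarrow> p = q"
  using strict_mono_eq[OF eig_strict_mono, of p q] strict_mono_eq[OF eig_strict_antimono, of p q]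
  by linarith

lemma eig_le_max: "p \<le> N \<Longrightarrow> eig p \<le> max 1 (eig N)"
proof -
  assume "p \<le> N"
  consider "\<mu> > 1" | "\<mu> = 1" | "\<mu> < 1" by linarith
  then show ?thesis
  proof cases
    case 1
    then have "eig p \<le> eig N"
      using \<open>p \<le> N\<close> by (simp add: strict_mono_less_eq[OF eig_strict_mono])
    then show ?thesis by simp
  next
    case 3
    then have "- eig 0 \<le> - eig p"
      by (subst strict_mono_less_eq[OF eig_strict_antimono]) auto
    then show ?thesis by (simp add: eig_0)
  next
    case 2
    show ?thesis unfolding eig_eq_1[OF 2] by simp
  qed
qed

text \<open>
  The component \<open>g p\<close> is \<open>|v|\<^sup>2\<^sup>p h\<^sub>p(u)\<close>.
\<close>

lemma kernel_op_decomposition: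
  obtains g where "\<And>m. mi_deg m = S \<Longrightarrow> kernel_op f m = (\<Sum>p\<le>S div 2. g p m)"
    "\<And>p m. p \<le> S div 2 \<Longrightarrow> mi_deg m = S \<Longrightarrow> kernel_op (g p) m = of_real (eig p) * g p m"
proof -
  obtain k where k: "k \<in> homspan S" "\<And>m. mi_deg m = S \<Longrightarrow> kernel_op f m = k m"
    using kernel_op_homspan[of S f] by blast
  then obtain h where h: "\<And>p. p \<le> S div 2 \<Longrightarrow> ufree (S - 2 * p) (h p)"
    "\<And>m. mi_deg m = S \<Longrightarrow> k m = (\<Sum>p\<le>S div 2. (quad ^^ p) (h p) m)"
    unfolding homspan_def by blast
  show ?thesis
    by (rule that[of "\<lambda>p. (quad ^^ p) (h p)"]) (use h k in \<open>auto intro!: kernel_op_eigenfunction\<close>)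
qed

lemma kernel_op_idem:
  assumes "\<mu> = 1"
  shows "kernel_op (kernel_op f) = kernel_op f"
proof
  fix m :: "'a \<Rightarrow> nat"
  obtain g :: "nat \<Rightarrow> 'a mfun" where g: "\<And>m'. mi_deg m' = mi_deg m \<Longrightarrow> kernel_op f m' = (\<Sum>p\<le>mi_deg m div 2. g p m')"
    "\<And>p m'. p \<le> mi_deg m div 2 \<Longrightarrow> mi_deg m' = mi_deg m \<Longrightarrow> kernel_op (g p) m' = of_real (eig p) * g p m'"
    using kernel_op_decomposition by blast
  have "kernel_op (kernel_op f) m = kernel_op (\<lambda>n. \<Sum>p\<le>mi_deg m div 2. g p n) m"
    by (rule kernel_op_cong) (rule g(1))
  also have "\<dots> = kernel_op f m"
    unfolding kernel_op_sum g(1)[OF refl] by (rule sum.cong) (auto simp: g(2) eig_eq_1[OF assms])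
  finally show "kernel_op (kernel_op f) m = kernel_op f m" .
qed

text \<open>
  Let \<open>P f = \<Sum> g\<^sub>p\<close> with eigenvectors \<open>g\<^sub>p\<close>. For \<open>\<mu> \<noteq> 1\<close> the eigenvalues \<open>\<lambda>\<^sub>p\<close> are distinct, so by
  selfadjointness the \<open>g\<^sub>p\<close> are orthogonal and \<open>\<langle>f, g\<^sub>p\<rangle> = |g\<^sub>p|\<^sup>2 / \<lambda>\<^sub>p\<close>. Hence
  \<open>|P f|\<^sup>2 = \<Sum> |g\<^sub>p|\<^sup>2\<close> and \<open>\<langle>f, P f\<rangle> = \<Sum> |g\<^sub>p|\<^sup>2 / \<lambda>\<^sub>p\<close>. Both positivity of the form and the bound for the
  norm follow. For \<open>\<mu> = 1\<close> the operator is a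
  selfadjoint idempotent, and equality holds. The maximum with \<open>1 = \<lambda>\<^sub>0\<close> covers \<open>\<mu> < 1\<close>, where the eigenvalues decrease.
\<close>

lemma kernel_op_mi_nsq_le_mi_inner:
  "mi_nsq S (kernel_op f) \<le> max 1 (eig (S div 2)) * Re (mi_inner S f (kernel_op f))"
proof (cases "\<mu> = 1")
  case True
  have "mi_inner S (kernel_op f) (kernel_op f) = mi_inner S f (kernel_op f)"
    unfolding kernel_op_selfadjoint kernel_op_idem[OF True] ..
  then have "mi_nsq S (kernel_op f) = Re (mi_inner S f (kernel_op f))"
    using mi_inner_self[of S "kernel_op f"] by (metis Re_complex_of_real)
  then show ?thesis unfolding eig_eq_1[OF True] by simp
next
  case False
  obtain g where g: "\<And>m. mi_deg m = S \<Longrightarrow> kernel_op f m = (\<Sum>p\<le>S div 2. g p m)"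
    "\<And>p m. p \<le> S div 2 \<Longrightarrow> mi_deg m = S \<Longrightarrow> kernel_op (g p) m = of_real (eig p) * g p m"
    using kernel_op_decomposition by blast
  have left: "mi_inner S (kernel_op (g p)) k = of_real (eig p) * mi_inner S (g p) k" if "p \<le> S div 2" for p k
    unfolding mi_inner_cmul_left[symmetric] by (rule mi_inner_cong) (use g(2) that in auto)
  have right: "mi_inner S k (kernel_op (g p)) = of_real (eig p) * mi_inner S k (g p)" if "p \<le> S div 2" for p k
    using left[OF that, of k] by (metis mi_inner_cnj complex_cnj_mult complex_cnj_complex_of_real)
  have orth: "mi_inner S (g p) (g q) = 0" if "p \<le> S div 2" "q \<le> S div 2" "p \<noteq> q" for p q
  proof -
    have "of_real (eig p) * mi_inner S (g p) (g q) = of_real (eig q) * mi_inner S (g p) (g q)"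
      using left[OF that(1), of "g q"] right[OF that(2), of "g p"] kernel_op_selfadjoint[of S "g p" "g q"]
      by argo
    then show ?thesis using eig_inj[OF False, of p q] that(3) by auto
  qed
  have dec: "mi_inner S k (kernel_op f) = (\<Sum>p\<le>S div 2. mi_inner S k (g p))" for k
    unfolding mi_inner_sum_right[symmetric] by (rule mi_inner_cong) (auto simp: g(1))
  have proj: "mi_inner S (kernel_op f) (g p) = of_real (mi_nsq S (g p))" if "p \<le> S div 2" for p
  proof -
    have "mi_inner S (kernel_op f) (g p) = (\<Sum>q\<le>S div 2. mi_inner S (g q) (g p))"
      unfolding mi_inner_sum_left[symmetric] by (rule mi_inner_cong) (auto simp: g(1))
    also have "\<dots> = (\<Sum>q\<in>{p}. mi_inner S (g q) (g p))"
      by (rule sum.mono_neutral_right) (use that orth in auto)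
    finally show ?thesis by (simp add: mi_inner_self)
  qed
  have coef: "mi_inner S f (g p) = of_real (mi_nsq S (g p) / eig p)" if "p \<le> S div 2" for p
  proof -
    have "of_real (eig p) * mi_inner S f (g p) = of_real (mi_nsq S (g p))"
      using right[OF that, of f] proj[OF that] by (simp add: kernel_op_selfadjoint)
    then show ?thesis using eig_pos[of p] by (simp add: field_simps)
  qed
  have "of_real (mi_nsq S (kernel_op f)) = (\<Sum>p\<le>S div 2. complex_of_real (mi_nsq S (g p)))"
    unfolding mi_inner_self[symmetric] dec by (rule sum.cong) (auto simp: proj mi_inner_self)
  then have "mi_nsq S (kernel_op f) = (\<Sum>p\<le>S div 2. mi_nsq S (g p))"
    by (metis of_real_sum of_real_eq_iff)
  also have "\<dots> \<le> (\<Sum>p\<le>S div 2. max 1 (eig (S div 2)) * (mi_nsq S (g p) / eig p))"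
  proof (rule sum_mono)
    fix p assume "p \<in> {..S div 2}"
    then have "eig p * mi_nsq S (g p) \<le> max 1 (eig (S div 2)) * mi_nsq S (g p)"
      by (intro mult_right_mono eig_le_max mi_nsq_nonneg) simp
    then show "mi_nsq S (g p) \<le> max 1 (eig (S div 2)) * (mi_nsq S (g p) / eig p)"
      using eig_pos[of p] by (simp add: pos_le_divide_eq mult.commute)
  qed
  also have "\<dots> = max 1 (eig (S div 2)) * Re (mi_inner S f (kernel_op f))"
  proof -
    have "mi_inner S f (kernel_op f) = (\<Sum>p\<le>S div 2. of_real (mi_nsq S (g p) / eig p))"
      unfolding dec by (rule sum.cong) (auto simp: coef)
    then show ?thesis by (simp add: sum_distrib_left del: of_real_divide)
  qed
  finally show ?thesis .
qed

lemma kernel_op_bound: "sqrt (mi_nsq S (kernel_op f)) \<le> max 1 (eig (S div 2)) * sqrt (mi_nsq S f)"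
proof (cases "mi_nsq S (kernel_op f) = 0")
  case False
  let ?L = "max 1 (eig (S div 2))"
  have pos: "sqrt (mi_nsq S (kernel_op f)) > 0" using False mi_nsq_nonneg[of S "kernel_op f"] by simp
  have "sqrt (mi_nsq S (kernel_op f)) * sqrt (mi_nsq S (kernel_op f)) = mi_nsq S (kernel_op f)"
    using mi_nsq_nonneg by simp
  also have "\<dots> \<le> ?L * Re (mi_inner S f (kernel_op f))" by (rule kernel_op_mi_nsq_le_mi_inner)
  also have "\<dots> \<le> ?L * (sqrt (mi_nsq S f) * sqrt (mi_nsq S (kernel_op f)))"
    by (intro mult_left_mono order_trans[OF complex_Re_le_cmod mi_inner_cauchy_schwarz]) auto
  finally show ?thesis using pos by (simp only: mult.assoc[symmetric] mult_le_cancel_right_pos)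
qed (use mi_nsq_nonneg in auto)

lemma mi_inner_kernel_op_nonneg: "Re (mi_inner S f (kernel_op f)) \<ge> 0"
proof -
  have "0 \<le> max 1 (eig (S div 2)) * Re (mi_inner S f (kernel_op f))"
    using kernel_op_mi_nsq_le_mi_inner mi_nsq_nonneg order_trans by blast
  then show ?thesis by (simp add: zero_le_mult_iff)
qed

lemma ufree_nonzero: "\<exists>h. ufree a h \<and> (\<exists>m. h m \<noteq> 0)"
proof -
  obtain c where c: "R c c \<noteq> 0" using Q_not_id by (auto simp: R_def)
  \<comment> \<open>The coefficient of \<open>w\<^sub>c\<^sup>a\<close> in \<open>u\<^sub>c\<^sup>a\<close> is \<open>(R c c)\<^sup>a\<close>.\<close>
  have nz: "((mulR c) ^^ a) unit_fun ((\<lambda>_. 0)(c := a)) = R c c ^ a" for a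
  proof (induction a)
    case 0
    show ?case by (simp add: unit_fun_def)
  next
    case (Suc a)
    let ?m = "(\<lambda>_. 0)(c := Suc a)"
    have "mulR c ((mulR c ^^ a) unit_fun) ?m = (\<Sum>b\<in>{c}. R c b * mulX b ((mulR c ^^ a) unit_fun) ?m)"
      unfolding mulR_def by (rule sum.mono_neutral_right) (auto simp: mulX_def)
    also have "\<dots> = R c c * (mulR c ^^ a) unit_fun ((\<lambda>_. 0)(c := a))" by (simp add: mulX_def)
    finally show ?case unfolding Suc by (simp only: funpow.simps o_apply power_Suc)
  qed
  have "ufree a ((mulR c ^^ a) unit_fun)"
    by (induction a) (auto intro: ufree_one ufree_mulR)
  then show ?thesis using c nz[of a] by (metis power_not_zero)
qed

text \<open>
  Each eigenvalue with \<open>p \<le> S/2\<close> does occur. That \<open>|v|\<^sup>2\<^sup>p h(u)\<close> is not the zero polynomial is seen from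
  its image under \<open>kernel_apply\<close>, whose part of degree \<open>S - 2p\<close> is a nonzero multiple of \<open>h\<close>.
\<close>

lemma kernel_op_eigenvector:
  assumes "p \<le> S div 2"
  obtains g where "\<And>m. g m \<noteq> 0 \<Longrightarrow> mi_deg m = S" "\<exists>m. g m \<noteq> 0" "kernel_op g = (\<lambda>m. of_real (eig p) * g m)"
proof -
  obtain h m where h: "ufree (S - 2 * p) h" "h m \<noteq> 0" using ufree_nonzero by blast
  have S: "S - 2 * p + 2 * p = S" using assms by auto
  let ?g = "(quad ^^ p) h"
  have supp: "mi_deg m = S" if "?g m \<noteq> 0" for m
    using quadp_support[OF ufree_support[OF h(1)] that] S by simp
  have dm: "mi_deg m = S - 2 * p" using ufree_support[OF h(1,2)] .
  have nz: "\<exists>m. ?g m \<noteq> 0"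
  proof (rule ccontr)
    assume "\<not> (\<exists>m. ?g m \<noteq> 0)"
    then have "kernel_apply (S - 2 * p + 2 * p) ?g m = 0" by (simp add: kernel_apply_def)
    moreover have "kernel_apply (S - 2 * p) h m = h m"
      using kernel_apply_ufree_diag[OF h(1), of m 0] dm by simp
    moreover have "pochhammer \<mu> p \<noteq> 0" using pochhammer_pos[OF mu_pos, of p] by simp
    ultimately show False unfolding kernel_apply_quadp[OF h(1)] using h(2) by simp
  qed
  have "kernel_op ?g m = of_real (eig p) * ?g m" for m
  proof (cases "mi_deg m = S")
    case True
    then show ?thesis using kernel_op_eigenfunction[OF h(1)] S by simp
  next
    case False
    have "kernel_op ?g m = kernel_op (\<lambda>n. 0) m" by (rule kernel_op_cong) (use supp False in metis)
    also have "\<dots> = 0" by (simp add: kernel_op_def kernel_apply_def)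
    finally show ?thesis using supp False by auto
  qed
  then show ?thesis using that supp nz by blast
qed

end

section \<open>The Gaussian measure and the recursion for products of Hermite polynomials\<close>

lemma gauss_eq_density_prod:
  "(gauss :: (real ^ 'd) measure) = density lborel (\<lambda>x. ennreal (\<Prod>r\<in>UNIV. std_normal_density (x $ r)))"
proof -
  have "(2 * pi) powr (- real CARD('d) / 2) * exp (- (norm x)\<^sup>2 / 2) = (\<Prod>r\<in>UNIV. std_normal_density (x $ r))"
    for x :: "real ^ 'd"
  proof -
    have half: "(2 * pi) powr (- (1 / 2)) = 1 / sqrt (2 * pi)"
      unfolding powr_minus_divide by (subst powr_half_sqrt) auto
    have "- real CARD('d) / 2 = - (1 / 2) * real CARD('d)" by simp
    then have "(2 * pi) powr (- real CARD('d) / 2) = ((2 * pi) powr (- (1 / 2))) powr real CARD('d)"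
      by (simp only: powr_powr)
    also have "\<dots> = (1 / sqrt (2 * pi)) ^ CARD('d)"
      unfolding half by (rule powr_realpow) simp
    also have "\<dots> = (\<Prod>r\<in>(UNIV :: 'd set). 1 / sqrt (2 * pi))"
      by (simp only: prod_constant)
    finally have c: "(2 * pi) powr (- real CARD('d) / 2) = (\<Prod>r\<in>(UNIV :: 'd set). 1 / sqrt (2 * pi))" .
    have "- (norm x)\<^sup>2 / 2 = (\<Sum>r\<in>UNIV. - (x $ r)\<^sup>2 / 2)"
      unfolding power2_norm_eq_inner inner_vec_def
      by (simp only: power2_eq_square inner_real_def sum_negf sum_divide_distrib[symmetric])
    then have "exp (- (norm x)\<^sup>2 / 2) = (\<Prod>r\<in>UNIV. exp (- (x $ r)\<^sup>2 / 2))"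
      by (simp only: exp_sum finite)
    then show ?thesis unfolding c by (simp only: std_normal_density_def prod.distrib)
  qed
  then show ?thesis by (simp add: gauss_def)
qed

lemma sets_gauss [simp, measurable_cong]: "sets gauss = sets borel"
  by (simp add: gauss_def)

lemma space_gauss [simp]: "space gauss = UNIV"
  by (simp add: gauss_def)

lemma Basis_vec_eq_axis: "(Basis :: (real ^ 'd) set) = range (\<lambda>r. axis r 1)"
  by (auto simp: Basis_vec_def)

lemma borel_measurable_vec_component [measurable]:
  "(\<lambda>x :: real ^ 'd. x $ r) \<in> borel_measurable borel"
  by (intro borel_measurable_continuous_onI continuous_intros)

text \<open>
  The coordinates \<open>x $ r\<close> and the coordinates of \<open>x\<close> in the standard basis are the same numbers,
  indexed by \<open>'d\<close> and by the set of basis vectors; Lebesgue measure is a product for the latter.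
\<close>

lemma lborel_prod_integral:
  fixes f :: "'d::finite \<Rightarrow> real \<Rightarrow> real"
  assumes int: "\<And>r. integrable lborel (f r)"
  shows "integrable lborel (\<lambda>x :: real ^ 'd. \<Prod>r\<in>UNIV. f r (x $ r))"
    and "(\<integral>x. (\<Prod>r\<in>UNIV. f r (x $ r)) \<partial>(lborel :: (real ^ 'd) measure)) = (\<Prod>r\<in>UNIV. \<integral>x. f r x \<partial>lborel)"
proof -
  interpret product_sigma_finite "\<lambda>_ :: real ^ 'd. lborel :: real measure" by standard
  have meas [measurable]: "f r \<in> borel_measurable borel" for r
    using borel_measurable_integrable[OF int[of r]] by simp
  define g where "g b = f (THE r. b = axis r (1::real))" for b :: "real ^ 'd"
  have g: "g (axis r 1) = f r" for r
    unfolding g_def by (simp add: axis_eq_axis)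
  have intg: "integrable lborel (g b)" for b unfolding g_def by (rule int)
  have inj: "inj (\<lambda>r :: 'd. axis r (1::real))" by (auto simp: inj_on_def axis_eq_axis)
  have comp: "(\<Sum>b\<in>Basis. y b *\<^sub>R b) $ r = y (axis r 1)" for y :: "real ^ 'd \<Rightarrow> real" and r
  proof -
    have "(\<Sum>b\<in>Basis. y b *\<^sub>R b) $ r = (\<Sum>s\<in>UNIV. y (axis s 1) * (axis s 1 :: real ^ 'd) $ r)"
      unfolding Basis_vec_eq_axis by (subst sum.reindex[OF inj]) simp
    also have "\<dots> = (\<Sum>s\<in>UNIV. if s = r then y (axis s 1) else 0)"
      by (rule sum.cong) (auto simp: axis_def)
    finally show ?thesis by simp
  qed
  have eq: "(\<Prod>r\<in>UNIV. f r ((\<Sum>b\<in>Basis. y b *\<^sub>R b) $ r)) = (\<Prod>b\<in>Basis. g b (y b))" for y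
  proof -
    have "(\<Prod>b\<in>Basis. g b (y b)) = (\<Prod>r\<in>UNIV. f r (y (axis r 1)))"
      unfolding Basis_vec_eq_axis by (subst prod.reindex[OF inj]) (simp add: g)
    then show ?thesis by (simp only: comp)
  qed
  let ?F = "\<lambda>x :: real ^ 'd. \<Prod>r\<in>UNIV. f r (x $ r)"
  let ?T = "\<lambda>y. \<Sum>b\<in>Basis. y b *\<^sub>R b :: real ^ 'd"
  have F: "?F \<in> borel_measurable borel" by measurable
  have T: "?T \<in> measurable (\<Pi>\<^sub>M b\<in>Basis. lborel) borel" by measurable
  have prod_eq: "(\<Prod>b\<in>Basis. \<integral>x. g b x \<partial>lborel) = (\<Prod>r\<in>UNIV. \<integral>x. f r x \<partial>lborel)"
    unfolding Basis_vec_eq_axis by (subst prod.reindex[OF inj]) (simp add: g)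
  have "integrable (\<Pi>\<^sub>M b\<in>Basis. lborel) (\<lambda>y. \<Prod>b\<in>Basis. g b (y b))"
    by (rule product_integrable_prod) (auto intro: intg)
  then show "integrable lborel ?F"
    by (subst lborel_eq, subst integrable_distr_eq[OF T F]) (simp only: eq)
  have "(\<integral>x. ?F x \<partial>lborel) = (\<integral>y. (\<Prod>b\<in>Basis. g b (y b)) \<partial>(\<Pi>\<^sub>M b\<in>Basis. lborel))"
    by (subst lborel_eq, subst integral_distr[OF T F]) (simp only: eq)
  also have "\<dots> = (\<Prod>b\<in>Basis. \<integral>x. g b x \<partial>lborel)"
    by (rule product_integral_prod) (auto intro: intg)
  finally show "(\<integral>x. ?F x \<partial>lborel) = (\<Prod>r\<in>UNIV. \<integral>x. f r x \<partial>lborel)"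
    by (simp only: prod_eq)
qed

lemma gauss_prod_integral:
  fixes f :: "'d::finite \<Rightarrow> real \<Rightarrow> real"
  assumes int: "\<And>r. integrable std_gauss (f r)"
  shows "integrable gauss (\<lambda>x :: real ^ 'd. \<Prod>r\<in>UNIV. f r (x $ r))"
    and "(\<integral>x. (\<Prod>r\<in>UNIV. f r (x $ r)) \<partial>(gauss :: (real ^ 'd) measure)) = (\<Prod>r\<in>UNIV. \<integral>x. f r x \<partial>std_gauss)"
proof -
  have meas [measurable]: "f r \<in> borel_measurable borel" for r
    using borel_measurable_integrable[OF int[of r]] by simp
  have int': "integrable lborel (\<lambda>x. std_normal_density x * f r x)" for r
    using int[of r] by (subst (asm) integrable_density) auto
  have nn: "0 \<le> (\<Prod>r\<in>UNIV. std_normal_density (x $ r))" for x :: "real ^ 'd"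
    by (intro prod_nonneg) auto
  show "integrable gauss (\<lambda>x :: real ^ 'd. \<Prod>r\<in>UNIV. f r (x $ r))"
    unfolding gauss_eq_density_prod
    by (subst integrable_density)
      (use lborel_prod_integral(1)[OF int'] nn in \<open>auto simp: prod.distrib\<close>)
  show "(\<integral>x. (\<Prod>r\<in>UNIV. f r (x $ r)) \<partial>(gauss :: (real ^ 'd) measure)) = (\<Prod>r\<in>UNIV. \<integral>x. f r x \<partial>std_gauss)"
    unfolding gauss_eq_density_prod
    by (subst integral_density)
      (use lborel_prod_integral(2)[OF int'] nn in \<open>auto simp: prod.distrib integral_density\<close>)
qed

lemma prob_space_gauss: "prob_space (gauss :: (real ^ 'd) measure)"
proof
  have "integrable std_gauss (\<lambda>_. 1 :: real)"
    using integrable_poly_std_gauss[of 1] unfolding poly_1 .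
  note int = gauss_prod_integral[of "\<lambda>_ :: 'd. \<lambda>_. 1", OF this]
  have "(\<integral>x. 1 \<partial>std_gauss) = (1 :: real)"
    using gauss_expect_1 by (simp add: gauss_expect_def)
  then have m: "measure (gauss :: (real ^ 'd) measure) UNIV = 1" using int(2) by simp
  have "emeasure (gauss :: (real ^ 'd) measure) UNIV \<noteq> \<infinity>"
    using m by (auto simp: measure_def)
  then show "emeasure (gauss :: (real ^ 'd) measure) (space gauss) = 1"
    using m by (simp add: emeasure_eq_ennreal_measure)
qed

interpretation gauss: prob_space "gauss :: (real ^ 'd) measure"
  by (rule prob_space_gauss)

interpretation gauss_pow: product_sigma_finite "\<lambda>_ :: 'i. gauss :: (real ^ 'd) measure"
  by standard

definition scaled_hermite_poly :: "real \<Rightarrow> nat \<Rightarrow> real poly" where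
  "scaled_hermite_poly c n = pcompose (hermite_poly n) [:0, c:]"

lemma prod_hermite_multi:
  "(\<Prod>j\<in>J. hermite_multi (m j) (c *\<^sub>R x)) = (\<Prod>r\<in>UNIV. poly (\<Prod>j\<in>J. scaled_hermite_poly c (m j $ r)) (x $ r))"
  unfolding hermite_multi_def hermite_eq_hermite_poly
  by (subst prod.swap) (simp add: poly_prod scaled_hermite_poly_def poly_pcompose mult.commute)

lemma integrable_prod_hermite_multi:
  "integrable gauss (\<lambda>x. \<Prod>j\<in>J. hermite_multi (m j) (c *\<^sub>R x))"
  unfolding prod_hermite_multi by (intro gauss_prod_integral(1) integrable_poly_std_gauss)

lemma integral_prod_hermite_multi:
  "(\<integral>x. (\<Prod>j\<in>J. hermite_multi (m j) (c *\<^sub>R x)) \<partial>gauss) = (\<Prod>r\<in>UNIV. gauss_expect (\<Prod>j\<in>J. scaled_hermite_poly c (m j $ r)))"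
  unfolding prod_hermite_multi
  by (subst gauss_prod_integral(2)) (auto intro: integrable_poly_std_gauss simp: gauss_expect_def)

lemma scaled_hermite_poly_1: "scaled_hermite_poly 1 n = hermite_poly n"
  unfolding scaled_hermite_poly_def by (rule pcompose_idR)

definition multi_fact :: "nat ^ 'd \<Rightarrow> real" where
  "multi_fact m = (\<Prod>r\<in>UNIV. fact (m $ r))"

lemma hermite_multi_orthogonal:
  "integrable gauss (\<lambda>x. hermite_multi m x * hermite_multi n x)"
  "(\<integral>x. hermite_multi m x * hermite_multi n x \<partial>gauss) = (if m = n then multi_fact m else 0)"
proof -
  have eq: "hermite_multi m x * hermite_multi n x = (\<Prod>j\<in>UNIV. hermite_multi (if j then m else n) (1 *\<^sub>R x))" for x
    by (simp add: UNIV_bool mult.commute)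
  show "integrable gauss (\<lambda>x. hermite_multi m x * hermite_multi n x)"
    unfolding eq by (rule integrable_prod_hermite_multi)
  have "(\<integral>x. hermite_multi m x * hermite_multi n x \<partial>gauss) =
      (\<Prod>r\<in>UNIV. gauss_expect (hermite_poly (m $ r) * hermite_poly (n $ r)))"
    unfolding eq integral_prod_hermite_multi scaled_hermite_poly_1 by (simp add: UNIV_bool mult.commute)
  also have "\<dots> = (\<Prod>r\<in>UNIV. if m $ r = n $ r then fact (m $ r) else 0)"
    by (rule prod.cong) (auto simp: hermite_poly_orthogonal)
  also have "\<dots> = (if m = n then multi_fact m else 0)"
    by (auto simp: multi_fact_def vec_eq_iff)
  finally show "(\<integral>x. hermite_multi m x * hermite_multi n x \<partial>gauss) = (if m = n then multi_fact m else 0)" .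
qed

definition kernel_1d :: "real \<Rightarrow> ('k::finite \<Rightarrow> nat) \<Rightarrow> ('k \<Rightarrow> nat) \<Rightarrow> real" where
  "kernel_1d c p q = gauss_expect (\<Prod>j\<in>UNIV. scaled_hermite_poly c (p j) * scaled_hermite_poly c (q j))"

lemma scaled_hermite_poly_Suc: "scaled_hermite_poly c (Suc n) = [:0, c:] * scaled_hermite_poly c n - smult (of_nat n) (scaled_hermite_poly c (n - 1))"
proof -
  have "hermite_poly (Suc n) = pCons 0 (hermite_poly n) - smult (of_nat n) (hermite_poly (n - 1))"
    by (simp add: pderiv_hermite_poly_pred)
  then show ?thesis unfolding scaled_hermite_poly_def
    by (simp only: pcompose_diff pcompose_smult pcompose_pCons) simp
qed

lemma pderiv_scaled_hermite_poly: "pderiv (scaled_hermite_poly c n) = smult (c * of_nat n) (scaled_hermite_poly c (n - 1))"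
  unfolding scaled_hermite_poly_def by (simp add: pderiv_pcompose pderiv_hermite_poly_pred pcompose_smult pderiv_pCons mult.commute)

lemma kernel_1d_upd:
  "kernel_1d c (p(j := v)) q = gauss_expect (scaled_hermite_poly c v * scaled_hermite_poly c (q j) *
     (\<Prod>i\<in>UNIV - {j}. scaled_hermite_poly c (p i) * scaled_hermite_poly c (q i)))"
  "kernel_1d c p (q(j := v)) = gauss_expect (scaled_hermite_poly c (p j) * scaled_hermite_poly c v *
     (\<Prod>i\<in>UNIV - {j}. scaled_hermite_poly c (p i) * scaled_hermite_poly c (q i)))"
  unfolding kernel_1d_def by (subst prod.remove[of _ j]; simp)+

text \<open>
  The first term comes from Stein's identity: the factor \<open>c x\<close> in the recursion for \<open>H\<^sub>n(c x)\<close> becomes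
  \<open>c\<close> times the derivative of the whole product, and each derivative contributes another \<open>c\<close>.
\<close>

lemma kernel_1d_step:
  "kernel_1d c (p(i := Suc (p i))) q =
     c\<^sup>2 * (\<Sum>j\<in>UNIV. real (p j) * kernel_1d c (p(j := p j - 1)) q + real (q j) * kernel_1d c p (q(j := q j - 1))) -
     real (p i) * kernel_1d c (p(i := p i - 1)) q"
proof -
  let ?W = "\<Prod>j\<in>UNIV. scaled_hermite_poly c (p j) * scaled_hermite_poly c (q j)"
  let ?W' = "\<lambda>j. \<Prod>i\<in>UNIV - {j}. scaled_hermite_poly c (p i) * scaled_hermite_poly c (q i)"
  have W: "?W = scaled_hermite_poly c (p i) * scaled_hermite_poly c (q i) * ?W' i"
    by (subst prod.remove[of _ i]) auto
  have "kernel_1d c (p(i := Suc (p i))) q = gauss_expect ([:0, c:] * ?W -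
      smult (real (p i)) (scaled_hermite_poly c (p i - 1) * scaled_hermite_poly c (q i) * ?W' i))"
    unfolding kernel_1d_upd scaled_hermite_poly_Suc W by (simp only: left_diff_distrib mult.assoc mult_smult_left)
  also have "\<dots> = gauss_expect ([:0, c:] * ?W) - real (p i) * kernel_1d c (p(i := p i - 1)) q"
    by (simp only: gauss_expect_diff gauss_expect_smult kernel_1d_upd)
  also have "[:0, c:] * ?W = smult c (pCons 0 ?W)" by simp
  also have "gauss_expect (smult c (pCons 0 ?W)) = c * gauss_expect (pderiv ?W)"
    by (simp only: gauss_expect_smult stein)
  also have "pderiv ?W = (\<Sum>j\<in>UNIV. ?W' j * pderiv (scaled_hermite_poly c (p j) * scaled_hermite_poly c (q j)))"
    by (rule pderiv_prod)
  also have "\<dots> = (\<Sum>j\<in>UNIV. smult (c * real (p j)) (scaled_hermite_poly c (p j - 1) * scaled_hermite_poly c (q j) * ?W' j) +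
      smult (c * real (q j)) (scaled_hermite_poly c (p j) * scaled_hermite_poly c (q j - 1) * ?W' j))"
    by (intro sum.cong refl)
      (simp only: pderiv_mult pderiv_scaled_hermite_poly mult_smult_left mult_smult_right distrib_left mult_ac add_ac)
  also have "gauss_expect \<dots> = (\<Sum>j\<in>UNIV. c * (real (p j) * kernel_1d c (p(j := p j - 1)) q +
      real (q j) * kernel_1d c p (q(j := q j - 1))))"
    unfolding kernel_1d_upd by (simp add: gauss_expect_sum gauss_expect_add gauss_expect_smult algebra_simps)
  also have "c * \<dots> = c\<^sup>2 * (\<Sum>j\<in>UNIV. real (p j) * kernel_1d c (p(j := p j - 1)) q +
      real (q j) * kernel_1d c p (q(j := q j - 1)))"
    by (simp add: sum_distrib_left[symmetric] power2_eq_square)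
  finally show ?thesis .
qed

text \<open>
  The kernel \<open>P(M,N)\<close> as a product over the sites \<open>(i,r)\<close>, at each of which the \<open>2k\<close> Hermite
  polynomials in the one variable \<open>x i $ r\<close> interact.
\<close>

definition kernel_mi :: "('l::finite \<times> 'k::finite \<times> 'd::finite \<Rightarrow> nat) \<Rightarrow> ('l \<times> 'k \<times> 'd \<Rightarrow> nat) \<Rightarrow> real" where
  "kernel_mi m n = (\<Prod>s\<in>UNIV. kernel_1d (sqrt (1 / real CARD('k)))
     (\<lambda>j. m (fst s, j, snd s)) (\<lambda>j. n (fst s, j, snd s)))"

text \<open>
  The projection onto the vectors whose mean over the column index \<open>j\<close> vanishes.
\<close>

definition Q_mi :: "'l::finite \<times> 'k::finite \<times> 'd::finite \<Rightarrow> 'l \<times> 'k \<times> 'd \<Rightarrow> complex" where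
  "Q_mi a b = (if a = b then 1 else 0) -
     (if fst a = fst b \<and> snd (snd a) = snd (snd b) then 1 / of_nat CARD('k) else 0)"

lemma sum_same_site:
  fixes F :: "'l::finite \<times> 'k::finite \<times> 'd::finite \<Rightarrow> 'x::comm_monoid_add"
  shows "(\<Sum>b\<in>UNIV. if fst a = fst b \<and> snd (snd a) = snd (snd b) then F b else 0) =
    (\<Sum>j\<in>UNIV. F (fst a, j, snd (snd a)))"
proof -
  have "(\<Sum>b\<in>UNIV. if fst a = fst b \<and> snd (snd a) = snd (snd b) then F b else 0) =
      (\<Sum>b\<in>range (\<lambda>j. (fst a, j, snd (snd a))). F b)"
    by (rule sum.mono_neutral_cong_right) (auto simp: image_iff prod_eq_iff)
  also have "\<dots> = (\<Sum>j\<in>UNIV. F (fst a, j, snd (snd a)))"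
    by (subst sum.reindex) (auto simp: inj_on_def)
  finally show ?thesis .
qed

lemma sum_Q_mi:
  fixes F :: "'l::finite \<times> 'k::finite \<times> 'd::finite \<Rightarrow> complex"
  shows "(\<Sum>b\<in>UNIV. Q_mi a b * F b) = F a - (\<Sum>j\<in>UNIV. F (fst a, j, snd (snd a))) / of_nat CARD('k)"
    and "(\<Sum>b\<in>UNIV. ((if a = b then 1 else 0) - Q_mi a b) * F b) =
      (\<Sum>j\<in>UNIV. F (fst a, j, snd (snd a))) / of_nat CARD('k)"
proof -
  have 1: "(\<Sum>b\<in>UNIV. (if fst a = fst b \<and> snd (snd a) = snd (snd b) then 1 / of_nat CARD('k) else 0) * F b) =
      (\<Sum>j\<in>UNIV. F (fst a, j, snd (snd a))) / of_nat CARD('k)"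
    using sum_same_site[of a "\<lambda>b. F b / of_nat CARD('k)"]
    by (simp add: if_distrib[where f = "\<lambda>c. c * _"] sum_divide_distrib cong: if_cong)
  show "(\<Sum>b\<in>UNIV. Q_mi a b * F b) = F a - (\<Sum>j\<in>UNIV. F (fst a, j, snd (snd a))) / of_nat CARD('k)"
    unfolding 1[symmetric] by (simp add: Q_mi_def left_diff_distrib sum_subtractf if_distrib[where f = "\<lambda>c. c * _"] cong: if_cong)
  show "(\<Sum>b\<in>UNIV. ((if a = b then 1 else 0) - Q_mi a b) * F b) =
      (\<Sum>j\<in>UNIV. F (fst a, j, snd (snd a))) / of_nat CARD('k)"
    unfolding 1[symmetric] by (simp add: Q_mi_def)
qed

lemma kernel_1d_sym: "kernel_1d c p q = kernel_1d c q p"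
  by (simp add: kernel_1d_def mult.commute)

lemma kernel_mi_upd:
  fixes m n :: "'l::finite \<times> 'k::finite \<times> 'd::finite \<Rightarrow> nat"
  obtains C where
    "\<And>j v. kernel_mi (m((i, j, r) := v)) n =
       kernel_1d (sqrt (1 / real CARD('k))) ((\<lambda>j. m (i, j, r))(j := v)) (\<lambda>j. n (i, j, r)) * C"
    "\<And>j v. kernel_mi m (n((i, j, r) := v)) =
       kernel_1d (sqrt (1 / real CARD('k))) (\<lambda>j. m (i, j, r)) ((\<lambda>j. n (i, j, r))(j := v)) * C"
proof
  let ?c = "sqrt (1 / real CARD('k))"
  let ?C = "\<Prod>s\<in>UNIV - {(i, r)}. kernel_1d ?c (\<lambda>j. m (fst s, j, snd s)) (\<lambda>j. n (fst s, j, snd s))"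
  have upd: "(\<lambda>j'. (m((i, j, r) := v)) (i, j', r)) = (\<lambda>j. m (i, j, r))(j := v)"
    for m :: "'l \<times> 'k \<times> 'd \<Rightarrow> nat" and j v by auto
  have other: "(\<lambda>j'. (m((i, j, r) := v)) (fst s, j', snd s)) = (\<lambda>j'. m (fst s, j', snd s))"
    if "s \<noteq> (i, r)" for m :: "'l \<times> 'k \<times> 'd \<Rightarrow> nat" and j v s
    using that by (auto simp: prod_eq_iff)
  show "kernel_mi (m((i, j, r) := v)) n =
       kernel_1d ?c ((\<lambda>j. m (i, j, r))(j := v)) (\<lambda>j. n (i, j, r)) * ?C" for j v
    unfolding kernel_mi_def
    by (subst prod.remove[of _ "(i, r)"], simp, simp, simp only: upd fst_conv snd_conv)
      (intro arg_cong2[of _ _ _ _ times] refl prod.cong, subst other, blast, rule refl)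
  show "kernel_mi m (n((i, j, r) := v)) =
       kernel_1d ?c (\<lambda>j. m (i, j, r)) ((\<lambda>j. n (i, j, r))(j := v)) * ?C" for j v
    unfolding kernel_mi_def
    by (subst prod.remove[of _ "(i, r)"], simp, simp, simp only: upd fst_conv snd_conv)
      (intro arg_cong2[of _ _ _ _ times] refl prod.cong, subst other, blast, rule refl)
qed

text \<open>
  With \<open>c\<^sup>2 = 1/k\<close> the sum over \<open>j\<close> in \<open>kernel_1d_step\<close> is a mean, that is, an application of \<open>1 - Q\<close>.
  This is the reason for the dilation \<open>\<lambda> = \<surd>(1/k)\<close>.
\<close>

lemma kernel_mi_step:
  fixes m n :: "'l::finite \<times> 'k::finite \<times> 'd::finite \<Rightarrow> nat"
  shows "complex_of_real (kernel_mi (m(a := Suc (m a))) n) =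
      (\<Sum>b\<in>UNIV. ((if a = b then 1 else 0) - Q_mi a b) * of_nat (n b) * of_real (kernel_mi m (n(b := n b - 1)))) -
      (\<Sum>b\<in>UNIV. Q_mi a b * of_nat (m b) * of_real (kernel_mi (m(b := m b - 1)) n))"
proof -
  obtain i j r where a: "a = (i, j, r)" by (cases a)
  let ?c = "sqrt (1 / real CARD('k))"
  let ?p = "\<lambda>j. m (i, j, r)" and ?q = "\<lambda>j. n (i, j, r)"
  obtain C where C:
    "\<And>j v. kernel_mi (m((i, j, r) := v)) n = kernel_1d ?c (?p(j := v)) ?q * C"
    "\<And>j v. kernel_mi m (n((i, j, r) := v)) = kernel_1d ?c ?p (?q(j := v)) * C"
    using kernel_mi_upd[where m = m and n = n and i = i and r = r] by blast
  have c2: "?c\<^sup>2 = 1 / real CARD('k)" by simp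
  have "kernel_mi (m(a := Suc (m a))) n = kernel_1d ?c (?p(j := Suc (?p j))) ?q * C"
    unfolding a C ..
  also have "\<dots> = (\<Sum>j\<in>UNIV. real (m (i, j, r)) * kernel_mi (m((i, j, r) := m (i, j, r) - 1)) n) / real CARD('k) +
      (\<Sum>j\<in>UNIV. real (n (i, j, r)) * kernel_mi m (n((i, j, r) := n (i, j, r) - 1))) / real CARD('k) -
      real (m (i, j, r)) * kernel_mi (m((i, j, r) := m (i, j, r) - 1)) n"
    unfolding C kernel_1d_step[of ?c ?p j ?q, unfolded c2] by (simp add: algebra_simps sum_distrib_left sum.distrib sum_divide_distrib)
  finally have "complex_of_real (kernel_mi (m(a := Suc (m a))) n) =
      (\<Sum>j\<in>UNIV. of_nat (m (i, j, r)) * of_real (kernel_mi (m((i, j, r) := m (i, j, r) - 1)) n)) / of_nat CARD('k) +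
      (\<Sum>j\<in>UNIV. of_nat (n (i, j, r)) * of_real (kernel_mi m (n((i, j, r) := n (i, j, r) - 1)))) / of_nat CARD('k) -
      of_nat (m (i, j, r)) * of_real (kernel_mi (m((i, j, r) := m (i, j, r) - 1)) n)"
    by simp
  then show ?thesis unfolding mult.assoc sum_Q_mi by (simp add: a)
qed

lemma gauss_kernel_mi:
  assumes k: "CARD('k::finite) \<ge> 2"
    and mu: "\<mu> = (real CARD('k) - 1) * real CARD('l::finite) * real CARD('d::finite) / 2"
  shows "gauss_kernel (Q_mi :: 'l \<times> 'k \<times> 'd \<Rightarrow> _ \<Rightarrow> complex) kernel_mi \<mu>"
proof
  fix a b c :: "'l \<times> 'k \<times> 'd" and m n :: "'l \<times> 'k \<times> 'd \<Rightarrow> nat"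
  show "Q_mi a b = Q_mi b a" by (auto simp: Q_mi_def)
  \<comment> \<open>Columns of \<open>Q_mi\<close> have mean \<open>0\<close> over \<open>j\<close>, which makes \<open>Q_mi\<close> idempotent.\<close>
  have "(\<Sum>j\<in>(UNIV :: 'k set). Q_mi (fst a, j, snd (snd a)) b) = 0"
  proof (cases "fst a = fst b \<and> snd (snd a) = snd (snd b)")
    case True
    then have "(\<Sum>j\<in>(UNIV :: 'k set). Q_mi (fst a, j, snd (snd a)) b) =
        (\<Sum>j\<in>(UNIV :: 'k set). (if j = fst (snd b) then 1 else 0) - 1 / of_nat CARD('k))"
      by (intro sum.cong) (auto simp: Q_mi_def prod_eq_iff)
    then show ?thesis by (simp add: sum_subtractf)
  next
    case False
    then show ?thesis by (intro sum.neutral ballI) (auto simp: Q_mi_def)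
  qed
  then show "(\<Sum>c\<in>UNIV. Q_mi a c * Q_mi c b) = Q_mi a b"
    unfolding sum_Q_mi by simp
  have "(\<Sum>a\<in>(UNIV :: ('l \<times> 'k \<times> 'd) set). Q_mi a a) =
      of_nat (CARD('l) * (CARD('k) * CARD('d))) * (1 - 1 / of_nat CARD('k))"
    by (simp add: Q_mi_def)
  also have "\<dots> = of_real (2 * \<mu>)"
    by (simp add: mu field_simps)
  finally show "(\<Sum>a\<in>(UNIV :: ('l \<times> 'k \<times> 'd) set). Q_mi a a) = of_real (2 * \<mu>)" .
  show "\<mu> > 0" unfolding mu using k by (intro divide_pos_pos mult_pos_pos) auto
  show "\<exists>a :: 'l \<times> 'k \<times> 'd. Q_mi a a \<noteq> 1" by (auto simp: Q_mi_def)
  show "kernel_mi (\<lambda>_. 0) (\<lambda>_ :: 'l \<times> 'k \<times> 'd. 0) = 1"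
    by (simp add: kernel_mi_def kernel_1d_def scaled_hermite_poly_def pcompose_1 gauss_expect_1)
  show "kernel_mi m n = kernel_mi n m"
    unfolding kernel_mi_def by (intro prod.cong refl kernel_1d_sym)
  show "complex_of_real (kernel_mi (m(a := Suc (m a))) n) =
      (\<Sum>b\<in>UNIV. ((if a = b then 1 else 0) - Q_mi a b) * of_nat (n b) * of_real (kernel_mi m (n(b := n b - 1)))) -
      (\<Sum>b\<in>UNIV. Q_mi a b * of_nat (m b) * of_real (kernel_mi (m(b := m b - 1)) n))"
    by (rule kernel_mi_step)
qed

section \<open>Summation by degree\<close>

text \<open>
  Every finite set lies below some degree, so sums over all elements of degree less than \<open>n\<close> exhaust
  an unconditional sum.
\<close>

lemma filterlim_grade:
  fixes g :: "'a \<Rightarrow> nat"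
  assumes fin: "\<And>n. finite {x. g x < n}"
  shows "filterlim (\<lambda>n. {x. g x < n}) (finite_subsets_at_top UNIV) sequentially"
  unfolding filterlim_def le_filter_def eventually_filtermap
proof (intro allI impI)
  fix P assume "eventually P (finite_subsets_at_top (UNIV :: 'a set))"
  then obtain X where X: "finite X" "\<And>Y. finite Y \<Longrightarrow> X \<subseteq> Y \<Longrightarrow> P Y"
    unfolding eventually_finite_subsets_at_top by auto
  show "eventually (\<lambda>n. P {x. g x < n}) sequentially"
  proof (rule eventually_sequentiallyI)
    fix n assume n: "Suc (\<Sum>x\<in>X. g x) \<le> n"
    have "g x < n" if "x \<in> X" for x
      using member_le_sum[OF that, of g] X(1) n by simp
    then show "P {x. g x < n}" using X(2)[OF fin] by blast
  qed
qed

lemma grade_has_sum_imp_sums: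
  fixes f :: "'a \<Rightarrow> 'b::{comm_monoid_add, t2_space}" and g :: "'a \<Rightarrow> nat"
  assumes fin: "\<And>n. finite {x. g x = n}" and hs: "(f has_sum s) UNIV"
  shows "(\<lambda>n. \<Sum>x | g x = n. f x) sums s"
proof -
  have finlt: "finite {x. g x < n}" for n
  proof -
    have "{x. g x < n} = (\<Union>i<n. {x. g x = i})" by auto
    then show ?thesis using fin by simp
  qed
  have "(\<lambda>n. sum f {x. g x < n}) \<longlonglongrightarrow> s"
    using filterlim_compose[OF hs[unfolded has_sum_def] filterlim_grade[OF finlt]] .
  moreover have "sum f {x. g x < n} = (\<Sum>i<n. \<Sum>x | g x = i. f x)" for n
  proof -
    have "sum f {x. g x < n} = sum f (\<Union>i\<in>{..<n}. {x. g x = i})" by (rule sum.cong) auto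
    also have "\<dots> = (\<Sum>i<n. \<Sum>x | g x = i. f x)" by (rule sum.UNION_disjoint) (use fin in auto)
    finally show ?thesis .
  qed
  ultimately show ?thesis by (simp add: sums_def)
qed

lemma grade_sums_imp_has_sum:
  fixes f :: "'a \<Rightarrow> real" and g :: "'a \<Rightarrow> nat"
  assumes fin: "\<And>n. finite {x. g x = n}" and nn: "\<And>x. f x \<ge> 0"
    and s: "(\<lambda>n. \<Sum>x | g x = n. f x) sums s"
  shows "(f has_sum s) UNIV"
proof -
  have "f summable_on UNIV"
  proof (rule nonneg_bdd_above_summable_on)
    show "bdd_above (sum f ` {F. F \<subseteq> UNIV \<and> finite F})"
    proof (rule bdd_aboveI2)
      fix F :: "'a set" assume "F \<in> {F. F \<subseteq> UNIV \<and> finite F}"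
      then have F: "finite F" by simp
      have "sum f F \<le> sum f (\<Union>i\<in>{..<Suc (\<Sum>x\<in>F. g x)}. {x. g x = i})"
        using F member_le_sum[of _ F g] by (intro sum_mono2) (auto simp: fin nn le_imp_less_Suc)
      also have "\<dots> = (\<Sum>i<Suc (\<Sum>x\<in>F. g x). \<Sum>x | g x = i. f x)"
        by (rule sum.UNION_disjoint) (use fin in auto)
      also have "\<dots> \<le> s"
        unfolding sums_unique[OF s] by (rule sum_le_suminf) (auto intro: sums_summable[OF s] sum_nonneg nn)
      finally show "sum f F \<le> s" .
    qed
  qed (use nn in auto)
  then have hs: "(f has_sum (infsum f UNIV)) UNIV" by simp
  then show ?thesis
    using sums_unique2[OF s grade_has_sum_imp_sums[OF fin hs]] by simp
qed

section \<open>The operator on functions of matrices\<close>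

definition to_mi :: "nat ^ 'd ^ 'k ^ 'l \<Rightarrow> 'l \<times> 'k \<times> 'd \<Rightarrow> nat" where
  "to_mi M = (\<lambda>(i, j, r). M $ i $ j $ r)"

definition of_mi :: "('l \<times> 'k \<times> 'd \<Rightarrow> nat) \<Rightarrow> nat ^ 'd ^ 'k ^ 'l" where
  "of_mi m = (\<chi> i j r. m (i, j, r))"

lemma of_mi_to_mi [simp]: "of_mi (to_mi M) = M"
  by (simp add: to_mi_def of_mi_def vec_eq_iff)

lemma to_mi_of_mi [simp]: "to_mi (of_mi m) = m"
  by (auto simp: to_mi_def of_mi_def)

lemma Mdeg_eq: "Mdeg M = mi_deg (to_mi M)"
  unfolding Mdeg_def mdeg_def mi_deg_def to_mi_def
  by (simp add: sum.cartesian_product)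

lemma Mfact_eq: "Mfact M = mi_fact (to_mi M)"
  unfolding Mfact_def mi_fact_def to_mi_def
  by (simp add: prod.cartesian_product split_def)

lemma finite_Mdeg [simp]: "finite {M. Mdeg M = S}"
proof -
  have "{M. Mdeg M = S} = of_mi ` {m. mi_deg m = S}"
    by (auto simp: Mdeg_eq image_iff) (metis of_mi_to_mi)
  then show ?thesis using finite_imageI[OF finite_mi_deg] by metis
qed

lemma sum_Mdeg: "(\<Sum>M | Mdeg M = S. f M) = (\<Sum>m | mi_deg m = S. f (of_mi m))"
  by (rule sum.reindex_bij_witness[where i = of_mi and j = to_mi]) (auto simp: Mdeg_eq)

lemma prod_UNIV_pair:
  fixes F :: "'x::finite \<Rightarrow> 'y::finite \<Rightarrow> 'c::comm_monoid_mult"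
  shows "(\<Prod>q\<in>UNIV. F (fst q) (snd q)) = (\<Prod>j\<in>UNIV. \<Prod>b\<in>UNIV. F j b)"
  by (simp add: prod.cartesian_product split_def)

lemma P_kernel_integrals:
  fixes M N :: "nat ^ 'd ^ 'k ^ 'l"
  defines "f \<equiv> \<lambda>i x. \<Prod>j\<in>UNIV. hermite_multi (M $ i $ j) (sqrt (1 / real CARD('k)) *\<^sub>R x) *
        hermite_multi (N $ i $ j) (sqrt (1 / real CARD('k)) *\<^sub>R x)"
  shows "integrable gauss (f i)"
    and "P_kernel M N = (\<Prod>i\<in>UNIV. \<integral>x. f i x \<partial>gauss)"
    and "P_kernel M N = kernel_mi (to_mi M) (to_mi N)"
proof -
  let ?c = "sqrt (1 / real CARD('k))"
  have f: "f i = (\<lambda>x. \<Prod>q\<in>UNIV. hermite_multi (if snd q then M $ i $ fst q else N $ i $ fst q) (?c *\<^sub>R x))" for i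
    unfolding f_def prod_UNIV_pair[where F = "\<lambda>j b. hermite_multi (if b then M $ i $ j else N $ i $ j) (?c *\<^sub>R x)" for x]
    by (rule ext, rule prod.cong) (auto simp: UNIV_bool mult.commute)
  show int: "integrable gauss (f i)" for i
    unfolding f by (rule integrable_prod_hermite_multi)
  show P: "P_kernel M N = (\<Prod>i\<in>UNIV. \<integral>x. f i x \<partial>gauss)"
  proof -
    have "P_kernel M N = (\<integral>x. (\<Prod>i\<in>UNIV. f i (x i)) \<partial>(\<Pi>\<^sub>M i\<in>UNIV. gauss))"
      unfolding P_kernel_def f_def ..
    also have "\<dots> = (\<Prod>i\<in>UNIV. \<integral>x. f i x \<partial>gauss)"
      by (rule gauss_pow.product_integral_prod) (auto intro: int)
    finally show ?thesis .
  qed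
  have "(\<integral>x. f i x \<partial>gauss) = (\<Prod>r\<in>UNIV. kernel_1d ?c (\<lambda>j. to_mi M (i, j, r)) (\<lambda>j. to_mi N (i, j, r)))" for i
  proof -
    have "(\<Prod>q\<in>UNIV. scaled_hermite_poly ?c ((if snd q then M $ i $ fst q else N $ i $ fst q) $ r)) =
        (\<Prod>j\<in>UNIV. scaled_hermite_poly ?c (M $ i $ j $ r) * scaled_hermite_poly ?c (N $ i $ j $ r))" for r
      unfolding prod_UNIV_pair[where F = "\<lambda>j b. scaled_hermite_poly ?c ((if b then M $ i $ j else N $ i $ j) $ r)"]
      by (rule prod.cong) (auto simp: UNIV_bool mult.commute)
    then show ?thesis
      unfolding f integral_prod_hermite_multi kernel_1d_def to_mi_def by simp
  qed
  then show "P_kernel M N = kernel_mi (to_mi M) (to_mi N)"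
    unfolding P kernel_mi_def by (simp add: prod.cartesian_product split_def)
qed

lemma P_op_scaled: "P_op \<phi> M * of_real (Mfact M) = (\<Sum>N | Mdeg N = Mdeg M. \<phi> N * of_real (P_kernel M N))"
proof -
  have "Mfact M \<noteq> 0" using mi_fact_pos[of "to_mi M"] by (simp add: Mfact_eq)
  then show ?thesis unfolding P_op_def by (simp add: sum_distrib_right)
qed

definition deg_inner where
  "deg_inner S \<phi> \<psi> = (\<Sum>M | Mdeg M = S. \<phi> M * cnj (\<psi> M) * of_real (Mfact M))"

definition deg_nsq where
  "deg_nsq S \<phi> = (\<Sum>M | Mdeg M = S. (norm (\<phi> M))\<^sup>2 * Mfact M)"

text \<open>
  The number \<open>gauss_kernel.eig\<close> as a function of \<open>\<mu>\<close>.
\<close>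

definition eigenvalue :: "real \<Rightarrow> nat \<Rightarrow> real" where
  "eigenvalue \<mu> p = pochhammer \<mu> p / fact p"

lemma Mfact_pos: "Mfact M > 0"
  by (simp add: Mfact_eq mi_fact_pos)

lemma deg_nsq_nonneg: "deg_nsq S \<phi> \<ge> 0"
  unfolding deg_nsq_def by (intro sum_nonneg mult_nonneg_nonneg) (auto intro: less_imp_le Mfact_pos)

context
  fixes \<mu> :: real
  assumes k: "CARD('k::finite) \<ge> 2"
    and mu: "\<mu> = (real CARD('k) - 1) * real CARD('l::finite) * real CARD('d::finite) / 2"
begin

interpretation gauss_kernel "Q_mi :: 'l \<times> 'k \<times> 'd \<Rightarrow> _ \<Rightarrow> complex" kernel_mi \<mu>
  by (rule gauss_kernel_mi[OF k mu])

lemma mu_gt_0: "\<mu> > 0" by (rule mu_pos)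

lemma eig_eq_eigenvalue: "eig = eigenvalue \<mu>"
  by (rule ext) (simp add: eig_def eigenvalue_def)

lemma P_op_eq: "P_op (\<phi> :: nat ^ 'd ^ 'k ^ 'l \<Rightarrow> complex) = (\<lambda>M. kernel_op (\<lambda>m. \<phi> (of_mi m)) (to_mi M))"
  by (rule ext) (simp add: P_op_def kernel_op_def kernel_apply_def kernel_column_def sum_Mdeg P_kernel_integrals(3) Mfact_eq Mdeg_eq[symmetric])

lemma deg_inner_eq: "deg_inner S (\<phi> :: nat ^ 'd ^ 'k ^ 'l \<Rightarrow> complex) \<psi> = mi_inner S (\<lambda>m. \<phi> (of_mi m)) (\<lambda>m. \<psi> (of_mi m))"
  by (simp add: deg_inner_def mi_inner_def sum_Mdeg Mfact_eq)

lemma deg_nsq_eq: "deg_nsq S (\<phi> :: nat ^ 'd ^ 'k ^ 'l \<Rightarrow> complex) = mi_nsq S (\<lambda>m. \<phi> (of_mi m))"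
  by (simp add: deg_nsq_def mi_nsq_def sum_Mdeg Mfact_eq)

lemma P_op_selfadjoint_deg: "deg_inner S (P_op (\<phi> :: nat ^ 'd ^ 'k ^ 'l \<Rightarrow> complex)) \<psi> = deg_inner S \<phi> (P_op \<psi>)"
  by (simp add: deg_inner_eq P_op_eq kernel_op_selfadjoint)

lemma P_op_bound_deg:
  "sqrt (deg_nsq S (P_op (\<phi> :: nat ^ 'd ^ 'k ^ 'l \<Rightarrow> complex))) \<le> max 1 (eigenvalue \<mu> (S div 2)) * sqrt (deg_nsq S \<phi>)"
  using kernel_op_bound by (simp add: deg_nsq_eq P_op_eq eig_eq_eigenvalue)

lemma P_op_idem: "\<mu> = 1 \<Longrightarrow> P_op (P_op (\<phi> :: nat ^ 'd ^ 'k ^ 'l \<Rightarrow> complex)) = P_op \<phi>"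
  by (simp add: P_op_eq kernel_op_idem)

text \<open>
  For \<open>\<mu> > 1\<close> these functions attain the norm; for \<open>\<mu> \<noteq> 1\<close> the case \<open>p = 1\<close> shows that the operator
  is not idempotent.
\<close>

lemma P_op_eigenvector:
  assumes "p \<le> S div 2"
  obtains \<phi> :: "nat ^ 'd ^ 'k ^ 'l \<Rightarrow> complex"
  where "\<phi> \<in> F_deg S" "\<exists>M. \<phi> M \<noteq> 0" "P_op \<phi> = (\<lambda>M. of_real (eigenvalue \<mu> p) * \<phi> M)"
proof -
  obtain g where g: "\<And>m. g m \<noteq> 0 \<Longrightarrow> mi_deg m = S" "\<exists>m. g m \<noteq> 0" "kernel_op g = (\<lambda>m. of_real (eig p) * g m)"
    using kernel_op_eigenvector[OF assms] by metis
  show ?thesis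
  proof (rule that[of "\<lambda>M. g (to_mi M)"])
    show "(\<lambda>M. g (to_mi M)) \<in> F_deg S" using g(1) by (auto simp: F_deg_def Mdeg_eq)
    show "\<exists>M. g (to_mi M) \<noteq> 0" using g(2) by (metis to_mi_of_mi)
    show "P_op (\<lambda>M. g (to_mi M)) = (\<lambda>M. of_real (eigenvalue \<mu> p) * g (to_mi M))"
      unfolding P_op_eq by (simp add: g(3) eig_eq_eigenvalue)
  qed
qed

lemma P_block_eq: "P_block S (\<phi> :: nat ^ 'd ^ 'k ^ 'l \<Rightarrow> complex) = deg_inner S \<phi> (P_op \<phi>)"
  by (simp add: P_block_def deg_inner_def)

lemma P_block_real: "P_block S (\<phi> :: nat ^ 'd ^ 'k ^ 'l \<Rightarrow> complex) \<in> \<real>"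
proof -
  have "cnj (deg_inner S \<phi> (P_op \<phi>)) = deg_inner S \<phi> (P_op \<phi>)"
    by (simp add: deg_inner_eq mi_inner_cnj P_op_eq kernel_op_selfadjoint)
  then show ?thesis by (simp add: P_block_eq complex_is_Real_iff complex_eq_iff)
qed

lemma P_block_nonneg: "Re (P_block S (\<phi> :: nat ^ 'd ^ 'k ^ 'l \<Rightarrow> complex)) \<ge> 0"
  by (simp add: P_block_eq deg_inner_eq P_op_eq mi_inner_kernel_op_nonneg)

lemma P_block_le: "Re (P_block S (\<phi> :: nat ^ 'd ^ 'k ^ 'l \<Rightarrow> complex)) \<le> max 1 (eigenvalue \<mu> (S div 2)) * deg_nsq S \<phi>"
proof -
  have "Re (P_block S \<phi>) \<le> sqrt (deg_nsq S \<phi>) * sqrt (deg_nsq S (P_op \<phi>))"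
    unfolding P_block_eq deg_inner_eq deg_nsq_eq
    by (rule order_trans[OF complex_Re_le_cmod mi_inner_cauchy_schwarz])
  also have "\<dots> \<le> sqrt (deg_nsq S \<phi>) * (max 1 (eigenvalue \<mu> (S div 2)) * sqrt (deg_nsq S \<phi>))"
    by (intro mult_left_mono P_op_bound_deg) (simp add: deg_nsq_nonneg)
  also have "\<dots> = max 1 (eigenvalue \<mu> (S div 2)) * deg_nsq S \<phi>"
    using deg_nsq_nonneg[of S \<phi>] by (simp add: mult.left_commute)
  finally show ?thesis .
qed

end

section \<open>The Hilbert space as a sum over degrees\<close>

lemma F_space_iff_sums: "\<phi> \<in> F_space \<longleftrightarrow> summable (\<lambda>S. deg_nsq S \<phi>)"
  and F_space_norm: "\<phi> \<in> F_space \<Longrightarrow> (\<lambda>S. deg_nsq S \<phi>) sums (F_norm \<phi>)\<^sup>2"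
proof -
  let ?f = "\<lambda>M. (norm (\<phi> M))\<^sup>2 * Mfact M"
  have nn: "?f M \<ge> 0" for M using Mfact_pos[of M] by simp
  show "\<phi> \<in> F_space \<longleftrightarrow> summable (\<lambda>S. deg_nsq S \<phi>)"
  proof
    assume "\<phi> \<in> F_space"
    then obtain s where "(?f has_sum s) UNIV" by (auto simp: F_space_def summable_on_def)
    from grade_has_sum_imp_sums[of Mdeg, OF finite_Mdeg this]
    show "summable (\<lambda>S. deg_nsq S \<phi>)" unfolding deg_nsq_def by (rule sums_summable)
  next
    assume "summable (\<lambda>S. deg_nsq S \<phi>)"
    from grade_sums_imp_has_sum[of Mdeg ?f, OF finite_Mdeg nn summable_sums[OF this, unfolded deg_nsq_def]]
    have "?f summable_on UNIV" by (rule has_sum_imp_summable)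
    then show "\<phi> \<in> F_space" by (simp add: F_space_def)
  qed
  assume "\<phi> \<in> F_space"
  then have "(?f has_sum infsum ?f UNIV) UNIV" by (simp add: F_space_def)
  from grade_has_sum_imp_sums[of Mdeg, OF finite_Mdeg this]
  show "(\<lambda>S. deg_nsq S \<phi>) sums (F_norm \<phi>)\<^sup>2"
    unfolding F_norm_def deg_nsq_def using infsum_nonneg[of UNIV ?f] nn by simp
qed

lemma F_inner_sums:
  assumes "(\<lambda>M. \<phi> M * cnj (\<psi> M) * of_real (Mfact M)) summable_on UNIV"
  shows "(\<lambda>S. deg_inner S \<phi> \<psi>) sums F_inner \<phi> \<psi>"
  unfolding deg_inner_def F_inner_def
  by (rule grade_has_sum_imp_sums) (use assms in auto)

lemma F_inner_summable:
  assumes "\<phi> \<in> F_space" "\<psi> \<in> F_space"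
  shows "(\<lambda>M. \<phi> M * cnj (\<psi> M) * of_real (Mfact M)) summable_on UNIV"
proof -
  have "(\<lambda>M. (norm (\<phi> M))\<^sup>2 * Mfact M + (norm (\<psi> M))\<^sup>2 * Mfact M) summable_on UNIV"
    using assms unfolding F_space_def by (auto intro: summable_on_add)
  moreover have "norm (\<phi> M * cnj (\<psi> M) * of_real (Mfact M)) \<le> (norm (\<phi> M))\<^sup>2 * Mfact M + (norm (\<psi> M))\<^sup>2 * Mfact M" for M
  proof -
    have "norm (\<phi> M) * norm (\<psi> M) \<le> (norm (\<phi> M))\<^sup>2 + (norm (\<psi> M))\<^sup>2"
      using sum_squares_bound[of "norm (\<phi> M)" "norm (\<psi> M)"]
        mult_nonneg_nonneg[OF norm_ge_zero[of "\<phi> M"] norm_ge_zero[of "\<psi> M"]] by linarith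
    then have "norm (\<phi> M) * norm (\<psi> M) * Mfact M \<le> ((norm (\<phi> M))\<^sup>2 + (norm (\<psi> M))\<^sup>2) * Mfact M"
      by (rule mult_right_mono) (simp add: less_imp_le Mfact_pos)
    then show ?thesis using Mfact_pos[of M] by (simp add: norm_mult distrib_right)
  qed
  ultimately have "(\<lambda>M. norm (\<phi> M * cnj (\<psi> M) * of_real (Mfact M))) summable_on UNIV"
    by (rule summable_on_comparison_test) auto
  then show ?thesis by (rule abs_summable_summable)
qed

lemma F_deg_subset: "\<phi> \<in> F_deg S \<Longrightarrow> \<phi> \<in> F_space"
  and F_norm_deg: "\<phi> \<in> F_deg S \<Longrightarrow> F_norm \<phi> = sqrt (deg_nsq S \<phi>)"
proof -
  assume \<phi>: "\<phi> \<in> F_deg S"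
  have "deg_nsq T \<phi> = 0" if "T \<noteq> S" for T
    using \<phi> that by (auto simp: deg_nsq_def F_deg_def intro!: sum.neutral)
  then have s: "(\<lambda>T. deg_nsq T \<phi>) sums deg_nsq S \<phi>"
    using sums_finite[of "{S}" "\<lambda>T. deg_nsq T \<phi>"] by simp
  then show F: "\<phi> \<in> F_space" by (auto simp: F_space_iff_sums summable_def)
  have "(F_norm \<phi>)\<^sup>2 = deg_nsq S \<phi>" using sums_unique2[OF F_space_norm[OF F] s] .
  moreover have "F_norm \<phi> \<ge> 0" unfolding F_norm_def
    by (intro real_sqrt_ge_zero infsum_nonneg mult_nonneg_nonneg) (auto simp: less_imp_le[OF Mfact_pos])
  ultimately show "F_norm \<phi> = sqrt (deg_nsq S \<phi>)" by (metis real_sqrt_unique)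
qed

lemma P_op_F_deg: "\<phi> \<in> F_deg S \<Longrightarrow> P_op \<phi> \<in> F_deg S"
  by (auto simp: F_deg_def P_op_def intro!: sum.neutral)

lemma P_op_linear: "P_op (\<lambda>M. a * \<phi> M + b * \<psi> M) = (\<lambda>M. a * P_op \<phi> M + b * P_op \<psi> M)"
  unfolding P_op_def sum_distrib_left sum.distrib[symmetric]
  by (rule ext, rule sum.cong) (simp_all add: distrib_right add_divide_distrib mult.assoc)

lemma F_norm_cmul: "\<phi> \<in> F_deg S \<Longrightarrow> F_norm (\<lambda>M. c * \<phi> M) = norm c * F_norm \<phi>"
proof -
  assume \<phi>: "\<phi> \<in> F_deg S"
  then have c: "(\<lambda>M. c * \<phi> M) \<in> F_deg S" by (auto simp: F_deg_def)
  have "deg_nsq S (\<lambda>M. c * \<phi> M) = (norm c)\<^sup>2 * deg_nsq S \<phi>"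
    unfolding deg_nsq_def by (simp add: norm_mult power_mult_distrib sum_distrib_left mult.assoc)
  then show ?thesis using F_norm_deg[OF \<phi>] F_norm_deg[OF c] by (simp add: real_sqrt_mult)
qed

lemma F_norm_pos: "\<phi> \<in> F_deg S \<Longrightarrow> \<phi> M \<noteq> 0 \<Longrightarrow> F_norm \<phi> > 0"
proof -
  assume \<phi>: "\<phi> \<in> F_deg S" and M: "\<phi> M \<noteq> 0"
  have "Mdeg M = S" using \<phi> M by (auto simp: F_deg_def)
  then have "(norm (\<phi> M))\<^sup>2 * Mfact M \<le> deg_nsq S \<phi>"
    unfolding deg_nsq_def
    by (intro member_le_sum mult_nonneg_nonneg) (auto simp: less_imp_le[OF Mfact_pos])
  moreover have "(norm (\<phi> M))\<^sup>2 * Mfact M > 0" using M by (intro mult_pos_pos Mfact_pos) simp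
  ultimately show ?thesis using F_norm_deg[OF \<phi>] by simp
qed

section \<open>Growth of the eigenvalues\<close>

text \<open>
  Up to the factor \<open>p / (\<mu> + p)\<close> the quotient of the two sides is \<open>\<Gamma>(\<mu>)\<close> over the \<open>p\<close>-th term of Euler's
  sequence for \<open>\<Gamma>(\<mu>)\<close>.
\<close>

lemma eigenvalue_asymp:
  assumes "\<mu> > 0"
  shows "eigenvalue \<mu> \<sim>[sequentially] (\<lambda>p. real p powr (\<mu> - 1) / Gamma \<mu>)"
proof -
  have Gz: "Gamma \<mu> \<noteq> 0" using Gamma_real_pos[OF assms] by linarith
  have "(\<lambda>p. (Gamma \<mu> / Gamma_series \<mu> p) * (real p / (\<mu> + real p))) \<longlonglongrightarrow> (Gamma \<mu> / Gamma \<mu>) * 1"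
  proof (intro tendsto_mult tendsto_divide tendsto_const Gamma_series_LIMSEQ)
    show "(\<lambda>p. real p / (\<mu> + real p)) \<longlonglongrightarrow> 1" by real_asymp
  qed (use Gamma_real_pos[OF assms] in simp)
  then have lim: "(\<lambda>p. (Gamma \<mu> / Gamma_series \<mu> p) * (real p / (\<mu> + real p))) \<longlonglongrightarrow> 1"
    using Gamma_real_pos[OF assms] by simp
  show ?thesis
  proof (rule asymp_equivI')
    have "eventually (\<lambda>p. (Gamma \<mu> / Gamma_series \<mu> p) * (real p / (\<mu> + real p)) =
        eigenvalue \<mu> p / (real p powr (\<mu> - 1) / Gamma \<mu>)) sequentially"
      using eventually_gt_at_top[of 0]
    proof eventually_elim
      case (elim p)
      have pp: "pochhammer \<mu> p > 0" using assms by (rule pochhammer_pos)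
      have G: "Gamma_series \<mu> p = fact p * (real p * real p powr (\<mu> - 1)) / (pochhammer \<mu> p * (\<mu> + real p))"
        using elim by (simp add: Gamma_series_def pochhammer_Suc powr_def exp_diff algebra_simps)
      have cancel: "g / (f * (q * w) / (h * m)) * (q / m) = h / f / (w / g)"
        if "g \<noteq> 0" "f \<noteq> 0" "q \<noteq> 0" "w \<noteq> 0" "h \<noteq> 0" "m \<noteq> 0" for g f q w h m :: real
        using that by (simp add: divide_simps)
      show ?case unfolding G eigenvalue_def
        by (rule cancel) (use pp elim assms Gz in auto)
    qed
    then show "(\<lambda>p. eigenvalue \<mu> p / (real p powr (\<mu> - 1) / Gamma \<mu>)) \<longlonglongrightarrow> 1"
      using lim by (rule Lim_transform_eventually[rotated])
  qed
qed

lemma eigenvalue_half_asymp: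
  assumes "\<mu> > 0"
  shows "(\<lambda>S. eigenvalue \<mu> (S div 2)) \<sim>[sequentially] (\<lambda>S. real S powr (\<mu> - 1) / (2 powr (\<mu> - 1) * Gamma \<mu>))"
proof -
  have half: "filterlim (\<lambda>S :: nat. S div 2) sequentially sequentially"
    unfolding filterlim_at_top
  proof
    fix Z :: nat
    show "eventually (\<lambda>S. Z \<le> S div 2) sequentially"
      using eventually_ge_at_top[of "2 * Z"] by eventually_elim auto
  qed
  have "(\<lambda>S. eigenvalue \<mu> (S div 2)) \<sim>[sequentially] (\<lambda>S. real (S div 2) powr (\<mu> - 1) / Gamma \<mu>)"
    using asymp_equiv_compose'[OF eigenvalue_asymp[OF assms] half] .
  also have "(\<lambda>S. real (S div 2) powr (\<mu> - 1) / Gamma \<mu>) \<sim>[sequentially] (\<lambda>S. (real S / 2) powr (\<mu> - 1) / Gamma \<mu>)"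
  proof -
    have "(\<lambda>S. real (S div 2) / (real S / 2)) \<longlonglongrightarrow> 1"
    proof (rule tendsto_sandwich)
      show "eventually (\<lambda>S. 1 - 1 / real S \<le> real (S div 2) / (real S / 2)) sequentially"
        using eventually_gt_at_top[of 0]
      proof eventually_elim
        case (elim S)
        have "S \<le> 2 * (S div 2) + 1" by linarith
        then have "real S - 1 \<le> 2 * real (S div 2)" by linarith
        then have "(real S - 1) / real S \<le> 2 * real (S div 2) / real S"
          by (rule divide_right_mono) simp
        then show ?case using elim by (simp add: diff_divide_distrib mult.commute)
      qed
      show "eventually (\<lambda>S. real (S div 2) / (real S / 2) \<le> 1) sequentially"
        using eventually_gt_at_top[of 0]
      proof eventually_elim
        case (elim S)
        have "2 * (S div 2) \<le> S" by simp
        then have "2 * real (S div 2) \<le> real S" by linarith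
        then show ?case using elim by (simp add: field_simps)
      qed
      show "(\<lambda>S. 1 - 1 / real S) \<longlonglongrightarrow> 1" by real_asymp
    qed simp
    then have "(\<lambda>S. real (S div 2)) \<sim>[sequentially] (\<lambda>S. real S / 2)"
      by (rule asymp_equivI')
    then have "(\<lambda>S. real (S div 2) powr (\<mu> - 1)) \<sim>[sequentially] (\<lambda>S. (real S / 2) powr (\<mu> - 1))"
      by (rule asymp_equiv_powr_real) auto
    then show ?thesis by (rule asymp_equiv_divide[OF _ asymp_equiv_refl])
  qed
  also have "(\<lambda>S. (real S / 2) powr (\<mu> - 1) / Gamma \<mu>) = (\<lambda>S. real S powr (\<mu> - 1) / (2 powr (\<mu> - 1) * Gamma \<mu>))"
    by (simp add: powr_divide)
  finally show ?thesis .
qed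

lemma eigenvalue_unbounded:
  assumes "\<mu> > 1"
  shows "filterlim (\<lambda>S. eigenvalue \<mu> (S div 2)) at_top sequentially"
proof (rule asymp_equiv_at_top_transfer[OF asymp_equiv_symI[OF eigenvalue_half_asymp]])
  have "2 powr (\<mu> - 1) * Gamma \<mu> > 0" using assms by (simp add: Gamma_real_pos)
  then have pos: "inverse (2 powr (\<mu> - 1) * Gamma \<mu>) > 0" by (rule positive_imp_inverse_positive)
  have "filterlim (\<lambda>S. real S powr (\<mu> - 1)) at_top sequentially"
    using assms by real_asymp
  from filterlim_tendsto_pos_mult_at_top[OF tendsto_const pos this]
  show "filterlim (\<lambda>S. real S powr (\<mu> - 1) / (2 powr (\<mu> - 1) * Gamma \<mu>)) at_top sequentially"
    by (simp add: divide_inverse mult.commute)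
qed (use assms in auto)

lemma eigenvalue_ge_1: "\<mu> > 1 \<Longrightarrow> eigenvalue \<mu> p \<ge> 1"
proof (induction p)
  case (Suc p)
  have "eigenvalue \<mu> (Suc p) = eigenvalue \<mu> p * ((\<mu> + real p) / (real p + 1))"
    by (simp add: eigenvalue_def pochhammer_Suc field_simps)
  moreover have "(\<mu> + real p) / (real p + 1) \<ge> 1" using Suc.prems by (simp add: field_simps)
  ultimately show ?case using Suc mult_mono[of 1 "eigenvalue \<mu> p" 1 "(\<mu> + real p) / (real p + 1)"] by simp
qed (simp add: eigenvalue_def)

section \<open>Projections and norms\<close>

context
  fixes \<mu> :: real
  assumes k: "CARD('k::finite) \<ge> 2"
    and mu: "\<mu> = (real CARD('k) - 1) * real CARD('l::finite) * real CARD('d::finite) / 2"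
begin

lemma projection_imp_mu_1:
  assumes "S \<ge> 2" "\<And>\<phi> :: nat ^ 'd ^ 'k ^ 'l \<Rightarrow> complex. \<phi> \<in> F_deg S \<Longrightarrow> P_op (P_op \<phi>) = P_op \<phi>"
  shows "\<mu> = 1"
proof -
  have "1 \<le> S div 2" using assms(1) by simp
  then obtain \<phi> :: "nat ^ 'd ^ 'k ^ 'l \<Rightarrow> complex" where \<phi>: "\<phi> \<in> F_deg S" "\<exists>M. \<phi> M \<noteq> 0"
    "P_op \<phi> = (\<lambda>M. of_real (eigenvalue \<mu> 1) * \<phi> M)"
    by (rule P_op_eigenvector[OF k mu])
  then obtain M where M: "\<phi> M \<noteq> 0" by blast
  have "P_op (P_op \<phi>) = (\<lambda>M. of_real (eigenvalue \<mu> 1) * P_op \<phi> M)"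
    using P_op_linear[of "of_real (eigenvalue \<mu> 1)" \<phi> 0 "\<lambda>_. 0"] \<phi>(3) by simp
  then have "of_real \<mu> * (of_real \<mu> * \<phi> M) = of_real \<mu> * \<phi> M"
    using assms(2)[OF \<phi>(1)] \<phi>(3) by (metis (no_types, lifting) eigenvalue_def pochhammer_1 fact_1 div_by_1)
  then show ?thesis using M mu_gt_0[OF k mu] by simp
qed

lemma P_op_F_norm_le:
  assumes "(\<phi> :: nat ^ 'd ^ 'k ^ 'l \<Rightarrow> complex) \<in> F_deg S"
  shows "F_norm (P_op \<phi>) \<le> max 1 (eigenvalue \<mu> (S div 2)) * F_norm \<phi>"
  using P_op_bound_deg[OF k mu, of S \<phi>] F_norm_deg[OF assms] F_norm_deg[OF P_op_F_deg[OF assms]] by simp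

lemma P_op_F_space:
  assumes "\<mu> = 1" "(\<phi> :: nat ^ 'd ^ 'k ^ 'l \<Rightarrow> complex) \<in> F_space"
  shows "P_op \<phi> \<in> F_space"
proof -
  have "deg_nsq S (P_op \<phi>) \<le> deg_nsq S \<phi>" for S
    using P_op_bound_deg[OF k mu, of S \<phi>] assms(1) by (simp add: eigenvalue_def pochhammer_fact[symmetric])
  then show ?thesis
    using assms(2) unfolding F_space_iff_sums
    by (elim summable_comparison_test'[where N = 0]) (simp add: deg_nsq_nonneg)
qed

text \<open>
  Stated for any invariant set \<open>V\<close>, which is used for a single degree and for the whole space.
\<close>

lemma P_op_projection:
  assumes "\<mu> = 1" and sub: "V \<subseteq> F_space" "\<And>\<phi>. \<phi> \<in> V \<Longrightarrow> P_op \<phi> \<in> V"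
  shows "is_projection_on (V :: (nat ^ 'd ^ 'k ^ 'l \<Rightarrow> complex) set) P_op"
  unfolding is_projection_on_def
proof (intro conjI ballI allI)
  fix \<phi> \<psi> assume "\<phi> \<in> V" "\<psi> \<in> V"
  then have F: "\<phi> \<in> F_space" "\<psi> \<in> F_space" "P_op \<phi> \<in> F_space" "P_op \<psi> \<in> F_space"
    using sub P_op_F_space[OF assms(1)] by auto
  have "(\<lambda>S. deg_inner S (P_op \<phi>) \<psi>) sums F_inner (P_op \<phi>) \<psi>"
    by (rule F_inner_sums[OF F_inner_summable]) (use F in auto)
  moreover have "(\<lambda>S. deg_inner S (P_op \<phi>) \<psi>) sums F_inner \<phi> (P_op \<psi>)"
    unfolding P_op_selfadjoint_deg[OF k mu]
    by (rule F_inner_sums[OF F_inner_summable]) (use F in auto)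
  ultimately show "F_inner (P_op \<phi>) \<psi> = F_inner \<phi> (P_op \<psi>)" by (rule sums_unique2)
qed (use assms P_op_linear P_op_idem[OF k mu] in auto)

text \<open>
  The supremum is attained at a normalized eigenvector.
\<close>

lemma op_norm_P_op:
  assumes "\<mu> > 1"
  shows "op_norm_on (F_deg S :: (nat ^ 'd ^ 'k ^ 'l \<Rightarrow> complex) set) P_op = eigenvalue \<mu> (S div 2)"
  unfolding op_norm_on_def
proof (rule cSup_eq_maximum)
  obtain \<phi> :: "nat ^ 'd ^ 'k ^ 'l \<Rightarrow> complex" where \<phi>: "\<phi> \<in> F_deg S" "\<exists>M. \<phi> M \<noteq> 0"
    "P_op \<phi> = (\<lambda>M. of_real (eigenvalue \<mu> (S div 2)) * \<phi> M)"
    by (rule P_op_eigenvector[OF k mu order_refl])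
  have pos: "F_norm \<phi> > 0" using F_norm_pos[OF \<phi>(1)] \<phi>(2) by blast
  define c where "c = complex_of_real (1 / F_norm \<phi>)"
  define \<psi> where "\<psi> = (\<lambda>M. c * \<phi> M)"
  have \<psi>: "\<psi> \<in> F_deg S" using \<phi>(1) by (auto simp: \<psi>_def F_deg_def)
  have n: "F_norm \<psi> = 1"
    unfolding \<psi>_def F_norm_cmul[OF \<phi>(1)] c_def using pos by (simp add: norm_divide)
  have "P_op \<psi> = (\<lambda>M. of_real (eigenvalue \<mu> (S div 2)) * \<psi> M)"
    using P_op_linear[of c \<phi> 0 "\<lambda>_. 0"] \<phi>(3) by (simp add: \<psi>_def mult_ac)
  then have "F_norm (P_op \<psi>) = eigenvalue \<mu> (S div 2)"
    using F_norm_cmul[OF \<psi>] n eigenvalue_ge_1[OF assms, of "S div 2"] by simp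
  then show "eigenvalue \<mu> (S div 2) \<in> {F_norm (P_op \<phi>) |\<phi> :: nat ^ 'd ^ 'k ^ 'l \<Rightarrow> complex. \<phi> \<in> F_deg S \<and> F_norm \<phi> \<le> 1}"
    using \<psi> n by (metis (mono_tags, lifting) mem_Collect_eq order_refl)
next
  fix y assume "y \<in> {F_norm (P_op \<phi>) |\<phi> :: nat ^ 'd ^ 'k ^ 'l \<Rightarrow> complex. \<phi> \<in> F_deg S \<and> F_norm \<phi> \<le> 1}"
  then obtain \<phi> :: "nat ^ 'd ^ 'k ^ 'l \<Rightarrow> complex" where
    \<phi>: "\<phi> \<in> F_deg S" "F_norm \<phi> \<le> 1" "y = F_norm (P_op \<phi>)" by auto
  have "y \<le> eigenvalue \<mu> (S div 2) * F_norm \<phi>"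
    using P_op_F_norm_le[OF \<phi>(1)] \<phi>(3) eigenvalue_ge_1[OF assms, of "S div 2"] by (simp add: max_def split: if_splits)
  also have "\<dots> \<le> eigenvalue \<mu> (S div 2) * 1"
    using eigenvalue_ge_1[OF assms, of "S div 2"] \<phi>(2) by (intro mult_left_mono) auto
  finally show "y \<le> eigenvalue \<mu> (S div 2)" by simp
qed

lemma P_op_unbounded:
  assumes "\<mu> > 1"
  shows "\<not> bounded_on {\<phi> \<in> (F_space :: (nat ^ 'd ^ 'k ^ 'l \<Rightarrow> complex) set). P_op \<phi> \<in> F_space} P_op"
proof
  assume "bounded_on {\<phi> \<in> (F_space :: (nat ^ 'd ^ 'k ^ 'l \<Rightarrow> complex) set). P_op \<phi> \<in> F_space} P_op"
  then obtain C where C: "\<And>\<phi> :: nat ^ 'd ^ 'k ^ 'l \<Rightarrow> complex.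
      \<phi> \<in> F_space \<Longrightarrow> P_op \<phi> \<in> F_space \<Longrightarrow> F_norm (P_op \<phi>) \<le> C * F_norm \<phi>"
    unfolding bounded_on_def by auto
  have "eigenvalue \<mu> (S div 2) \<le> C" for S
  proof -
    obtain \<phi> :: "nat ^ 'd ^ 'k ^ 'l \<Rightarrow> complex" where \<phi>: "\<phi> \<in> F_deg S" "\<exists>M. \<phi> M \<noteq> 0"
      "P_op \<phi> = (\<lambda>M. of_real (eigenvalue \<mu> (S div 2)) * \<phi> M)"
      by (rule P_op_eigenvector[OF k mu order_refl])
    have pos: "F_norm \<phi> > 0" using F_norm_pos[OF \<phi>(1)] \<phi>(2) by blast
    have "F_norm (P_op \<phi>) \<le> C * F_norm \<phi>"
      by (rule C) (use \<phi>(1) P_op_F_deg F_deg_subset in blast)+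
    then show ?thesis
      using F_norm_cmul[OF \<phi>(1)] \<phi>(3) pos eigenvalue_ge_1[OF assms, of "S div 2"] by simp
  qed
  moreover have "eventually (\<lambda>S. eigenvalue \<mu> (S div 2) > C) sequentially"
    using eigenvalue_unbounded[OF assms] by (simp add: filterlim_at_top_dense)
  ultimately show False by (auto simp: eventually_sequentially not_less[symmetric])
qed

end

lemma eigenvalue_prod: "eigenvalue \<mu> n = (\<Prod>i<n. \<mu> + real i) / fact n"
  by (simp add: eigenvalue_def pochhammer_prod lessThan_atLeast0)

section \<open>Square integrable functions of the Gaussian measure\<close>

text \<open>
  The squared norm with values in \<open>[0,\<infinity>]\<close>, so that estimates can precede the proof that a function
  is square integrable.
\<close>

definition L2_sq :: "(real ^ 'd \<Rightarrow> complex) \<Rightarrow> ennreal" where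
  "L2_sq f = (\<integral>\<^sup>+x. ennreal ((norm (f x))\<^sup>2) \<partial>gauss)"

lemma L2_iff: "f \<in> L2 \<longleftrightarrow> f \<in> borel_measurable borel \<and> L2_sq f < \<infinity>"
proof -
  have "integrable gauss (\<lambda>x. (norm (f x))\<^sup>2) \<longleftrightarrow> L2_sq f < \<infinity>" if [measurable]: "f \<in> borel_measurable borel"
    by (simp add: integrable_iff_bounded L2_sq_def)
  then show ?thesis by (auto simp: L2_def)
qed

lemma L2_sq_L2_norm: "f \<in> L2 \<Longrightarrow> L2_sq f = ennreal ((L2_norm f)\<^sup>2)"
  unfolding L2_sq_def L2_norm_def L2_def by (subst nn_integral_eq_integral) (auto intro: integral_nonneg)

lemma L2_sq_integral: "f \<in> L2 \<Longrightarrow> L2_sq f = ennreal (\<integral>x. (norm (f x))\<^sup>2 \<partial>gauss)"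
  unfolding L2_sq_def L2_def by (subst nn_integral_eq_integral) auto

lemma L2_norm_nonneg: "L2_norm f \<ge> 0"
  unfolding L2_norm_def by (intro real_sqrt_ge_zero integral_nonneg) auto

lemma L2_sq_cong_AE: "(AE x in gauss. f x = g x) \<Longrightarrow> L2_sq f = L2_sq g"
  unfolding L2_sq_def by (intro nn_integral_cong_AE) auto

lemma ennreal_tendsto_0I:
  assumes "\<And>e :: real. e > 0 \<Longrightarrow> eventually (\<lambda>n. f n \<le> ennreal e) F"
  shows "(f \<longlongrightarrow> (0 :: ennreal)) F"
proof (rule order_tendstoI)
  fix a :: ennreal assume a: "0 < a"
  obtain e :: real where e: "e > 0" "ennreal e < a"
  proof (cases a)
    case (real r)
    then show ?thesis using a that[of "r / 2"] by (auto simp: ennreal_less_iff)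
  next
    case top
    then show ?thesis using that[of 1] by simp
  qed
  show "eventually (\<lambda>n. f n < a) F"
    using assms[OF e(1)] by eventually_elim (use e(2) in auto)
qed auto

lemma ennreal_tendsto_0D:
  fixes f :: "'x \<Rightarrow> ennreal"
  assumes "(f \<longlongrightarrow> 0) F" "e > 0"
  shows "eventually (\<lambda>n. f n \<le> ennreal e) F"
  using order_tendstoD(2)[OF assms(1), of "ennreal e"] assms(2) by (auto elim: eventually_mono)

lemma L2_sq_eq_0_imp_AE:
  assumes [measurable]: "f \<in> borel_measurable borel" and "L2_sq f = 0"
  shows "AE x in gauss. f x = 0"
  using assms(2) unfolding L2_sq_def by (subst (asm) nn_integral_0_iff_AE) auto

lemma L2_sq_zero [simp]: "L2_sq (\<lambda>x. 0) = 0"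
  by (simp add: L2_sq_def)

lemma norm_add_sq_le: "(norm (a + b))\<^sup>2 \<le> 2 * (norm a)\<^sup>2 + 2 * (norm (b :: complex))\<^sup>2"
proof -
  have "(norm (a + b))\<^sup>2 \<le> (norm a + norm b)\<^sup>2"
    by (intro power_mono norm_triangle_ineq) auto
  also have "\<dots> \<le> 2 * (norm a)\<^sup>2 + 2 * (norm b)\<^sup>2"
    using sum_squares_bound[of "norm a" "norm b"] by (simp add: power2_sum)
  finally show ?thesis .
qed

lemma L2_sq_add_le:
  assumes [measurable]: "f \<in> borel_measurable borel" "g \<in> borel_measurable borel"
  shows "L2_sq (\<lambda>x. f x + g x) \<le> 2 * L2_sq f + 2 * L2_sq g"
proof -
  have "L2_sq (\<lambda>x. f x + g x) \<le> (\<integral>\<^sup>+x. 2 * ennreal ((norm (f x))\<^sup>2) + 2 * ennreal ((norm (g x))\<^sup>2) \<partial>gauss)"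
    unfolding L2_sq_def
  proof (rule nn_integral_mono)
    fix x
    have "ennreal ((norm (f x + g x))\<^sup>2) \<le> ennreal (2 * (norm (f x))\<^sup>2 + 2 * (norm (g x))\<^sup>2)"
      by (intro ennreal_leI norm_add_sq_le)
    then show "ennreal ((norm (f x + g x))\<^sup>2) \<le> 2 * ennreal ((norm (f x))\<^sup>2) + 2 * ennreal ((norm (g x))\<^sup>2)"
      by (simp add: ennreal_plus ennreal_mult)
  qed
  also have "\<dots> = 2 * L2_sq f + 2 * L2_sq g"
    unfolding L2_sq_def by (simp add: nn_integral_add nn_integral_cmult)
  finally show ?thesis .
qed

lemma L2_sq_cmul:
  assumes [measurable]: "f \<in> borel_measurable borel"
  shows "L2_sq (\<lambda>x. c * f x) = ennreal ((norm c)\<^sup>2) * L2_sq f"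
  unfolding L2_sq_def by (simp add: norm_mult power_mult_distrib ennreal_mult nn_integral_cmult)

lemma L2_sq_diff_commute: "L2_sq (\<lambda>x. f x - g x) = L2_sq (\<lambda>x. g x - f x)"
  unfolding L2_sq_def by (simp add: norm_minus_commute)

text \<open>
  The change of variables \<open>y = x / \<surd>k\<close> has Jacobian \<open>k\<close> to the power \<open>d/2\<close>, and the Gaussian density at \<open>\<surd>k y\<close> is at
  most the density at \<open>y\<close>. This estimate makes \<open>H\<^sub>m(x) \<mapsto> H\<^sub>m(\<lambda>x)\<close> a bounded operator, although the
  dilated polynomials are no longer orthogonal.
\<close>

lemma L2_sq_dilate_le:
  fixes f :: "real ^ 'd \<Rightarrow> complex"
  assumes [measurable]: "f \<in> borel_measurable borel" and k: "k \<ge> 1"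
  shows "L2_sq (\<lambda>x. f (sqrt (1 / real k) *\<^sub>R x)) \<le> ennreal (sqrt (real k) ^ CARD('d)) * L2_sq f"
proof -
  let ?c = "sqrt (1 / real k)"
  have c: "?c > 0" "?c \<noteq> 0" using k by auto
  define D where "D x = (2 * pi) powr (- real CARD('d) / 2) * exp (- (norm x)\<^sup>2 / 2)" for x :: "real ^ 'd"
  have [measurable]: "D \<in> borel_measurable borel" unfolding D_def by measurable
  have D_nn: "D x \<ge> 0" for x by (simp add: D_def)
  have L2_sq: "L2_sq h = (\<integral>\<^sup>+x. ennreal (D x) * ennreal ((norm (h x))\<^sup>2) \<partial>lborel)"
    if [measurable]: "h \<in> borel_measurable borel" for h :: "real ^ 'd \<Rightarrow> complex"
    unfolding L2_sq_def gauss_def D_def[symmetric] by (subst nn_integral_density) auto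
  have D_le: "D ((1 / ?c) *\<^sub>R y) \<le> D y" for y
  proof -
    have "1 \<le> 1 / ?c" using k by (simp add: real_sqrt_divide)
    then have "norm y \<le> norm ((1 / ?c) *\<^sub>R y)"
      using mult_right_mono[of 1 "1 / ?c" "norm y"] c by simp
    then have "(norm y)\<^sup>2 \<le> (norm ((1 / ?c) *\<^sub>R y))\<^sup>2" by (intro power_mono) auto
    then show ?thesis unfolding D_def by (intro mult_left_mono) auto
  qed
  have inv: "(1 / ?c) *\<^sub>R (?c *\<^sub>R x) = x" for x :: "real ^ 'd" using c by simp
  let ?G = "\<lambda>y. ennreal (D ((1 / ?c) *\<^sub>R y)) * ennreal ((norm (f y))\<^sup>2)"
  have "(\<integral>\<^sup>+y. ?G y \<partial>lborel) = ennreal (?c ^ CARD('d)) * (\<integral>\<^sup>+x. ?G (?c *\<^sub>R x) \<partial>lborel)"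
    by (subst lborel_affine[OF c(2), of 0])
      (use c in \<open>simp add: nn_integral_density nn_integral_distr nn_integral_cmult\<close>)
  also have "(\<integral>\<^sup>+x. ?G (?c *\<^sub>R x) \<partial>lborel) = L2_sq (\<lambda>x. f (?c *\<^sub>R x))"
    unfolding inv by (subst L2_sq) auto
  finally have eq: "ennreal (?c ^ CARD('d)) * L2_sq (\<lambda>x. f (?c *\<^sub>R x)) = (\<integral>\<^sup>+y. ?G y \<partial>lborel)" ..
  have "sqrt (real k) * ?c = 1" using k by (simp add: real_sqrt_mult[symmetric])
  then have one: "ennreal (sqrt (real k) ^ CARD('d)) * ennreal (?c ^ CARD('d)) = 1"
    by (simp add: ennreal_mult[symmetric] power_mult_distrib[symmetric])
  have "L2_sq (\<lambda>x. f (?c *\<^sub>R x)) = ennreal (sqrt (real k) ^ CARD('d)) * (\<integral>\<^sup>+y. ?G y \<partial>lborel)"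
    unfolding eq[symmetric] mult.assoc[symmetric] one by simp
  also have "(\<integral>\<^sup>+y. ?G y \<partial>lborel) \<le> L2_sq f"
    unfolding L2_sq[OF assms(1)] by (intro nn_integral_mono mult_right_mono ennreal_leI D_le) auto
  finally show ?thesis by (simp add: mult_left_mono)
qed

text \<open>
  Either \<open>a i\<close> is below \<open>2\<^sup>-\<^sup>i\<close>, or it is at most \<open>2\<^sup>i (a i)\<^sup>2\<close>.
\<close>

lemma summable_of_weighted_squares:
  fixes a :: "nat \<Rightarrow> real"
  assumes nn: "\<And>i. a i \<ge> 0" and s: "summable (\<lambda>i. 2 ^ i * (a i)\<^sup>2)"
  shows "summable a"
proof (rule summable_comparison_test')
  show "summable (\<lambda>i. (1 / 2) ^ i + 2 ^ i * (a i)\<^sup>2)"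
    by (intro summable_add s) (simp add: summable_geometric)
  fix i :: nat
  show "norm (a i) \<le> (1 / 2) ^ i + 2 ^ i * (a i)\<^sup>2"
  proof (cases "a i \<le> (1 / 2) ^ i")
    case True
    then show ?thesis using nn[of i] by (simp add: add_increasing2)
  next
    case False
    then have "1 \<le> 2 ^ i * a i" by (simp add: field_simps power_divide)
    then have "a i * 1 \<le> a i * (2 ^ i * a i)" by (intro mult_left_mono nn)
    then have "a i \<le> 2 ^ i * (a i)\<^sup>2" by (simp add: power2_eq_square mult_ac)
    then show ?thesis using nn[of i] by (simp add: add_increasing)
  qed
qed

text \<open>
  Completeness of \<open>L\<^sup>2\<close>: a subsequence with squared differences at most \<open>4\<^sup>-\<^sup>i\<close> converges almost
  everywhere, and Fatou's lemma bounds the distance to the limit.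
\<close>

lemma riesz_fischer:
  fixes u :: "nat \<Rightarrow> real ^ 'd \<Rightarrow> complex"
  assumes meas [measurable]: "\<And>n. u n \<in> borel_measurable borel"
    and cauchy: "\<And>e. e > 0 \<Longrightarrow> \<exists>N. \<forall>m\<ge>N. \<forall>n\<ge>N. L2_sq (\<lambda>x. u m x - u n x) \<le> ennreal e"
  obtains f where "f \<in> borel_measurable borel" "(\<lambda>n. L2_sq (\<lambda>x. f x - u n x)) \<longlonglongrightarrow> 0"
proof -
  have "\<exists>N. \<forall>m\<ge>N. \<forall>n\<ge>N. L2_sq (\<lambda>x. u m x - u n x) \<le> ennreal ((1 / 4) ^ i)" for i :: nat
    by (rule cauchy) simp
  then obtain N where N: "\<And>i m n. m \<ge> N i \<Longrightarrow> n \<ge> N i \<Longrightarrow> L2_sq (\<lambda>x. u m x - u n x) \<le> ennreal ((1 / 4) ^ i)"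
    by metis
  \<comment> \<open>Indices beyond \<open>N i\<close> that increase with \<open>i\<close> and are at least \<open>i\<close>.\<close>
  define r where "r i = i + (\<Sum>j\<le>i. N j)" for i
  have rN: "N i \<le> r i" "r i \<le> r (Suc i)" for i
    using member_le_sum[of i "{..i}" N] by (auto simp: r_def)
  have step: "L2_sq (\<lambda>x. u (r (Suc i)) x - u (r i) x) \<le> ennreal ((1 / 4) ^ i)" for i
    by (rule N) (use rN[of i] in auto)
  let ?a = "\<lambda>i x. norm (u (r (Suc i)) x - u (r i) x)"
  have "(\<integral>\<^sup>+x. (\<Sum>i. ennreal (2 ^ i * (?a i x)\<^sup>2)) \<partial>gauss) = (\<Sum>i. \<integral>\<^sup>+x. ennreal (2 ^ i * (?a i x)\<^sup>2) \<partial>gauss)"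
    by (rule nn_integral_suminf) auto
  also have "\<dots> = (\<Sum>i. ennreal (2 ^ i) * L2_sq (\<lambda>x. u (r (Suc i)) x - u (r i) x))"
    by (simp add: L2_sq_def ennreal_mult nn_integral_cmult)
  also have "\<dots> \<le> (\<Sum>i. ennreal ((1 / 2) ^ i))"
  proof (intro suminf_le summableI)
    fix i :: nat
    have "ennreal (2 ^ i) * L2_sq (\<lambda>x. u (r (Suc i)) x - u (r i) x) \<le> ennreal (2 ^ i) * ennreal ((1 / 4) ^ i)"
      by (intro mult_left_mono step) simp
    also have "\<dots> = ennreal ((1 / 2) ^ i)"
      by (simp add: ennreal_mult[symmetric] power_mult_distrib[symmetric])
    finally show "ennreal (2 ^ i) * L2_sq (\<lambda>x. u (r (Suc i)) x - u (r i) x) \<le> ennreal ((1 / 2) ^ i)" .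
  qed
  also have "\<dots> = ennreal (\<Sum>i. (1 / 2) ^ i)"
    by (rule suminf_ennreal2) (auto intro: summable_geometric)
  finally have "(\<integral>\<^sup>+x. (\<Sum>i. ennreal (2 ^ i * (?a i x)\<^sup>2)) \<partial>gauss) \<noteq> \<infinity>"
    by (auto simp: top_unique)
  then have "AE x in gauss. (\<Sum>i. ennreal (2 ^ i * (?a i x)\<^sup>2)) \<noteq> \<infinity>"
    by (intro nn_integral_PInf_AE) auto
  then have conv: "AE x in gauss. convergent (\<lambda>i. u (r i) x)"
  proof eventually_elim
    case (elim x)
    have "summable (\<lambda>i. 2 ^ i * (?a i x)\<^sup>2)"
      by (rule summable_suminf_not_top) (use elim in auto)
    then have "summable (\<lambda>i. ?a i x)" by (rule summable_of_weighted_squares[rotated]) simp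
    then have "summable (\<lambda>i. u (r (Suc i)) x - u (r i) x)" by (rule summable_norm_cancel)
    then have "convergent (\<lambda>n. \<Sum>i<n. u (r (Suc i)) x - u (r i) x)" by (simp add: summable_iff_convergent)
    then have "convergent (\<lambda>n. u (r n) x - u (r 0) x)"
      using sum_lessThan_telescope[of "\<lambda>i. u (r i) x"] by simp
    then have "convergent (\<lambda>n. (u (r n) x - u (r 0) x) + u (r 0) x)"
      by (intro convergent_add convergent_const)
    then show ?case by simp
  qed
  define f where "f x = lim (\<lambda>i. u (r i) x)" for x
  have f [measurable]: "f \<in> borel_measurable borel"
    unfolding f_def by (rule borel_measurable_lim_metric) simp
  have bound: "L2_sq (\<lambda>x. f x - u n x) \<le> e" if e: "\<And>i. i \<ge> M \<Longrightarrow> L2_sq (\<lambda>x. u (r i) x - u n x) \<le> e" for n e M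
  proof -
    have "L2_sq (\<lambda>x. f x - u n x) = (\<integral>\<^sup>+x. liminf (\<lambda>i. ennreal ((norm (u (r i) x - u n x))\<^sup>2)) \<partial>gauss)"
      unfolding L2_sq_def
    proof (rule nn_integral_cong_AE)
      show "AE x in gauss. ennreal ((norm (f x - u n x))\<^sup>2) = liminf (\<lambda>i. ennreal ((norm (u (r i) x - u n x))\<^sup>2))"
        using conv
      proof eventually_elim
        case (elim x)
        then have "(\<lambda>i. u (r i) x) \<longlonglongrightarrow> f x" by (simp add: f_def convergent_LIMSEQ_iff)
        then have "(\<lambda>i. ennreal ((norm (u (r i) x - u n x))\<^sup>2)) \<longlonglongrightarrow> ennreal ((norm (f x - u n x))\<^sup>2)"
          by (intro tendsto_intros)
        then show ?case by (rule lim_imp_Liminf[OF trivial_limit_sequentially, symmetric])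
      qed
    qed
    also have "\<dots> \<le> liminf (\<lambda>i. L2_sq (\<lambda>x. u (r i) x - u n x))"
      unfolding L2_sq_def by (rule nn_integral_liminf) auto
    also have "\<dots> \<le> e"
      using e by (intro Liminf_le) (auto simp: eventually_sequentially)
    finally show ?thesis .
  qed
  have "(\<lambda>n. L2_sq (\<lambda>x. f x - u n x)) \<longlonglongrightarrow> 0"
  proof (rule ennreal_tendsto_0I)
    fix e :: real assume "e > 0"
    then obtain M where M: "\<And>m n. m \<ge> M \<Longrightarrow> n \<ge> M \<Longrightarrow> L2_sq (\<lambda>x. u m x - u n x) \<le> ennreal e"
      using cauchy by blast
    have id: "i \<le> r i" for i by (simp add: r_def)
    show "eventually (\<lambda>n. L2_sq (\<lambda>x. f x - u n x) \<le> ennreal e) sequentially"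
      unfolding eventually_sequentially
      by (intro exI[of _ M] allI impI bound[where M = M] M) (use id order_trans in blast)+
  qed
  with f show ?thesis by (rule that)
qed

section \<open>Hermite series and their dilations\<close>

lemma finite_mdeg [simp]: "finite {m :: nat ^ 'd. mdeg m = j}"
proof (rule finite_subset)
  show "{m :: nat ^ 'd. mdeg m = j} \<subseteq> vec_lambda ` Pi\<^sub>E UNIV (\<lambda>_. {..j})"
  proof
    fix m :: "nat ^ 'd" assume "m \<in> {m. mdeg m = j}"
    then have "m $ r \<le> j" for r
      unfolding mdeg_def using member_le_sum[of r UNIV "\<lambda>r. m $ r"] by auto
    then show "m \<in> vec_lambda ` Pi\<^sub>E UNIV (\<lambda>_. {..j})"
      by (intro image_eqI[of _ _ "\<lambda>r. m $ r"]) auto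
  qed
  show "finite (vec_lambda ` Pi\<^sub>E (UNIV :: 'd set) (\<lambda>_. {..j}) :: (nat ^ 'd) set)"
    by (intro finite_imageI finite_PiE) auto
qed

lemma mdeg_less_Union: "{m :: nat ^ 'd. mdeg m < n} = (\<Union>j\<in>{..<n}. {m. mdeg m = j})"
  by auto

lemma finite_mdeg_less [simp]: "finite {m :: nat ^ 'd. mdeg m < n}"
  unfolding mdeg_less_Union by simp

lemma sum_mdeg_less:
  "(\<Sum>m | mdeg (m :: nat ^ 'd) < n. f m) = (\<Sum>j<n. \<Sum>m | mdeg m = j. f m)"
  unfolding mdeg_less_Union by (rule sum.UNION_disjoint) auto

lemma hermite_multi_measurable [measurable]: "hermite_multi m \<in> borel_measurable borel"
  unfolding hermite_multi_def by measurable

text \<open>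
  The squared norm of the part of degree \<open>j\<close> of \<open>\<Sum> c(m) H\<^sub>m\<close>.
\<close>

definition degree_weight :: "(nat ^ 'd \<Rightarrow> complex) \<Rightarrow> nat \<Rightarrow> real" where
  "degree_weight c j = (\<Sum>m | mdeg m = j. (norm (c m))\<^sup>2 * multi_fact m)"

lemma multi_fact_pos: "multi_fact m > 0"
  unfolding multi_fact_def by (intro prod_pos) auto

lemma degree_weight_nonneg: "degree_weight c j \<ge> 0"
  unfolding degree_weight_def by (intro sum_nonneg mult_nonneg_nonneg) (auto simp: less_imp_le[OF multi_fact_pos])

lemma hermite_sum_L2:
  fixes c :: "nat ^ 'd \<Rightarrow> complex"
  assumes "finite A"
  defines "p \<equiv> \<lambda>x. \<Sum>m\<in>A. c m * of_real (hermite_multi m x)"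
  shows "integrable gauss (\<lambda>x. (norm (p x))\<^sup>2)"
    and "(\<integral>x. (norm (p x))\<^sup>2 \<partial>gauss) = (\<Sum>m\<in>A. (norm (c m))\<^sup>2 * multi_fact m)"
proof -
  have eq: "complex_of_real ((norm (p x))\<^sup>2) =
      (\<Sum>m\<in>A. \<Sum>n\<in>A. c m * cnj (c n) * of_real (hermite_multi m x * hermite_multi n x))" for x
    unfolding complex_norm_square p_def by (simp add: sum_product mult_ac)
  have int: "integrable gauss (\<lambda>x. c m * cnj (c n) * of_real (hermite_multi m x * hermite_multi n x))" for m n
    by (intro integrable_mult_right integrable_of_real hermite_multi_orthogonal)
  have int2: "integrable gauss (\<lambda>x. complex_of_real ((norm (p x))\<^sup>2))"
    unfolding eq by (intro Bochner_Integration.integrable_sum int)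
  then have "integrable gauss (\<lambda>x. Re (complex_of_real ((norm (p x))\<^sup>2)))" by (rule integrable_Re)
  then show "integrable gauss (\<lambda>x. (norm (p x))\<^sup>2)" by (simp only: Re_complex_of_real)
  have "complex_of_real (\<integral>x. (norm (p x))\<^sup>2 \<partial>gauss) = (\<integral>x. complex_of_real ((norm (p x))\<^sup>2) \<partial>gauss)"
    by (rule integral_complex_of_real[symmetric])
  also have "\<dots> = (\<Sum>m\<in>A. \<Sum>n\<in>A. \<integral>x. c m * cnj (c n) * of_real (hermite_multi m x * hermite_multi n x) \<partial>gauss)"
    unfolding eq by (simp only: Bochner_Integration.integral_sum Bochner_Integration.integrable_sum int)
  also have "\<dots> = (\<Sum>m\<in>A. \<Sum>n\<in>A. c m * cnj (c n) * of_real (if m = n then multi_fact m else 0))"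
    by (simp only: integral_mult_right_zero integral_complex_of_real hermite_multi_orthogonal)
  also have "\<dots> = (\<Sum>m\<in>A. c m * cnj (c m) * of_real (multi_fact m))"
    using assms(1) by (simp add: if_distrib[where f = of_real] if_distrib[where f = "\<lambda>y. _ * y"] cong: if_cong)
  also have "\<dots> = complex_of_real (\<Sum>m\<in>A. (norm (c m))\<^sup>2 * multi_fact m)"
    by (simp add: complex_norm_square[symmetric] del: of_real_power)
  finally show "(\<integral>x. (norm (p x))\<^sup>2 \<partial>gauss) = (\<Sum>m\<in>A. (norm (c m))\<^sup>2 * multi_fact m)"
    by (simp only: of_real_eq_iff)
qed

lemma L2_sq_hermite_sum:
  fixes c :: "nat ^ 'd \<Rightarrow> complex"
  assumes "finite A"
  shows "L2_sq (\<lambda>x. \<Sum>m\<in>A. c m * of_real (hermite_multi m x)) = ennreal (\<Sum>m\<in>A. (norm (c m))\<^sup>2 * multi_fact m)"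
    and "(\<lambda>x. \<Sum>m\<in>A. c m * of_real (hermite_multi m x)) \<in> L2"
proof -
  show L: "(\<lambda>x. \<Sum>m\<in>A. c m * of_real (hermite_multi m x)) \<in> L2"
    unfolding L2_def using hermite_sum_L2(1)[OF assms, of c] by auto
  show "L2_sq (\<lambda>x. \<Sum>m\<in>A. c m * of_real (hermite_multi m x)) = ennreal (\<Sum>m\<in>A. (norm (c m))\<^sup>2 * multi_fact m)"
    unfolding L2_sq_integral[OF L] hermite_sum_L2(2)[OF assms] ..
qed

text \<open>
  The multi-indices are exhausted by total degree, since both the flow and the blocks of the operator
  depend on the degree only.
\<close>

definition dilated_sum :: "real \<Rightarrow> (nat ^ 'd \<Rightarrow> complex) \<Rightarrow> nat \<Rightarrow> real ^ 'd \<Rightarrow> complex" where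
  "dilated_sum s c n x = (\<Sum>m | mdeg m < n. c m * of_real (hermite_multi m (s *\<^sub>R x)))"

lemma dilated_sum_measurable [measurable]: "dilated_sum s c n \<in> borel_measurable borel"
  unfolding dilated_sum_def by measurable

lemma L2_sq_dilated_sum_1: "L2_sq (dilated_sum 1 c n) = ennreal (\<Sum>j<n. degree_weight c j)"
  using L2_sq_hermite_sum(1)[of "{m. mdeg m < n}" c] unfolding dilated_sum_def[abs_def] degree_weight_def by (simp add: sum_mdeg_less)

lemma dilated_sum_diff:
  "m \<le> n \<Longrightarrow> dilated_sum s c n x - dilated_sum s c m x = dilated_sum s (\<lambda>i. if mdeg i < m then 0 else c i) n x"
proof -
  assume "m \<le> n"
  have "dilated_sum s (\<lambda>i. if mdeg i < m then 0 else c i) n x =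
      (\<Sum>i\<in>{i. mdeg i < n} - {i. mdeg i < m}. c i * of_real (hermite_multi i (s *\<^sub>R x)))"
    unfolding dilated_sum_def by (rule sum.mono_neutral_cong_right) auto
  also have "\<dots> = dilated_sum s c n x - dilated_sum s c m x"
    unfolding dilated_sum_def by (rule sum_diff) (use \<open>m \<le> n\<close> in auto)
  finally show ?thesis ..
qed

lemma degree_weight_restrict: "degree_weight (\<lambda>i. if mdeg i < m then 0 else c i) j = (if j < m then 0 else degree_weight c j)"
  unfolding degree_weight_def by (auto intro!: sum.cong sum.neutral)

definition dilation_factor :: "nat \<Rightarrow> real" where "dilation_factor k = sqrt (1 / real k)"

definition dilation_bound :: "'d::finite itself \<Rightarrow> nat \<Rightarrow> real" where
  "dilation_bound _ k = sqrt (real k) ^ CARD('d)"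

lemma dilation_bound_nonneg: "dilation_bound TYPE('d::finite) k \<ge> 0" by (simp add: dilation_bound_def)

lemma L2_sq_dilated_sum_le:
  assumes "k \<ge> 1"
  shows "L2_sq (dilated_sum (dilation_factor k) (c :: nat ^ 'd \<Rightarrow> complex) n) \<le> ennreal (dilation_bound TYPE('d) k * (\<Sum>j<n. degree_weight c j))"
proof -
  have "dilated_sum (dilation_factor k) c n = (\<lambda>x. dilated_sum 1 c n (sqrt (1 / real k) *\<^sub>R x))"
    by (simp add: dilated_sum_def[abs_def] dilation_factor_def)
  then have "L2_sq (dilated_sum (dilation_factor k) c n) \<le> ennreal (dilation_bound TYPE('d) k) * L2_sq (dilated_sum 1 c n)"
    using L2_sq_dilate_le[of "dilated_sum 1 c n" k] assms by (simp add: dilation_bound_def)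
  then show ?thesis by (simp add: L2_sq_dilated_sum_1 ennreal_mult dilation_bound_def sum_nonneg degree_weight_nonneg)
qed

definition ell2 :: "(nat ^ 'd \<Rightarrow> complex) \<Rightarrow> bool" where
  "ell2 c \<longleftrightarrow> summable (degree_weight c)"

text \<open>
  The function \<open>f\<close> is the \<open>L\<^sup>2\<close> sum of the dilated series \<open>\<Sum> c(m) H\<^sub>m(\<lambda>x)\<close>.
\<close>

definition represents :: "nat \<Rightarrow> (real ^ 'd \<Rightarrow> complex) \<Rightarrow> (nat ^ 'd \<Rightarrow> complex) \<Rightarrow> bool" where
  "represents k f c \<longleftrightarrow> f \<in> borel_measurable borel \<and> (\<lambda>n. L2_sq (\<lambda>x. f x - dilated_sum (dilation_factor k) c n x)) \<longlonglongrightarrow> 0"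

lemma represents_exists:
  fixes c :: "nat ^ 'd \<Rightarrow> complex"
  assumes "k \<ge> 1" "ell2 c"
  shows "\<exists>f. represents k f c"
proof -
  let ?K = "dilation_bound TYPE('d) k"
  have tail: "L2_sq (\<lambda>x. dilated_sum (dilation_factor k) c n x - dilated_sum (dilation_factor k) c m x) \<le> ennreal (?K * (\<Sum>j\<in>{m..<n}. degree_weight c j))" if "m \<le> n" for m n
  proof -
    have "L2_sq (\<lambda>x. dilated_sum (dilation_factor k) c n x - dilated_sum (dilation_factor k) c m x) \<le>
        ennreal (?K * (\<Sum>j<n. if j < m then 0 else degree_weight c j))"
      unfolding dilated_sum_diff[OF that] using L2_sq_dilated_sum_le[OF assms(1), of "\<lambda>i. if mdeg i < m then 0 else c i" n]
      by (simp add: degree_weight_restrict)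
    also have "(\<Sum>j<n. if j < m then 0 else degree_weight c j) = (\<Sum>j\<in>{m..<n}. degree_weight c j)"
      by (rule sum.mono_neutral_cong_right) auto
    finally show ?thesis .
  qed
  have "\<exists>N. \<forall>m\<ge>N. \<forall>n\<ge>N. L2_sq (\<lambda>x. dilated_sum (dilation_factor k) c m x - dilated_sum (dilation_factor k) c n x) \<le> ennreal e" if "e > 0" for e
  proof -
    have "e / (?K + 1) > 0" using that dilation_bound_nonneg[where 'd = 'd, of k] by simp
    then obtain N where N: "\<And>m n. m \<ge> N \<Longrightarrow> norm (\<Sum>j\<in>{m..<n}. degree_weight c j) < e / (?K + 1)"
      using assms(2) unfolding ell2_def summable_Cauchy by metis
    have le: "?K * (\<Sum>j\<in>{m..<n}. degree_weight c j) \<le> e" if "m \<ge> N" for m n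
    proof -
      have "?K * (\<Sum>j\<in>{m..<n}. degree_weight c j) \<le> ?K * (e / (?K + 1))"
        using N[OF that, of n] by (intro mult_left_mono dilation_bound_nonneg) auto
      also have "\<dots> \<le> e" using \<open>e > 0\<close> dilation_bound_nonneg[where 'd = 'd, of k] by (simp add: field_simps)
      finally show ?thesis .
    qed
    show ?thesis
    proof (intro exI[of _ N] allI impI)
      fix m n assume mn: "N \<le> m" "N \<le> n"
      show "L2_sq (\<lambda>x. dilated_sum (dilation_factor k) c m x - dilated_sum (dilation_factor k) c n x) \<le> ennreal e"
      proof (cases "n \<le> m")
        case True
        show ?thesis using order_trans[OF tail[OF True] ennreal_leI[OF le[OF mn(2)]]] .
      next
        case False
        then have "m \<le> n" by simp
        show ?thesis unfolding L2_sq_diff_commute[of "dilated_sum (dilation_factor k) c m"]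
          using order_trans[OF tail[OF \<open>m \<le> n\<close>] ennreal_leI[OF le[OF mn(1)]]] .
      qed
    qed
  qed
  then obtain f where "f \<in> borel_measurable borel" "(\<lambda>n. L2_sq (\<lambda>x. f x - dilated_sum (dilation_factor k) c n x)) \<longlonglongrightarrow> 0"
    using riesz_fischer[of "dilated_sum (dilation_factor k) c"] dilated_sum_measurable by blast
  then show ?thesis unfolding represents_def by blast
qed

lemma dilated_sum_lin: "dilated_sum s (\<lambda>m. a * c m + b * c' m) n x = a * dilated_sum s c n x + b * dilated_sum s c' n x"
  by (simp add: dilated_sum_def sum_distrib_left sum.distrib distrib_right mult.assoc)

lemma represents_lin:
  assumes "represents k f c" "represents k f' c'"
  shows "represents k (\<lambda>x. a * f x + b * f' x) (\<lambda>m. a * c m + b * c' m)"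
proof -
  have [measurable]: "f \<in> borel_measurable borel" "f' \<in> borel_measurable borel"
    using assms by (auto simp: represents_def)
  let ?d = "\<lambda>n. L2_sq (\<lambda>x. f x - dilated_sum (dilation_factor k) c n x)" and ?d' = "\<lambda>n. L2_sq (\<lambda>x. f' x - dilated_sum (dilation_factor k) c' n x)"
  let ?A = "ennreal ((norm a)\<^sup>2)" and ?B = "ennreal ((norm b)\<^sup>2)"
  have le: "L2_sq (\<lambda>x. (a * f x + b * f' x) - dilated_sum (dilation_factor k) (\<lambda>m. a * c m + b * c' m) n x) \<le> 2 * (?A * ?d n) + 2 * (?B * ?d' n)" for n
  proof -
    have "(\<lambda>x. (a * f x + b * f' x) - dilated_sum (dilation_factor k) (\<lambda>m. a * c m + b * c' m) n x) =
       (\<lambda>x. a * (f x - dilated_sum (dilation_factor k) c n x) + b * (f' x - dilated_sum (dilation_factor k) c' n x))"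
      by (simp add: dilated_sum_lin algebra_simps)
    then show ?thesis
      using L2_sq_add_le[of "\<lambda>x. a * (f x - dilated_sum (dilation_factor k) c n x)" "\<lambda>x. b * (f' x - dilated_sum (dilation_factor k) c' n x)"]
      by (simp add: L2_sq_cmul)
  qed
  have "(\<lambda>n. 2 * (?A * ?d n) + 2 * (?B * ?d' n)) \<longlonglongrightarrow> 2 * (?A * 0) + 2 * (?B * 0)"
    using assms unfolding represents_def by (intro tendsto_intros) auto
  then have "(\<lambda>n. 2 * (?A * ?d n) + 2 * (?B * ?d' n)) \<longlonglongrightarrow> 0" by simp
  then have "(\<lambda>n. L2_sq (\<lambda>x. (a * f x + b * f' x) - dilated_sum (dilation_factor k) (\<lambda>m. a * c m + b * c' m) n x)) \<longlonglongrightarrow> 0"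
    by (rule tendsto_sandwich[OF _ _ tendsto_const, rotated 2]) (use le in auto)
  then show ?thesis by (simp add: represents_def)
qed

text \<open>
  The factor \<open>2\<close> comes from \<open>L2_sq_add_le\<close>. Any finite constant serves the purpose of passing to
  limits.
\<close>

lemma represents_bound:
  fixes c :: "nat ^ 'd \<Rightarrow> complex"
  assumes "k \<ge> 1" "represents k f c" "ell2 c"
  shows "L2_sq f \<le> ennreal (2 * dilation_bound TYPE('d) k * (\<Sum>j. degree_weight c j))"
proof -
  have [measurable]: "f \<in> borel_measurable borel" using assms by (auto simp: represents_def)
  let ?d = "\<lambda>n. L2_sq (\<lambda>x. f x - dilated_sum (dilation_factor k) c n x)"
  let ?B = "ennreal (2 * dilation_bound TYPE('d) k * (\<Sum>j. degree_weight c j))"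
  have "L2_sq f \<le> 2 * ?d n + ?B" for n
  proof -
    have "L2_sq f \<le> 2 * ?d n + 2 * L2_sq (dilated_sum (dilation_factor k) c n)"
      using L2_sq_add_le[of "\<lambda>x. f x - dilated_sum (dilation_factor k) c n x" "dilated_sum (dilation_factor k) c n"] by simp
    also have "2 * L2_sq (dilated_sum (dilation_factor k) c n) \<le> 2 * ennreal (dilation_bound TYPE('d) k * (\<Sum>j. degree_weight c j))"
    proof (intro mult_left_mono order_trans[OF L2_sq_dilated_sum_le[OF assms(1)]] ennreal_leI mult_left_mono dilation_bound_nonneg)
      show "(\<Sum>j<n. degree_weight c j) \<le> (\<Sum>j. degree_weight c j)"
        using assms(3) unfolding ell2_def by (intro sum_le_suminf) (auto simp: degree_weight_nonneg)
    qed simp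
    also have "\<dots> = ?B"
      by (simp add: ennreal_mult' mult.assoc)
    finally show ?thesis by (simp add: add_left_mono)
  qed
  moreover have "(\<lambda>n. 2 * ?d n + ?B) \<longlonglongrightarrow> 2 * 0 + ?B"
    using assms(2) unfolding represents_def by (intro tendsto_intros) auto
  ultimately have "L2_sq f \<le> 2 * 0 + ?B" by (intro LIMSEQ_le_const[of _ _ "L2_sq f"]) auto
  then show ?thesis by simp
qed

lemma degree_weight_cmul: "degree_weight (\<lambda>m. b m * c m) j \<le> B\<^sup>2 * degree_weight c j" if "\<And>m. mdeg m = j \<Longrightarrow> norm (b m) \<le> B" for b c :: "nat ^ 'd \<Rightarrow> complex"
  unfolding degree_weight_def sum_distrib_left
proof (rule sum_mono)
  fix m :: "nat ^ 'd" assume "m \<in> {m. mdeg m = j}"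
  then have "(norm (b m))\<^sup>2 \<le> B\<^sup>2" using that by (intro power_mono) auto
  then have "(norm (b m))\<^sup>2 * ((norm (c m))\<^sup>2 * multi_fact m) \<le> B\<^sup>2 * ((norm (c m))\<^sup>2 * multi_fact m)"
    by (intro mult_right_mono mult_nonneg_nonneg) (auto simp: less_imp_le[OF multi_fact_pos])
  then show "(norm (b m * c m))\<^sup>2 * multi_fact m \<le> B\<^sup>2 * ((norm (c m))\<^sup>2 * multi_fact m)"
    by (simp add: norm_mult power_mult_distrib mult.assoc)
qed

lemma degree_weight_lin_le:
  fixes c c' :: "nat ^ 'd \<Rightarrow> complex"
  shows "degree_weight (\<lambda>m. a * c m + b * c' m) j \<le> 2 * (norm a)\<^sup>2 * degree_weight c j + 2 * (norm b)\<^sup>2 * degree_weight c' j"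
  unfolding degree_weight_def sum_distrib_left sum.distrib[symmetric]
proof (rule sum_mono)
  fix m :: "nat ^ 'd"
  have "(norm (a * c m + b * c' m))\<^sup>2 \<le> 2 * (norm a)\<^sup>2 * (norm (c m))\<^sup>2 + 2 * (norm b)\<^sup>2 * (norm (c' m))\<^sup>2"
    using norm_add_sq_le[of "a * c m" "b * c' m"] by (simp add: norm_mult power_mult_distrib mult.assoc)
  then have "(norm (a * c m + b * c' m))\<^sup>2 * multi_fact m \<le>
      (2 * (norm a)\<^sup>2 * (norm (c m))\<^sup>2 + 2 * (norm b)\<^sup>2 * (norm (c' m))\<^sup>2) * multi_fact m"
    by (rule mult_right_mono) (simp add: less_imp_le[OF multi_fact_pos])
  then show "(norm (a * c m + b * c' m))\<^sup>2 * multi_fact m \<le>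
      2 * (norm a)\<^sup>2 * ((norm (c m))\<^sup>2 * multi_fact m) + 2 * (norm b)\<^sup>2 * ((norm (c' m))\<^sup>2 * multi_fact m)"
    by (simp add: algebra_simps)
qed

lemma ell2_lin:
  assumes "ell2 c" "ell2 c'"
  shows "ell2 (\<lambda>m. a * c m + b * c' m)"
  unfolding ell2_def
proof (rule summable_comparison_test')
  show "summable (\<lambda>j. 2 * (norm a)\<^sup>2 * degree_weight c j + 2 * (norm b)\<^sup>2 * degree_weight c' j)"
    using assms unfolding ell2_def by (intro summable_add summable_mult)
  show "norm (degree_weight (\<lambda>m. a * c m + b * c' m) j) \<le> 2 * (norm a)\<^sup>2 * degree_weight c j + 2 * (norm b)\<^sup>2 * degree_weight c' j" for j
    using degree_weight_lin_le[of a c b c' j] by (simp add: degree_weight_nonneg)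
qed

lemma ell2_mult: "ell2 c \<Longrightarrow> (\<And>m. norm (b m) \<le> B) \<Longrightarrow> ell2 (\<lambda>m. b m * c m)"
  unfolding ell2_def
  by (rule summable_comparison_test'[where N = 0, OF summable_mult[of "degree_weight c" "B\<^sup>2"]])
    (auto simp: degree_weight_nonneg intro!: degree_weight_cmul)

lemma represents_diff_bound:
  fixes c :: "nat ^ 'd \<Rightarrow> complex"
  assumes "k \<ge> 1" "represents k f c" "represents k f' c'" "ell2 c" "ell2 c'"
  shows "L2_sq (\<lambda>x. f x - f' x) \<le> ennreal (2 * dilation_bound TYPE('d) k * (\<Sum>j. degree_weight (\<lambda>m. c m - c' m) j))"
  using represents_bound[OF assms(1) represents_lin[OF assms(2,3), of 1 "-1"] ell2_lin[OF assms(4,5)]] by simp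

lemma represents_unique:
  fixes c :: "nat ^ 'd \<Rightarrow> complex"
  assumes "k \<ge> 1" "represents k f c" "represents k f' c" "ell2 c"
  shows "AE x in gauss. f x = f' x"
proof -
  have [measurable]: "f \<in> borel_measurable borel" "f' \<in> borel_measurable borel"
    using assms by (auto simp: represents_def)
  have "L2_sq (\<lambda>x. f x - f' x) = 0"
    using represents_diff_bound[OF assms(1-3,4,4)] by (simp add: degree_weight_def)
  then have "AE x in gauss. f x - f' x = 0" by (intro L2_sq_eq_0_imp_AE) auto
  then show ?thesis by simp
qed

section \<open>Hermite coefficients and the flow\<close>

definition hermite_coeff :: "(real ^ 'd \<Rightarrow> complex) \<Rightarrow> nat ^ 'd \<Rightarrow> complex" where
  "hermite_coeff g m = (\<integral>x. g x * of_real (hermite_multi m x) \<partial>gauss) / of_real (multi_fact m)"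

lemma integrable_L2_mult:
  assumes "f \<in> L2" "g \<in> L2"
  shows "integrable gauss (\<lambda>x. f x * g x)"
proof (rule Bochner_Integration.integrable_bound)
  show "integrable gauss (\<lambda>x. (norm (f x))\<^sup>2 + (norm (g x))\<^sup>2)"
    using assms by (auto simp: L2_def)
  have [measurable]: "f \<in> borel_measurable borel" "g \<in> borel_measurable borel"
    using assms by (auto simp: L2_def)
  show "(\<lambda>x. f x * g x) \<in> borel_measurable gauss" by measurable
  show "AE x in gauss. norm (f x * g x) \<le> norm ((norm (f x))\<^sup>2 + (norm (g x))\<^sup>2)"
  proof (intro AE_I2)
    fix x
    have "norm (f x) * norm (g x) \<le> (norm (f x))\<^sup>2 + (norm (g x))\<^sup>2"
      using sum_squares_bound[of "norm (f x)" "norm (g x)"]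
        mult_nonneg_nonneg[OF norm_ge_zero[of "f x"] norm_ge_zero[of "g x"]] by linarith
    then show "norm (f x * g x) \<le> norm ((norm (f x))\<^sup>2 + (norm (g x))\<^sup>2)"
      unfolding norm_mult real_norm_def by (rule order_trans[OF _ abs_ge_self])
  qed
qed

lemma hermite_multi_L2: "(\<lambda>x. complex_of_real (hermite_multi m x)) \<in> L2"
  using L2_sq_hermite_sum(2)[of "{m}" "\<lambda>_. 1"] by simp

lemma hermite_coeff_lin:
  assumes "g \<in> L2" "h \<in> L2"
  shows "hermite_coeff (\<lambda>y. a * g y + b * h y) m = a * hermite_coeff g m + b * hermite_coeff h m"
proof -
  have "(\<integral>x. (a * g x + b * h x) * of_real (hermite_multi m x) \<partial>gauss) =
      (\<integral>x. a * (g x * of_real (hermite_multi m x)) + b * (h x * of_real (hermite_multi m x)) \<partial>gauss)"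
    by (intro Bochner_Integration.integral_cong refl) (simp add: algebra_simps)
  also have "\<dots> = a * (\<integral>x. g x * of_real (hermite_multi m x) \<partial>gauss) + b * (\<integral>x. h x * of_real (hermite_multi m x) \<partial>gauss)"
    using integrable_L2_mult[OF assms(1) hermite_multi_L2] integrable_L2_mult[OF assms(2) hermite_multi_L2]
    by (subst Bochner_Integration.integral_add) auto
  finally show ?thesis by (simp add: hermite_coeff_def add_divide_distrib)
qed

lemma hermite_coeff_hermite: "hermite_coeff (\<lambda>y. of_real (hermite_multi n y)) m = (if m = n then 1 else 0)"
proof -
  have "(\<integral>x. complex_of_real (hermite_multi n x) * of_real (hermite_multi m x) \<partial>gauss) =
      of_real (\<integral>x. hermite_multi n x * hermite_multi m x \<partial>gauss)"
    by (simp only: of_real_mult[symmetric] integral_complex_of_real)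
  then show ?thesis using multi_fact_pos[of m] by (auto simp: hermite_coeff_def hermite_multi_orthogonal)
qed

lemma L2_norm_sq: "(L2_norm g)\<^sup>2 = (\<integral>x. (norm (g x))\<^sup>2 \<partial>gauss)"
  unfolding L2_norm_def by (subst real_sqrt_pow2) auto

text \<open>
  Pythagoras for the projection onto the span of the \<open>H\<^sub>m\<close> with \<open>|m| < n\<close>.
\<close>

lemma bessel_remainder:
  fixes g :: "real ^ 'd \<Rightarrow> complex"
  assumes "g \<in> L2"
  shows "(L2_norm (\<lambda>x. g x - dilated_sum 1 (hermite_coeff g) n x))\<^sup>2 = (L2_norm g)\<^sup>2 - (\<Sum>j<n. degree_weight (hermite_coeff g) j)"
proof -
  let ?A = "{m :: nat ^ 'd. mdeg m < n}"
  let ?c = "hermite_coeff g" and ?H = "\<lambda>m x. complex_of_real (hermite_multi m x)"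
  define p where "p x = (\<Sum>m\<in>?A. ?c m * ?H m x)" for x
  have pL: "p \<in> L2" unfolding p_def[abs_def] by (rule L2_sq_hermite_sum(2)) simp
  have intgH: "integrable gauss (\<lambda>x. cnj (?c m) * (g x * ?H m x))" for m
    by (intro integrable_mult_right integrable_L2_mult assms hermite_multi_L2)
  have gp_eq: "g x * cnj (p x) = (\<Sum>m\<in>?A. cnj (?c m) * (g x * ?H m x))" for x
    by (simp add: p_def sum_distrib_left mult_ac)
  have int_gp: "integrable gauss (\<lambda>x. g x * cnj (p x))"
    unfolding gp_eq by (intro Bochner_Integration.integrable_sum intgH)
  have "(\<integral>x. g x * cnj (p x) \<partial>gauss) = (\<Sum>m\<in>?A. cnj (?c m) * (\<integral>x. g x * ?H m x \<partial>gauss))"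
    unfolding gp_eq by (subst Bochner_Integration.integral_sum) (auto intro: intgH)
  also have "\<dots> = (\<Sum>m\<in>?A. of_real ((norm (?c m))\<^sup>2 * multi_fact m))"
  proof (rule sum.cong[OF refl])
    fix m :: "nat ^ 'd"
    have "(\<integral>x. g x * ?H m x \<partial>gauss) = ?c m * of_real (multi_fact m)"
      using multi_fact_pos[of m] by (simp add: hermite_coeff_def)
    then show "cnj (?c m) * (\<integral>x. g x * ?H m x \<partial>gauss) = of_real ((norm (?c m))\<^sup>2 * multi_fact m)"
      by (simp add: complex_norm_square mult_ac del: of_real_power)
  qed
  finally have gp: "(\<integral>x. g x * cnj (p x) \<partial>gauss) = of_real (\<Sum>m\<in>?A. (norm (?c m))\<^sup>2 * multi_fact m)"
    by simp
  have int_g: "integrable gauss (\<lambda>x. (norm (g x))\<^sup>2)" and int_p: "integrable gauss (\<lambda>x. (norm (p x))\<^sup>2)"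
    using assms pL by (auto simp: L2_def)
  have "(\<integral>x. (norm (g x - p x))\<^sup>2 \<partial>gauss) = (\<integral>x. (norm (g x))\<^sup>2 - 2 * Re (g x * cnj (p x)) + (norm (p x))\<^sup>2 \<partial>gauss)"
    by (intro Bochner_Integration.integral_cong refl, unfold cmod_power2)
      (simp add: power2_eq_square algebra_simps)
  also have "\<dots> = (\<integral>x. (norm (g x))\<^sup>2 \<partial>gauss) - 2 * Re (\<integral>x. g x * cnj (p x) \<partial>gauss) + (\<integral>x. (norm (p x))\<^sup>2 \<partial>gauss)"
  proof -
    have "integrable gauss (\<lambda>x. Re (g x * cnj (p x)))" by (rule integrable_Re[OF int_gp])
    then show ?thesis using int_g int_p
      by (simp only: Bochner_Integration.integral_add Bochner_Integration.integral_diff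
          Bochner_Integration.integrable_diff integrable_mult_right integral_mult_right_zero integral_Re[OF int_gp])
  qed
  also have "(\<integral>x. (norm (p x))\<^sup>2 \<partial>gauss) = (\<Sum>m\<in>?A. (norm (?c m))\<^sup>2 * multi_fact m)"
    unfolding p_def by (rule hermite_sum_L2(2)) simp
  finally have "(\<integral>x. (norm (g x - p x))\<^sup>2 \<partial>gauss) = (\<integral>x. (norm (g x))\<^sup>2 \<partial>gauss) - (\<Sum>m\<in>?A. (norm (?c m))\<^sup>2 * multi_fact m)"
    unfolding gp by simp
  moreover have "p = dilated_sum 1 (hermite_coeff g) n" by (rule ext) (simp add: p_def dilated_sum_def)
  ultimately show ?thesis unfolding L2_norm_sq degree_weight_def sum_mdeg_less by simp
qed

lemma bessel:
  fixes g :: "real ^ 'd \<Rightarrow> complex"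
  assumes "g \<in> L2"
  shows "ell2 (hermite_coeff g)" "(\<Sum>j. degree_weight (hermite_coeff g) j) \<le> (L2_norm g)\<^sup>2"
proof -
  have partial: "(\<Sum>j<n. degree_weight (hermite_coeff g) j) \<le> (L2_norm g)\<^sup>2" for n
    using bessel_remainder[OF assms, of n] zero_le_power2[of "L2_norm (\<lambda>x. g x - dilated_sum 1 (hermite_coeff g) n x)"]
    by linarith
  have s: "summable (degree_weight (hermite_coeff g))"
    by (rule bounded_imp_summable[OF degree_weight_nonneg, where B = "(L2_norm g)\<^sup>2"])
      (use partial[of "Suc _"] in \<open>simp add: lessThan_Suc_atMost\<close>)
  then show "ell2 (hermite_coeff g)" by (simp add: ell2_def)
  show "(\<Sum>j. degree_weight (hermite_coeff g) j) \<le> (L2_norm g)\<^sup>2"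
    by (rule suminf_le_const[OF s]) (rule partial)
qed

definition phase :: "real \<Rightarrow> nat \<Rightarrow> complex" where
  "phase t j = exp (2 * of_real pi * of_nat j * \<i> * of_real t)"

definition twist :: "real \<Rightarrow> (nat ^ 'd \<Rightarrow> complex) \<Rightarrow> nat ^ 'd \<Rightarrow> complex" where
  "twist t c m = phase t (mdeg m) * c m"

lemma norm_phase [simp]: "norm (phase t j) = 1"
proof -
  have "phase t j = exp (\<i> * of_real (2 * pi * real j * t))" by (simp add: phase_def mult_ac)
  then show ?thesis by (simp only: norm_exp_i_times)
qed

lemma degree_weight_twist [simp]: "degree_weight (twist t c) = degree_weight c"
  by (rule ext) (simp add: degree_weight_def twist_def norm_mult)

lemma ell2_twist [simp]: "ell2 (twist t c) = ell2 c"
  by (simp add: ell2_def)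

text \<open>
  The flow expands \<open>g\<close> into its Hermite coefficients and sums the rotated dilated series. Bessel's
  inequality makes the coefficients of every \<open>g\<close> in \<open>L\<^sup>2\<close> square summable. Uniqueness of the sum
  turns linearity of the coefficients into linearity almost everywhere.
\<close>

lemma hermite_flow_exists:
  assumes k: "k \<ge> 1"
  shows "\<exists>T :: (real ^ 'd \<Rightarrow> complex) \<Rightarrow> _. is_hermite_flow k t T"
proof -
  define T where "T g = (SOME f. represents k f (twist t (hermite_coeff g)))" for g :: "real ^ 'd \<Rightarrow> complex"
  have ell: "ell2 (twist t (hermite_coeff g))" if "g \<in> L2" for g :: "real ^ 'd \<Rightarrow> complex"
    using bessel(1)[OF that] by simp
  have T: "represents k (T g) (twist t (hermite_coeff g))" if "g \<in> L2" for g
    unfolding T_def by (rule someI_ex[OF represents_exists[OF k ell[OF that]]])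
  let ?K = "dilation_bound TYPE('d) k"
  have bd: "L2_sq (T g) \<le> ennreal (2 * ?K * (L2_norm g)\<^sup>2)" if "g \<in> L2" for g
  proof -
    have "L2_sq (T g) \<le> ennreal (2 * ?K * (\<Sum>j. degree_weight (hermite_coeff g) j))"
      using represents_bound[OF k T[OF that] ell[OF that]] by simp
    also have "\<dots> \<le> ennreal (2 * ?K * (L2_norm g)\<^sup>2)"
      by (intro ennreal_leI mult_left_mono bessel(2) that) (simp add: dilation_bound_def)
    finally show ?thesis .
  qed
  have TL: "T g \<in> L2" if "g \<in> L2" for g
    using bd[OF that] T[OF that] unfolding L2_iff represents_def by (auto intro: le_less_trans)
  have "is_hermite_flow k t T"
    unfolding is_hermite_flow_def
  proof (intro conjI ballI allI)
    fix g :: "real ^ 'd \<Rightarrow> complex" assume "g \<in> L2"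
    then show "T g \<in> L2" by (rule TL)
  next
    fix g h :: "real ^ 'd \<Rightarrow> complex" and a b assume gh: "g \<in> L2" "h \<in> L2"
    have gm [measurable]: "g \<in> borel_measurable borel" "h \<in> borel_measurable borel"
      using gh by (auto simp: L2_def)
    have "L2_sq (\<lambda>y. a * g y + b * h y) < \<infinity>"
    proof -
      have "L2_sq (\<lambda>y. a * g y + b * h y) \<le> 2 * L2_sq (\<lambda>y. a * g y) + 2 * L2_sq (\<lambda>y. b * h y)"
        by (rule L2_sq_add_le) auto
      also have "\<dots> < \<infinity>"
        using gh by (auto simp: L2_sq_cmul L2_iff ennreal_mult_less_top)
      finally show ?thesis .
    qed
    then have L: "(\<lambda>y. a * g y + b * h y) \<in> L2" by (auto simp: L2_iff)
    have eq: "twist t (hermite_coeff (\<lambda>y. a * g y + b * h y)) = (\<lambda>m. a * twist t (hermite_coeff g) m + b * twist t (hermite_coeff h) m)"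
      by (rule ext) (simp add: twist_def hermite_coeff_lin[OF gh] algebra_simps)
    show "AE x in gauss. T (\<lambda>y. a * g y + b * h y) x = a * T g x + b * T h x"
      using represents_unique[OF k T[OF L, unfolded eq] represents_lin[OF T[OF gh(1)] T[OF gh(2)]]]
        ell2_lin[OF ell[OF gh(1)] ell[OF gh(2)]] .
  next
    show "\<exists>C. \<forall>g\<in>L2. L2_norm (T g) \<le> C * L2_norm g"
    proof (intro exI[of _ "sqrt (2 * ?K)"] ballI)
      fix g :: "real ^ 'd \<Rightarrow> complex" assume g: "g \<in> L2"
      have "ennreal ((L2_norm (T g))\<^sup>2) \<le> ennreal (2 * ?K * (L2_norm g)\<^sup>2)"
        using bd[OF g] by (simp only: L2_sq_L2_norm[OF TL[OF g]])
      then have "(L2_norm (T g))\<^sup>2 \<le> 2 * ?K * (L2_norm g)\<^sup>2"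
        by (subst (asm) ennreal_le_iff) (auto simp: dilation_bound_def)
      then have "L2_norm (T g) \<le> sqrt (2 * ?K * (L2_norm g)\<^sup>2)" by (rule real_le_rsqrt)
      then show "L2_norm (T g) \<le> sqrt (2 * ?K) * L2_norm g"
        using L2_norm_nonneg[of g] by (simp add: real_sqrt_mult)
    qed
  next
    fix m :: "nat ^ 'd"
    let ?H = "\<lambda>y. complex_of_real (hermite_multi m y)"
    have eq: "twist t (hermite_coeff ?H) = (\<lambda>n. if n = m then phase t (mdeg m) else 0)"
      by (rule ext) (simp add: twist_def hermite_coeff_hermite)
    have fin: "dilated_sum (dilation_factor k) (twist t (hermite_coeff ?H)) n x = phase t (mdeg m) * of_real (hermite_multi m (dilation_factor k *\<^sub>R x))"
      if "n > mdeg m" for n x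
      unfolding dilated_sum_def eq using that by (simp add: if_distrib[where f = "\<lambda>c. c * _"] cong: if_cong)
    have meas: "(\<lambda>x. phase t (mdeg m) * of_real (hermite_multi m (dilation_factor k *\<^sub>R x))) \<in> borel_measurable borel"
      by measurable
    have ev: "eventually (\<lambda>n. 0 = L2_sq (\<lambda>x. phase t (mdeg m) * of_real (hermite_multi m (dilation_factor k *\<^sub>R x)) -
        dilated_sum (dilation_factor k) (twist t (hermite_coeff ?H)) n x)) sequentially"
      using eventually_gt_at_top[of "mdeg m"] by eventually_elim (simp add: fin)
    have "represents k (\<lambda>x. phase t (mdeg m) * of_real (hermite_multi m (dilation_factor k *\<^sub>R x))) (twist t (hermite_coeff ?H))"
      unfolding represents_def by (intro conjI meas Lim_transform_eventually[OF tendsto_const ev])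
    from represents_unique[OF k T[OF hermite_multi_L2] this ell[OF hermite_multi_L2]]
    show "AE x in gauss. T ?H x = exp (2 * of_real pi * of_nat (mdeg m) * \<i> * of_real t) *
        of_real (hermite_multi m (sqrt (1 / real k) *\<^sub>R x))"
      by (simp add: phase_def dilation_factor_def)
  qed
  then show ?thesis by blast
qed

lemma dilated_sum_L2: "dilated_sum 1 c n \<in> L2"
  using L2_sq_dilated_sum_1[of c n] by (auto simp: L2_iff)

lemma L2_diff_dilated_sum:
  assumes "g \<in> L2"
  shows "(\<lambda>x. g x - dilated_sum 1 c n x) \<in> L2"
proof -
  have [measurable]: "g \<in> borel_measurable borel" using assms by (simp add: L2_def)
  have "L2_sq (\<lambda>x. g x - dilated_sum 1 c n x) \<le> 2 * L2_sq g + 2 * L2_sq (\<lambda>x. (-1) * dilated_sum 1 c n x)"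
    using L2_sq_add_le[of g "\<lambda>x. (-1) * dilated_sum 1 c n x"] by simp
  also have "\<dots> < \<infinity>"
    using assms dilated_sum_L2[of c n] L2_sq_cmul[of "dilated_sum 1 c n" "-1"] by (auto simp: L2_iff ennreal_mult_less_top)
  finally show ?thesis by (auto simp: L2_iff)
qed

lemma hermite_expansion_dilated_sum:
  fixes g :: "real ^ 'd \<Rightarrow> complex"
  assumes "hermite_expansion g \<alpha>" "g \<in> L2"
  shows "(\<lambda>n. L2_sq (\<lambda>x. g x - dilated_sum 1 \<alpha> n x)) \<longlonglongrightarrow> 0"
proof -
  have flt: "filterlim (\<lambda>n. {m :: nat ^ 'd. mdeg m < n}) (finite_subsets_at_top UNIV) sequentially"
    by (rule filterlim_grade) simp
  have "(\<lambda>n. L2_norm (\<lambda>x. g x - dilated_sum 1 \<alpha> n x)) \<longlonglongrightarrow> 0"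
    using filterlim_compose[OF assms(1)[unfolded hermite_expansion_def] flt] by (simp only: dilated_sum_def scaleR_one)
  then have "(\<lambda>n. ennreal ((L2_norm (\<lambda>x. g x - dilated_sum 1 \<alpha> n x))\<^sup>2)) \<longlonglongrightarrow> ennreal (0\<^sup>2)"
    by (intro tendsto_intros)
  moreover have "L2_sq (\<lambda>x. g x - dilated_sum 1 \<alpha> n x) = ennreal ((L2_norm (\<lambda>x. g x - dilated_sum 1 \<alpha> n x))\<^sup>2)" for n
    by (rule L2_sq_L2_norm) (rule L2_diff_dilated_sum[OF assms(2)])
  ultimately show ?thesis by (simp only: zero_power2 ennreal_0)
qed

lemma coeff_le_degree_weight_sum:
  fixes c :: "nat ^ 'd \<Rightarrow> complex"
  assumes "ell2 c"
  shows "(norm (c m))\<^sup>2 * multi_fact m \<le> (\<Sum>j. degree_weight c j)"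
proof -
  have "(norm (c m))\<^sup>2 * multi_fact m \<le> degree_weight c (mdeg m)"
    unfolding degree_weight_def using member_le_sum[of m "{i. mdeg i = mdeg m}" "\<lambda>i. (norm (c i))\<^sup>2 * multi_fact i"]
    by (simp add: less_imp_le[OF multi_fact_pos])
  also have "\<dots> \<le> (\<Sum>j<Suc (mdeg m). degree_weight c j)"
    by (simp add: sum_nonneg degree_weight_nonneg)
  also have "\<dots> \<le> (\<Sum>j. degree_weight c j)"
    using assms unfolding ell2_def by (intro sum_le_suminf) (auto simp: degree_weight_nonneg)
  finally show ?thesis .
qed

text \<open>
  By Bessel's inequality a single coefficient of \<open>g - \<Sum> \<alpha>(i) H\<^sub>i\<close>, summed over \<open>|i| < n\<close>, is bounded by the norm
  of this difference, which tends to \<open>0\<close>.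
\<close>

lemma hermite_coeff_eq_expansion:
  fixes g :: "real ^ 'd \<Rightarrow> complex"
  assumes "g \<in> L2" "(\<lambda>n. L2_sq (\<lambda>x. g x - dilated_sum 1 \<alpha> n x)) \<longlonglongrightarrow> 0"
  shows "hermite_coeff g = \<alpha>"
proof
  fix m
  let ?d = "\<lambda>n x. g x - dilated_sum 1 \<alpha> n x"
  have bound: "(norm (hermite_coeff g m - \<alpha> m))\<^sup>2 * multi_fact m \<le> (L2_norm (?d n))\<^sup>2" if "n > mdeg m" for n
  proof -
    have L: "?d n \<in> L2" by (rule L2_diff_dilated_sum[OF assms(1)])
    have "hermite_coeff (dilated_sum 1 \<alpha> n) m = \<alpha> m"
    proof -
      have "(\<integral>x. dilated_sum 1 \<alpha> n x * of_real (hermite_multi m x) \<partial>gauss) =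
          (\<integral>x. (\<Sum>i | mdeg i < n. \<alpha> i * of_real (hermite_multi i x * hermite_multi m x)) \<partial>gauss)"
        by (intro Bochner_Integration.integral_cong refl) (simp add: dilated_sum_def sum_distrib_right mult.assoc)
      also have "\<dots> = (\<Sum>i | mdeg i < n. \<alpha> i * of_real (\<integral>x. hermite_multi i x * hermite_multi m x \<partial>gauss))"
      proof -
        have "integrable gauss (\<lambda>x. \<alpha> i * complex_of_real (hermite_multi i x * hermite_multi m x))" for i
          by (intro integrable_mult_right integrable_of_real hermite_multi_orthogonal)
        then show ?thesis
          by (simp only: Bochner_Integration.integral_sum integral_mult_right_zero integral_complex_of_real)
      qed
      also have "\<dots> = (\<Sum>i | mdeg i < n. if i = m then \<alpha> m * of_real (multi_fact m) else 0)"
        by (rule sum.cong) (auto simp: hermite_multi_orthogonal)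
      also have "\<dots> = \<alpha> m * of_real (multi_fact m)" using that by simp
      finally show ?thesis using multi_fact_pos[of m] by (simp add: hermite_coeff_def)
    qed
    moreover have "?d n = (\<lambda>y. 1 * g y + (-1) * dilated_sum 1 \<alpha> n y)" by (rule ext) simp
    ultimately have eq: "hermite_coeff (?d n) m = hermite_coeff g m - \<alpha> m"
      using hermite_coeff_lin[OF assms(1) dilated_sum_L2[of \<alpha> n], where a = 1 and b = "-1" and m = m] by (simp only:) simp
    have "(norm (hermite_coeff (?d n) m))\<^sup>2 * multi_fact m \<le> (\<Sum>j. degree_weight (hermite_coeff (?d n)) j)"
      by (rule coeff_le_degree_weight_sum[OF bessel(1)[OF L]])
    also have "\<dots> \<le> (L2_norm (?d n))\<^sup>2" by (rule bessel(2)[OF L])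
    finally show ?thesis unfolding eq .
  qed
  have "(norm (hermite_coeff g m - \<alpha> m))\<^sup>2 * multi_fact m \<le> e" if "e > 0" for e
  proof -
    have "eventually (\<lambda>n. L2_sq (?d n) \<le> ennreal e \<and> n > mdeg m) sequentially"
      using ennreal_tendsto_0D[OF assms(2) that] eventually_gt_at_top[of "mdeg m"] by eventually_elim simp
    then obtain n where n: "L2_sq (?d n) \<le> ennreal e" "n > mdeg m"
      using eventually_happens'[OF sequentially_bot] by blast
    then have "(L2_norm (?d n))\<^sup>2 \<le> e"
      using that unfolding L2_sq_L2_norm[OF L2_diff_dilated_sum[OF assms(1)]] by (simp add: ennreal_le_iff)
    then show ?thesis using bound[OF n(2)] by simp
  qed
  then have "(norm (hermite_coeff g m - \<alpha> m))\<^sup>2 * multi_fact m \<le> 0"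
    by (metis add_0 field_le_epsilon)
  then have "norm (hermite_coeff g m - \<alpha> m) = 0"
    using multi_fact_pos[of m] by (metis mult_le_0_iff not_le power2_less_eq_zero_iff norm_eq_zero)
  then show "hermite_coeff g m = \<alpha> m" by simp
qed

lemma hermite_parseval:
  fixes g :: "real ^ 'd \<Rightarrow> complex"
  assumes "g \<in> L2" "(\<lambda>n. L2_sq (\<lambda>x. g x - dilated_sum 1 \<alpha> n x)) \<longlonglongrightarrow> 0"
  shows "degree_weight \<alpha> sums (L2_norm g)\<^sup>2"
proof -
  note h = hermite_coeff_eq_expansion[OF assms]
  have "(\<lambda>n. (L2_norm g)\<^sup>2 - (L2_norm (\<lambda>x. g x - dilated_sum 1 \<alpha> n x))\<^sup>2) \<longlonglongrightarrow> (L2_norm g)\<^sup>2 - 0"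
  proof (intro tendsto_diff tendsto_const)
    have "(\<lambda>n. ennreal ((L2_norm (\<lambda>x. g x - dilated_sum 1 \<alpha> n x))\<^sup>2)) \<longlonglongrightarrow> ennreal 0"
      using assms(2) by (simp only: L2_sq_L2_norm[OF L2_diff_dilated_sum[OF assms(1)]] ennreal_0)
    then show "(\<lambda>n. (L2_norm (\<lambda>x. g x - dilated_sum 1 \<alpha> n x))\<^sup>2) \<longlonglongrightarrow> 0"
      by (subst (asm) tendsto_ennreal_iff) auto
  qed
  then show ?thesis
    unfolding sums_def bessel_remainder[OF assms(1), unfolded h] by simp
qed

lemma is_hermite_flowD:
  assumes "is_hermite_flow k t T"
  shows "g \<in> L2 \<Longrightarrow> T g \<in> L2"
    and "g \<in> L2 \<Longrightarrow> h \<in> L2 \<Longrightarrow> AE x in gauss. T (\<lambda>y. a * g y + b * h y) x = a * T g x + b * T h x"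
    and "\<exists>C. \<forall>g\<in>L2. L2_norm (T g) \<le> C * L2_norm g"
    and "AE x in gauss. T (\<lambda>y. of_real (hermite_multi m y)) x =
      phase t (mdeg m) * of_real (hermite_multi m (dilation_factor k *\<^sub>R x))"
  using assms[unfolded is_hermite_flow_def, THEN conjunct1]
    assms[unfolded is_hermite_flow_def, THEN conjunct2, THEN conjunct1]
    assms[unfolded is_hermite_flow_def, THEN conjunct2, THEN conjunct2, THEN conjunct1]
    assms[unfolded is_hermite_flow_def, THEN conjunct2, THEN conjunct2, THEN conjunct2]
  unfolding phase_def dilation_factor_def by simp_all

lemma flow_hermite_sum:
  fixes T :: "(real ^ 'd \<Rightarrow> complex) \<Rightarrow> real ^ 'd \<Rightarrow> complex"
  assumes T: "is_hermite_flow k t T" and "finite A"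
  shows "AE x in gauss. T (\<lambda>y. \<Sum>m\<in>A. c m * of_real (hermite_multi m y)) x =
     (\<Sum>m\<in>A. twist t c m * of_real (hermite_multi m (dilation_factor k *\<^sub>R x)))"
  using assms(2)
proof (induction A rule: finite_induct)
  case empty
  note lin = is_hermite_flowD(2)[OF T]
  show ?case
    using lin[OF hermite_multi_L2 hermite_multi_L2, where a = 0 and b = 0] by simp
next
  case (insert m A)
  note lin = is_hermite_flowD(2)[OF T]
  have H: "AE x in gauss. T (\<lambda>y. of_real (hermite_multi m y)) x =
      phase t (mdeg m) * of_real (hermite_multi m (dilation_factor k *\<^sub>R x))"
    by (rule is_hermite_flowD(4)[OF T])
  have eq: "(\<lambda>y. \<Sum>i\<in>insert m A. c i * of_real (hermite_multi i y)) =
      (\<lambda>y. c m * of_real (hermite_multi m y) + 1 * (\<Sum>i\<in>A. c i * of_real (hermite_multi i y)))"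
    using insert.hyps by simp
  show ?case
    unfolding eq using lin[OF hermite_multi_L2[of m] L2_sq_hermite_sum(2)[OF insert.hyps(1), of c], where a = "c m" and b = 1] H insert.IH
    by eventually_elim (use insert.hyps in \<open>simp add: twist_def\<close>)
qed

text \<open>
  Linearity determines any flow on finite Hermite sums, and boundedness transports their convergence
  to \<open>g\<close>. Applied to the flow selected by \<open>hermite_flow\<close>, this replaces \<open>hermite_flow\<close> by a dilated
  Hermite series.
\<close>

lemma flow_represents:
  fixes T :: "(real ^ 'd \<Rightarrow> complex) \<Rightarrow> real ^ 'd \<Rightarrow> complex"
  assumes T: "is_hermite_flow k t T" and g: "g \<in> L2"
    and lim: "(\<lambda>n. L2_sq (\<lambda>x. g x - dilated_sum 1 \<alpha> n x)) \<longlonglongrightarrow> 0"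
  shows "represents k (T g) (twist t \<alpha>)"
proof -
  note lin = is_hermite_flowD(2)[OF T] and TL = is_hermite_flowD(1)[OF T]
  obtain C where C: "\<And>g. g \<in> L2 \<Longrightarrow> L2_norm (T g) \<le> C * L2_norm g"
    using is_hermite_flowD(3)[OF T] by blast
  have [measurable]: "T g \<in> borel_measurable borel" using TL[OF g] by (simp add: L2_def)
  let ?d = "\<lambda>n x. g x - dilated_sum 1 \<alpha> n x"
  have le: "L2_sq (\<lambda>x. T g x - dilated_sum (dilation_factor k) (twist t \<alpha>) n x) \<le> ennreal (C\<^sup>2) * L2_sq (?d n)" for n
  proof -
    have L: "?d n \<in> L2" by (rule L2_diff_dilated_sum[OF g])
    have p: "AE x in gauss. T (dilated_sum 1 \<alpha> n) x = dilated_sum (dilation_factor k) (twist t \<alpha>) n x"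
      using flow_hermite_sum[OF T, of "{m. mdeg m < n}" \<alpha>] by (simp add: dilated_sum_def[abs_def])
    have d: "?d n = (\<lambda>y. 1 * g y + (-1) * dilated_sum 1 \<alpha> n y)" by simp
    have "AE x in gauss. T (?d n) x = 1 * T g x + (-1) * T (dilated_sum 1 \<alpha> n) x"
      unfolding d by (rule lin[OF g dilated_sum_L2])
    then have "AE x in gauss. T g x - dilated_sum (dilation_factor k) (twist t \<alpha>) n x = T (?d n) x"
      using p by eventually_elim simp
    then have "L2_sq (\<lambda>x. T g x - dilated_sum (dilation_factor k) (twist t \<alpha>) n x) = L2_sq (T (?d n))"
      by (rule L2_sq_cong_AE)
    also have "\<dots> = ennreal ((L2_norm (T (?d n)))\<^sup>2)" by (rule L2_sq_L2_norm[OF TL[OF L]])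
    also have "\<dots> \<le> ennreal ((C * L2_norm (?d n))\<^sup>2)"
      by (intro ennreal_leI power_mono C L L2_norm_nonneg)
    also have "\<dots> = ennreal (C\<^sup>2) * L2_sq (?d n)"
      unfolding L2_sq_L2_norm[OF L] by (simp add: power_mult_distrib ennreal_mult)
    finally show ?thesis .
  qed
  have "(\<lambda>n. ennreal (C\<^sup>2) * L2_sq (?d n)) \<longlonglongrightarrow> ennreal (C\<^sup>2) * 0"
    by (intro tendsto_intros lim) auto
  then have "(\<lambda>n. ennreal (C\<^sup>2) * L2_sq (?d n)) \<longlonglongrightarrow> 0" by simp
  then have "(\<lambda>n. L2_sq (\<lambda>x. T g x - dilated_sum (dilation_factor k) (twist t \<alpha>) n x)) \<longlonglongrightarrow> 0"
    by (rule tendsto_sandwich[OF _ _ tendsto_const, rotated 2]) (use le in auto)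
  then show ?thesis by (simp add: represents_def)
qed

section \<open>Lower semicontinuity of the energy\<close>

text \<open>
  Iterated, this carries a limit inferior through the power \<open>l\<close> that stands between the two
  integrations of the energy.
\<close>

lemma liminf_mult_ennreal_le:
  fixes a b :: "nat \<Rightarrow> ennreal"
  shows "liminf a * liminf b \<le> liminf (\<lambda>n. a n * b n)"
proof -
  let ?A = "\<lambda>n. INF m\<in>{n..}. a m" and ?B = "\<lambda>n. INF m\<in>{n..}. b m"
  have "liminf a * liminf b = (SUP n. ?A n * (SUP m. ?B m))"
    unfolding liminf_SUP_INF by (rule SUP_mult_right_ennreal)
  also have "\<dots> = (SUP n. SUP m. ?A n * ?B m)"
    by (simp only: SUP_mult_left_ennreal)
  also have "\<dots> \<le> (SUP n. INF m\<in>{n..}. a m * b m)"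
  proof (intro SUP_least)
    fix n m :: nat
    have "?A n * ?B m \<le> (INF i\<in>{max n m..}. a i * b i)"
      by (intro INF_greatest mult_mono INF_lower) auto
    also have "\<dots> \<le> (SUP n. INF m\<in>{n..}. a m * b m)" by (rule SUP_upper) simp
    finally show "?A n * ?B m \<le> (SUP n. INF m\<in>{n..}. a m * b m)" .
  qed
  finally show ?thesis unfolding liminf_SUP_INF .
qed

lemma liminf_power_ennreal_le:
  fixes a :: "nat \<Rightarrow> ennreal"
  shows "(liminf a) ^ l \<le> liminf (\<lambda>n. a n ^ l)"
proof (induction l)
  case (Suc l)
  have "(liminf a) ^ Suc l \<le> liminf a * liminf (\<lambda>n. a n ^ l)"
    using Suc by (simp add: mult_left_mono)
  also have "\<dots> \<le> liminf (\<lambda>n. a n ^ Suc l)"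
    using liminf_mult_ennreal_le[of a "\<lambda>n. a n ^ l"] by simp
  finally show ?case .
qed (simp add: Liminf_const)

definition power_integral :: "nat \<Rightarrow> (real ^ 'd \<Rightarrow> complex) \<Rightarrow> ennreal" where
  "power_integral k f = (\<integral>\<^sup>+x. ennreal (norm (f x) ^ (2 * k)) \<partial>gauss)"

lemma power_integral_cong_AE: "(AE x in gauss. f x = g x) \<Longrightarrow> power_integral k f = power_integral k g"
  unfolding power_integral_def by (intro nn_integral_cong_AE) auto

text \<open>
  Along a subsequence that realizes the limit inferior, a further subsequence converges almost
  everywhere; Fatou's lemma applies to it.
\<close>

lemma power_integral_lsc:
  assumes meas [measurable]: "f \<in> borel_measurable borel" "\<And>n. fs n \<in> borel_measurable borel"
    and lim: "(\<lambda>n. L2_sq (\<lambda>x. f x - fs n x)) \<longlonglongrightarrow> 0" and fin: "\<And>n. L2_sq (\<lambda>x. f x - fs n x) < \<infinity>"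
  shows "power_integral k f \<le> liminf (\<lambda>n. power_integral k (fs n))"
proof -
  \<comment> \<open>The subsequence must be chosen before the one that converges almost everywhere.\<close>
  obtain r :: "nat \<Rightarrow> nat" where r: "strict_mono r" "(\<lambda>n. power_integral k (fs (r n))) \<longlonglongrightarrow> liminf (\<lambda>n. power_integral k (fs n))"
    using liminf_subseq_lim[of "\<lambda>n. power_integral k (fs n)"] by (auto simp: o_def)
  let ?u = "\<lambda>n x. (norm (f x - fs (r n) x))\<^sup>2"
  have L: "(\<lambda>x. f x - fs (r n) x) \<in> L2" for n
    using fin by (auto simp: L2_iff)
  have int: "integrable gauss (?u n)" for n
    using L[of n] by (simp add: L2_def)
  have "(\<lambda>n. ennreal (\<integral>x. ?u n x \<partial>gauss)) \<longlonglongrightarrow> ennreal 0"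
    using LIMSEQ_subseq_LIMSEQ[OF lim r(1)] by (simp add: o_def L2_sq_integral[OF L])
  then have "(\<lambda>n. \<integral>x. norm (?u n x) \<partial>gauss) \<longlonglongrightarrow> 0"
    by (subst (asm) tendsto_ennreal_iff) auto
  then obtain s :: "nat \<Rightarrow> nat" where s: "strict_mono s" "AE x in gauss. (\<lambda>n. ?u (s n) x) \<longlonglongrightarrow> 0"
    using tendsto_L1_AE_subseq[of gauss ?u, OF int] by blast
  have "power_integral k f = (\<integral>\<^sup>+x. liminf (\<lambda>n. ennreal (norm (fs (r (s n)) x) ^ (2 * k))) \<partial>gauss)"
    unfolding power_integral_def
  proof (rule nn_integral_cong_AE)
    show "AE x in gauss. ennreal (norm (f x) ^ (2 * k)) = liminf (\<lambda>n. ennreal (norm (fs (r (s n)) x) ^ (2 * k)))"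
      using s(2)
    proof eventually_elim
      case (elim x)
      then have "(\<lambda>n. sqrt (?u (s n) x)) \<longlonglongrightarrow> sqrt 0" by (rule tendsto_real_sqrt)
      then have "(\<lambda>n. f x - (f x - fs (r (s n)) x)) \<longlonglongrightarrow> f x - 0"
        by (intro tendsto_diff tendsto_const) (simp add: tendsto_norm_zero_iff)
      then have "(\<lambda>n. fs (r (s n)) x) \<longlonglongrightarrow> f x" by simp
      then have "(\<lambda>n. ennreal (norm (fs (r (s n)) x) ^ (2 * k))) \<longlonglongrightarrow> ennreal (norm (f x) ^ (2 * k))"
        by (intro tendsto_intros)
      then show ?case by (rule lim_imp_Liminf[OF trivial_limit_sequentially, symmetric])
    qed
  qed
  also have "\<dots> \<le> liminf (\<lambda>n. power_integral k (fs (r (s n))))"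
    unfolding power_integral_def by (rule nn_integral_liminf) auto
  also have "\<dots> = liminf (\<lambda>n. power_integral k (fs n))"
    using LIMSEQ_subseq_LIMSEQ[OF r(2) s(1)] by (intro lim_imp_Liminf) (auto simp: o_def)
  finally show ?thesis .
qed

text \<open>
  Multipliers that depend on the degree: rotations by \<open>phase\<close>, truncations, Fejer and exponential
  weights are all of this kind, and they commute.
\<close>

definition degree_mult :: "(nat \<Rightarrow> complex) \<Rightarrow> (nat ^ 'd \<Rightarrow> complex) \<Rightarrow> nat ^ 'd \<Rightarrow> complex" where
  "degree_mult b c m = b (mdeg m) * c m"

lemma degree_weight_degree_mult: "degree_weight (degree_mult b c) j = (norm (b j))\<^sup>2 * degree_weight c j"
  unfolding degree_weight_def degree_mult_def sum_distrib_left
  by (intro sum.cong) (auto simp: norm_mult power_mult_distrib)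

lemma twist_degree_mult: "twist t c = degree_mult (phase t) c"
  by (rule ext) (simp add: twist_def degree_mult_def)

lemma degree_mult_degree_mult: "degree_mult b (degree_mult b' c) = degree_mult (\<lambda>j. b j * b' j) c"
  by (rule ext) (simp add: degree_mult_def mult.assoc)

lemma ell2_degree_mult:
  assumes "ell2 c" "\<And>j. norm (b j) \<le> B"
  shows "ell2 (degree_mult b c)"
  using ell2_mult[OF assms(1), of "\<lambda>m. b (mdeg m)" B] assms(2) by (simp add: degree_mult_def[abs_def])

lemma degree_mult_diff: "(\<lambda>m. degree_mult b c m - degree_mult b' c m) = degree_mult (\<lambda>j. b j - b' j) c"
  by (rule ext) (simp add: degree_mult_def algebra_simps)

text \<open>
  Dominated convergence for series, with the majorant \<open>(2B)\<^sup>2\<close> times the weight of \<open>c\<close>.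
\<close>

lemma degree_mult_tendsto:
  fixes c :: "nat ^ 'd \<Rightarrow> complex"
  assumes c: "ell2 c" and lim: "\<And>j. (\<lambda>n. b n j) \<longlonglongrightarrow> b' j"
    and B: "\<And>n j. norm (b n j) \<le> B" "\<And>j. norm (b' j) \<le> B"
  shows "(\<lambda>n. \<Sum>j. degree_weight (\<lambda>m. degree_mult b' c m - degree_mult (b n) c m) j) \<longlonglongrightarrow> 0"
proof -
  let ?a = "\<lambda>j n. (norm (b' j - b n j))\<^sup>2 * degree_weight c j"
  have "eventually (\<lambda>n. summable (\<lambda>j. norm (?a j n))) sequentially \<and> summable (\<lambda>j. norm (0 :: real)) \<and>
    ((\<lambda>n. \<Sum>j. ?a j n) \<longlonglongrightarrow> (\<Sum>j. 0))"
  proof (rule tannerys_theorem)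
    show "summable (\<lambda>j. (2 * B)\<^sup>2 * degree_weight c j)"
      using c unfolding ell2_def by (rule summable_mult)
    show "(\<lambda>n. ?a j n) \<longlonglongrightarrow> 0" for j
    proof -
      have "(\<lambda>n. (norm (b' j - b n j))\<^sup>2 * degree_weight c j) \<longlonglongrightarrow> (norm (b' j - b' j))\<^sup>2 * degree_weight c j"
        by (intro tendsto_intros lim)
      then show ?thesis by simp
    qed
    have "norm (?a j n) \<le> (2 * B)\<^sup>2 * degree_weight c j" for j n
    proof -
      have "norm (b' j - b n j) \<le> 2 * B"
        using norm_triangle_ineq4[of "b' j" "b n j"] B(1)[of n j] B(2)[of j] by linarith
      then have "(norm (b' j - b n j))\<^sup>2 \<le> (2 * B)\<^sup>2" by (intro power_mono) auto
      then have "(norm (b' j - b n j))\<^sup>2 * degree_weight c j \<le> (2 * B)\<^sup>2 * degree_weight c j"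
        by (intro mult_right_mono degree_weight_nonneg)
      then show ?thesis by (simp add: degree_weight_nonneg abs_mult)
    qed
    then show "eventually (\<lambda>(j, n). norm (?a j n) \<le> (2 * B)\<^sup>2 * degree_weight c j) (at_top \<times>\<^sub>F sequentially)"
      by (intro always_eventually) auto
  qed simp
  then show ?thesis unfolding degree_mult_diff degree_weight_degree_mult by simp
qed

definition series_sum :: "nat \<Rightarrow> (nat ^ 'd \<Rightarrow> complex) \<Rightarrow> real ^ 'd \<Rightarrow> complex" where
  "series_sum k c = (SOME f. represents k f c)"

lemma represents_series_sum: "k \<ge> 1 \<Longrightarrow> ell2 c \<Longrightarrow> represents k (series_sum k c) c"
  unfolding series_sum_def by (rule someI_ex[OF represents_exists])

lemma power_integral_degree_mult_lsc:
  fixes c :: "nat ^ 'd \<Rightarrow> complex"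
  assumes k: "k \<ge> 1" and c: "ell2 c" and lim: "\<And>j. (\<lambda>n. b n j) \<longlonglongrightarrow> b' j"
    and B: "\<And>n j. norm (b n j) \<le> B" "\<And>j. norm (b' j) \<le> B"
  shows "power_integral k (series_sum k (degree_mult b' c)) \<le> liminf (\<lambda>n. power_integral k (series_sum k (degree_mult (b n) c)))"
proof (rule power_integral_lsc)
  have e: "ell2 (degree_mult b' c)" "ell2 (degree_mult (b n) c)" for n
    by (rule ell2_degree_mult[OF c], rule B)+
  note R = represents_series_sum[OF k e(1)] represents_series_sum[OF k e(2)]
  show "series_sum k (degree_mult b' c) \<in> borel_measurable borel" "series_sum k (degree_mult (b n) c) \<in> borel_measurable borel" for n
    using R(1) R(2)[of n] unfolding represents_def by blast+
  have le: "L2_sq (\<lambda>x. series_sum k (degree_mult b' c) x - series_sum k (degree_mult (b n) c) x) \<le>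
     ennreal (2 * dilation_bound TYPE('d) k * (\<Sum>j. degree_weight (\<lambda>m. degree_mult b' c m - degree_mult (b n) c m) j))" for n
    by (rule represents_diff_bound[OF k R e])
  then show "L2_sq (\<lambda>x. series_sum k (degree_mult b' c) x - series_sum k (degree_mult (b n) c) x) < \<infinity>" for n
    by (rule le_less_trans) simp
  have "(\<lambda>n. \<Sum>j. degree_weight (\<lambda>m. degree_mult b' c m - degree_mult (b n) c m) j) \<longlonglongrightarrow> 0"
    by (rule degree_mult_tendsto[where B = B]) (fact c lim B)+
  then have "(\<lambda>n. ennreal (2 * dilation_bound TYPE('d) k * (\<Sum>j. degree_weight (\<lambda>m. degree_mult b' c m - degree_mult (b n) c m) j))) \<longlonglongrightarrow>
      ennreal (2 * dilation_bound TYPE('d) k * 0)"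
    by (intro tendsto_intros)
  then have "(\<lambda>n. ennreal (2 * dilation_bound TYPE('d) k * (\<Sum>j. degree_weight (\<lambda>m. degree_mult b' c m - degree_mult (b n) c m) j))) \<longlonglongrightarrow> 0"
    by simp
  then show "(\<lambda>n. L2_sq (\<lambda>x. series_sum k (degree_mult b' c) x - series_sum k (degree_mult (b n) c) x)) \<longlonglongrightarrow> 0"
    by (rule tendsto_sandwich[OF _ _ tendsto_const, rotated 2]) (use le in auto)
qed

lemma phase_tendsto: "(x \<longlonglongrightarrow> t) \<Longrightarrow> (\<lambda>n. phase (x n) j) \<longlonglongrightarrow> phase t j"
  unfolding phase_def by (intro tendsto_intros)

text \<open>
  Lower semicontinuity in \<open>t\<close> makes the sublevel sets closed.
\<close>

lemma power_integral_twist_measurable: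
  fixes c :: "nat ^ 'd \<Rightarrow> complex"
  assumes k: "k \<ge> 1" and c: "ell2 c"
  shows "(\<lambda>t. power_integral k (series_sum k (twist t c))) \<in> borel_measurable borel"
proof (rule borel_measurableI_le)
  fix y
  have "closed {t. power_integral k (series_sum k (twist t c)) \<le> y}"
    unfolding closed_sequential_limits
  proof (intro allI impI)
    fix x t assume "(\<forall>n. x n \<in> {t. power_integral k (series_sum k (twist t c)) \<le> y}) \<and> x \<longlonglongrightarrow> t"
    then have x: "\<And>n. power_integral k (series_sum k (twist (x n) c)) \<le> y" "x \<longlonglongrightarrow> t" by auto
    have "power_integral k (series_sum k (twist t c)) \<le> liminf (\<lambda>n. power_integral k (series_sum k (twist (x n) c)))"
      unfolding twist_degree_mult
      by (rule power_integral_degree_mult_lsc[OF k c phase_tendsto[OF x(2)], where B = 1]) simp_all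
    also have "\<dots> \<le> y" by (intro Liminf_le always_eventually allI x(1)) simp
    finally show "t \<in> {t. power_integral k (series_sum k (twist t c)) \<le> y}" by simp
  qed
  then show "{t \<in> space borel. power_integral k (series_sum k (twist t c)) \<le> y} \<in> sets borel" by simp
qed

text \<open>
  The left hand side of the integral identity as a function of the Hermite coefficients.
\<close>

definition energy :: "nat \<Rightarrow> nat \<Rightarrow> (nat ^ 'd \<Rightarrow> complex) \<Rightarrow> ennreal" where
  "energy k l c = (\<integral>\<^sup>+t\<in>{-1/2..1/2}. power_integral k (series_sum k (twist t c)) ^ l \<partial>lborel)"

lemma energy_lsc:
  fixes c :: "nat ^ 'd \<Rightarrow> complex"
  assumes k: "k \<ge> 1" and c: "ell2 c" and lim: "\<And>j. (\<lambda>n. b n j) \<longlonglongrightarrow> b' j"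
    and B: "\<And>n j. norm (b n j) \<le> B" "\<And>j. norm (b' j) \<le> B"
  shows "energy k l (degree_mult b' c) \<le> liminf (\<lambda>n. energy k l (degree_mult (b n) c))"
proof -
  have e: "ell2 (degree_mult b' c)" "ell2 (degree_mult (b n) c)" for n
    by (rule ell2_degree_mult[OF c], rule B)+
  note [measurable] = power_integral_twist_measurable[OF k e(1)] power_integral_twist_measurable[OF k e(2)]
  have "energy k l (degree_mult b' c) \<le>
      (\<integral>\<^sup>+t. liminf (\<lambda>n. power_integral k (series_sum k (twist t (degree_mult (b n) c))) ^ l * indicator {-1/2..1/2} t) \<partial>lborel)"
    unfolding energy_def
  proof (rule nn_integral_mono)
    fix t
    have "power_integral k (series_sum k (twist t (degree_mult b' c))) \<le> liminf (\<lambda>n. power_integral k (series_sum k (twist t (degree_mult (b n) c))))"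
      unfolding twist_degree_mult degree_mult_degree_mult
      by (rule power_integral_degree_mult_lsc[OF k c, where B = B]) (auto intro!: tendsto_intros lim B simp: norm_mult)
    then have "power_integral k (series_sum k (twist t (degree_mult b' c))) ^ l \<le> (liminf (\<lambda>n. power_integral k (series_sum k (twist t (degree_mult (b n) c))))) ^ l"
      by (rule power_mono) simp
    also have "\<dots> \<le> liminf (\<lambda>n. power_integral k (series_sum k (twist t (degree_mult (b n) c))) ^ l)"
      by (rule liminf_power_ennreal_le)
    finally show "power_integral k (series_sum k (twist t (degree_mult b' c))) ^ l * indicator {-1/2..1/2} t \<le>
        liminf (\<lambda>n. power_integral k (series_sum k (twist t (degree_mult (b n) c))) ^ l * indicator {-1/2..1/2} t)"
      by (auto split: split_indicator)
  qed
  also have "\<dots> \<le> liminf (\<lambda>n. energy k l (degree_mult (b n) c))"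
    unfolding energy_def by (rule nn_integral_liminf) measurable
  finally show ?thesis .
qed

section \<open>Averages over shifts of time\<close>

text \<open>
  Jensen's inequality for \<open>x \<mapsto> x\<^sup>l\<close>; the value \<open>\<infinity>\<close> is treated apart, where a weight \<open>0\<close> cancels it.
\<close>

lemma power_convex_ennreal:
  fixes a :: "nat \<Rightarrow> ennreal" and v :: "nat \<Rightarrow> real"
  assumes v: "\<And>q. q < n \<Longrightarrow> v q \<ge> 0" "(\<Sum>q<n. v q) = 1" and l: "l \<ge> 1"
  shows "(\<Sum>q<n. ennreal (v q) * a q) ^ l \<le> (\<Sum>q<n. ennreal (v q) * a q ^ l)"
proof (cases "\<exists>q<n. v q > 0 \<and> a q = \<infinity>")
  case True
  then obtain q where q: "q < n" "v q > 0" "a q = \<infinity>" by blast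
  have "ennreal (v q) * a q ^ l \<le> (\<Sum>q<n. ennreal (v q) * a q ^ l)"
    by (rule member_le_sum) (use q in auto)
  moreover have "ennreal (v q) * a q ^ l = \<infinity>"
    using q l by (simp add: top_power_ennreal ennreal_mult_top)
  ultimately have "(\<Sum>q<n. ennreal (v q) * a q ^ l) = \<top>" by (simp only: infinity_ennreal_def top_unique)
  then show ?thesis by (simp only: top_greatest)
next
  case False
  let ?r = "\<lambda>q. enn2real (a q)"
  have eq: "ennreal (v q) * a q ^ i = ennreal (v q * ?r q ^ i)" if "q < n" "i \<ge> 1" for q i
  proof (cases "v q = 0")
    case False
    then have "a q \<noteq> \<infinity>" using \<open>\<not> (\<exists>q<n. v q > 0 \<and> a q = \<infinity>)\<close> v(1)[OF that(1)] that(1) by fastforce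
    then have "a q = ennreal (?r q)" by (simp add: less_top)
    then have "a q ^ i = ennreal (?r q ^ i)" by (metis ennreal_power enn2real_nonneg)
    then show ?thesis using v(1)[OF that(1)] by (simp add: ennreal_mult)
  qed (simp)
  have "n \<noteq> 0" using v(2) by (metis lessThan_0 sum.empty zero_neq_one)
  have conv: "convex_on {0 :: real..} (\<lambda>x. x ^ l)"
  proof (cases "even l")
    case True
    show ?thesis using convex_power_even[OF True] by (rule convex_on_subset) auto
  qed (rule convex_power_odd)
  have "(\<Sum>q<n. v q *\<^sub>R ?r q) ^ l \<le> (\<Sum>q<n. v q * ?r q ^ l)"
    by (rule convex_on_sum[OF _ _ conv v(2)]) (use v(1) \<open>n \<noteq> 0\<close> in auto)
  then have real_le: "(\<Sum>q<n. v q * ?r q) ^ l \<le> (\<Sum>q<n. v q * ?r q ^ l)" by simp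
  have "(\<Sum>q<n. ennreal (v q) * a q) = (\<Sum>q<n. ennreal (v q * ?r q))"
    using eq[of _ 1] by (intro sum.cong) auto
  also have "\<dots> = ennreal (\<Sum>q<n. v q * ?r q)"
    by (rule sum_ennreal) (use v(1) in auto)
  finally have "(\<Sum>q<n. ennreal (v q) * a q) ^ l = ennreal ((\<Sum>q<n. v q * ?r q) ^ l)"
    using v(1) by (simp only:) (intro ennreal_power sum_nonneg mult_nonneg_nonneg, auto)
  also have "\<dots> \<le> ennreal (\<Sum>q<n. v q * ?r q ^ l)" by (rule ennreal_leI[OF real_le])
  also have "\<dots> = (\<Sum>q<n. ennreal (v q * ?r q ^ l))"
    by (rule sum_ennreal[symmetric]) (use v(1) in auto)
  also have "\<dots> = (\<Sum>q<n. ennreal (v q) * a q ^ l)"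
    using eq l by (intro sum.cong) auto
  finally show ?thesis .
qed

lemma power_integral_convex:
  fixes f :: "nat \<Rightarrow> real ^ 'd \<Rightarrow> complex"
  assumes v: "\<And>q. q < n \<Longrightarrow> v q \<ge> 0" "(\<Sum>q<n. v q) = 1" and k: "k \<ge> 1"
    and [measurable]: "\<And>q. f q \<in> borel_measurable borel"
  shows "power_integral k (\<lambda>x. \<Sum>q<n. of_real (v q) * f q x) \<le> (\<Sum>q<n. ennreal (v q) * power_integral k (f q))"
proof -
  have "power_integral k (\<lambda>x. \<Sum>q<n. of_real (v q) * f q x) \<le>
     (\<integral>\<^sup>+x. (\<Sum>q<n. ennreal (v q) * ennreal (norm (f q x) ^ (2 * k))) \<partial>gauss)"
    unfolding power_integral_def
  proof (rule nn_integral_mono)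
    fix x
    have "norm (\<Sum>q<n. of_real (v q) * f q x) \<le> (\<Sum>q<n. v q * norm (f q x))"
      by (rule order_trans[OF norm_sum sum_mono]) (use v(1) in \<open>auto simp: norm_mult\<close>)
    then have "ennreal (norm (\<Sum>q<n. of_real (v q) * f q x) ^ (2 * k)) \<le> ennreal ((\<Sum>q<n. v q * norm (f q x)) ^ (2 * k))"
      by (intro ennreal_leI power_mono) auto
    also have "\<dots> = (\<Sum>q<n. ennreal (v q) * ennreal (norm (f q x))) ^ (2 * k)"
    proof -
      have "(\<Sum>q<n. ennreal (v q) * ennreal (norm (f q x))) = ennreal (\<Sum>q<n. v q * norm (f q x))"
        using v(1) by (subst sum_ennreal[symmetric]) (auto simp: ennreal_mult)
      moreover have "0 \<le> (\<Sum>q<n. v q * norm (f q x))"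
        by (intro sum_nonneg mult_nonneg_nonneg) (use v(1) in auto)
      ultimately show ?thesis by (simp only: ennreal_power)
    qed
    also have "\<dots> \<le> (\<Sum>q<n. ennreal (v q) * ennreal (norm (f q x)) ^ (2 * k))"
      by (rule power_convex_ennreal) (use v k in auto)
    finally show "ennreal (norm (\<Sum>q<n. of_real (v q) * f q x) ^ (2 * k)) \<le>
        (\<Sum>q<n. ennreal (v q) * ennreal (norm (f q x) ^ (2 * k)))"
      by (simp add: ennreal_power)
  qed
  also have "\<dots> = (\<Sum>q<n. ennreal (v q) * power_integral k (f q))"
    unfolding power_integral_def by (simp add: nn_integral_sum nn_integral_cmult)
  finally show ?thesis .
qed

lemma phase_add: "phase (s + t) j = phase s j * phase t j"
  unfolding phase_def by (simp add: exp_add[symmetric] algebra_simps)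

lemma phase_1: "phase 1 j = 1"
proof -
  have "phase 1 j = exp (2 * of_real pi * \<i>) ^ j"
    unfolding phase_def by (simp add: exp_of_nat_mult[symmetric] mult_ac)
  then show ?thesis by simp
qed

text \<open>
  The part of the shifted period that sticks out on the left is moved by \<open>1\<close> and fills the gap on the
  right; the end points form a null set.
\<close>

lemma nn_integral_periodic_shift:
  fixes F :: "real \<Rightarrow> ennreal"
  assumes [measurable]: "F \<in> borel_measurable borel" and per: "\<And>t. F (t + 1) = F t" and s: "0 \<le> s" "s \<le> 1"
  shows "(\<integral>\<^sup>+t\<in>{-1/2..1/2}. F (t - s) \<partial>lborel) = (\<integral>\<^sup>+t\<in>{-1/2..1/2}. F t \<partial>lborel)"
proof -
  have shift: "(\<integral>\<^sup>+t. G t \<partial>lborel) = (\<integral>\<^sup>+t. G (t + a) \<partial>lborel)"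
    if "G \<in> borel_measurable borel" for G :: "real \<Rightarrow> ennreal" and a
    using nn_integral_real_affine[OF that, of 1 a] by (simp add: add.commute)
  have "(\<integral>\<^sup>+t\<in>{-1/2..1/2}. F (t - s) \<partial>lborel) = (\<integral>\<^sup>+t. F t * indicator {-1/2 - s..1/2 - s} t \<partial>lborel)"
    by (subst shift[of _ s]) (auto intro!: nn_integral_cong split: split_indicator)
  also have "\<dots> = (\<integral>\<^sup>+t. F t * indicator {-1/2 - s..<-1/2} t + F t * indicator {-1/2..1/2 - s} t \<partial>lborel)"
    by (intro nn_integral_cong) (use s in \<open>auto split: split_indicator\<close>)
  also have "\<dots> = (\<integral>\<^sup>+t. F t * indicator {-1/2 - s..<-1/2} t \<partial>lborel) + (\<integral>\<^sup>+t. F t * indicator {-1/2..1/2 - s} t \<partial>lborel)"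
    by (rule nn_integral_add) auto
  also have "(\<integral>\<^sup>+t. F t * indicator {-1/2 - s..<-1/2} t \<partial>lborel) = (\<integral>\<^sup>+t. F t * indicator {1/2 - s..<1/2} t \<partial>lborel)"
  proof -
    have "F (t - 1) = F t" for t using per[of "t - 1"] by simp
    then show ?thesis
      by (subst shift[of _ "-1"]) (auto intro!: nn_integral_cong split: split_indicator)
  qed
  also have "\<dots> = (\<integral>\<^sup>+t. F t * indicator {1/2 - s<..1/2} t \<partial>lborel)"
  proof (rule nn_integral_cong_AE)
    have "AE t in lborel. t \<noteq> 1/2 - s" "AE t in lborel. t \<noteq> (1/2 :: real)"
      by (rule AE_lborel_singleton)+
    then show "AE t in lborel. F t * indicator {1/2 - s..<1/2} t = F t * indicator {1/2 - s<..1/2} t"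
      by eventually_elim (auto split: split_indicator)
  qed
  also have "\<dots> + (\<integral>\<^sup>+t. F t * indicator {-1/2..1/2 - s} t \<partial>lborel) =
      (\<integral>\<^sup>+t. F t * indicator {1/2 - s<..1/2} t + F t * indicator {-1/2..1/2 - s} t \<partial>lborel)"
    by (rule nn_integral_add[symmetric]) auto
  also have "\<dots> = (\<integral>\<^sup>+t. F t * indicator {-1/2..1/2} t \<partial>lborel)"
    by (intro nn_integral_cong) (use s in \<open>auto split: split_indicator\<close>)
  finally show ?thesis .
qed

lemma represents_sum:
  assumes "\<And>q. q < n \<Longrightarrow> represents k (f q) (c q)"
  shows "represents k (\<lambda>x. \<Sum>q<(n::nat). a q * f q x) (\<lambda>m. \<Sum>q<n. a q * c q m)"
  using assms
proof (induction n)
  case 0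
  show ?case by (simp add: represents_def dilated_sum_def)
next
  case (Suc n)
  have "represents k (\<lambda>x. 1 * (\<Sum>q<n. a q * f q x) + a n * f n x) (\<lambda>m. 1 * (\<Sum>q<n. a q * c q m) + a n * c n m)"
    by (rule represents_lin) (use Suc in auto)
  then show ?case by simp
qed

text \<open>
  A convex combination of shifts in time acts on the coefficients as a degree multiplier. The
  functional \<open>(\<integral> |f|\<^sup>2\<^sup>k)\<^sup>l\<close> is convex, and its integral over a period does not change under shifts.
\<close>

lemma energy_average_le:
  fixes c :: "nat ^ 'd \<Rightarrow> complex" and v s :: "nat \<Rightarrow> real"
  assumes k: "k \<ge> 1" and l: "l \<ge> 1" and c: "ell2 c"
    and v: "\<And>q. q < n \<Longrightarrow> v q \<ge> 0" "(\<Sum>q<n. v q) = 1" and s: "\<And>q. q < n \<Longrightarrow> 0 \<le> s q \<and> s q \<le> 1"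
  shows "energy k l (degree_mult (\<lambda>j. \<Sum>q<n. of_real (v q) * phase (- s q) j) c) \<le> energy k l c"
proof -
  let ?b = "\<lambda>j. \<Sum>q<n. of_real (v q) * phase (- s q) j"
  have et: "ell2 (twist t c)" for t using c by simp
  have nb: "norm (?b j) \<le> 1" for j
    using v by (intro order_trans[OF norm_sum]) (simp add: norm_mult)
  have e: "ell2 (degree_mult ?b c)" by (rule ell2_degree_mult[OF c nb])
  note [measurable] = power_integral_twist_measurable[OF k c]
  \<comment> \<open>The multiplier is the average of the shifted rotations.\<close>
  have eq: "twist t (degree_mult ?b c) = (\<lambda>m. \<Sum>q<n. of_real (v q) * twist (t - s q) c m)" for t
    using phase_add[of t "- s _"]
    by (intro ext) (simp add: twist_def degree_mult_def sum_distrib_left sum_distrib_right mult_ac)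
  have meas: "series_sum k (twist t c) \<in> borel_measurable borel" for t
    using represents_series_sum[OF k et] by (auto simp: represents_def)
  have "power_integral k (series_sum k (twist t (degree_mult ?b c))) ^ l \<le> (\<Sum>q<n. ennreal (v q) * power_integral k (series_sum k (twist (t - s q) c)) ^ l)" for t
  proof -
    have "represents k (series_sum k (twist t (degree_mult ?b c))) (twist t (degree_mult ?b c))"
      by (rule represents_series_sum[OF k]) (use e in simp)
    moreover have "represents k (\<lambda>x. \<Sum>q<n. of_real (v q) * series_sum k (twist (t - s q) c) x) (twist t (degree_mult ?b c))"
      unfolding eq by (rule represents_sum[where f = "\<lambda>q. series_sum k (twist (t - s q) c)"]) (rule represents_series_sum[OF k et])
    ultimately have "AE x in gauss. series_sum k (twist t (degree_mult ?b c)) x = (\<Sum>q<n. of_real (v q) * series_sum k (twist (t - s q) c) x)"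
      by (rule represents_unique[OF k]) (use e in simp)
    then have "power_integral k (series_sum k (twist t (degree_mult ?b c))) = power_integral k (\<lambda>x. \<Sum>q<n. of_real (v q) * series_sum k (twist (t - s q) c) x)"
      by (rule power_integral_cong_AE)
    also have "\<dots> \<le> (\<Sum>q<n. ennreal (v q) * power_integral k (series_sum k (twist (t - s q) c)))"
      by (rule power_integral_convex[OF v k meas])
    finally have "power_integral k (series_sum k (twist t (degree_mult ?b c))) ^ l \<le> (\<Sum>q<n. ennreal (v q) * power_integral k (series_sum k (twist (t - s q) c))) ^ l"
      by (rule power_mono) simp
    also have "\<dots> \<le> (\<Sum>q<n. ennreal (v q) * power_integral k (series_sum k (twist (t - s q) c)) ^ l)"
      by (rule power_convex_ennreal[OF v l])
    finally show ?thesis .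
  qed
  then have "energy k l (degree_mult ?b c) \<le>
      (\<integral>\<^sup>+t. (\<Sum>q<n. ennreal (v q) * (power_integral k (series_sum k (twist (t - s q) c)) ^ l * indicator {-1/2..1/2} t)) \<partial>lborel)"
    unfolding energy_def
    by (intro nn_integral_mono) (auto split: split_indicator)
  also have "\<dots> = (\<Sum>q<n. ennreal (v q) * (\<integral>\<^sup>+t\<in>{-1/2..1/2}. power_integral k (series_sum k (twist (t - s q) c)) ^ l \<partial>lborel))"
    by (simp add: nn_integral_sum nn_integral_cmult)
  also have "\<dots> = (\<Sum>q<n. ennreal (v q) * energy k l c)"
  proof (rule sum.cong[OF refl])
    fix q assume "q \<in> {..<n}"
    have "twist (t + 1) c = twist t c" for t
      by (rule ext) (simp add: twist_def phase_add phase_1)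
    then have "(\<integral>\<^sup>+t\<in>{-1/2..1/2}. power_integral k (series_sum k (twist (t - s q) c)) ^ l \<partial>lborel) = energy k l c"
      unfolding energy_def using s[of q] \<open>q \<in> {..<n}\<close>
      by (intro nn_integral_periodic_shift[where F = "\<lambda>t. power_integral k (series_sum k (twist t c)) ^ l"]) auto
    then show "ennreal (v q) * (\<integral>\<^sup>+t\<in>{-1/2..1/2}. power_integral k (series_sum k (twist (t - s q) c)) ^ l \<partial>lborel) = ennreal (v q) * energy k l c"
      by simp
  qed
  also have "\<dots> = energy k l c"
  proof -
    have "(\<Sum>q<n. ennreal (v q)) = ennreal (\<Sum>q<n. v q)" by (rule sum_ennreal) (use v(1) in auto)
    then show ?thesis by (simp only: sum_distrib_right[symmetric] v(2) ennreal_1 mult_1)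
  qed
  finally show ?thesis .
qed

section \<open>Fejer means\<close>

lemma sum_roots_of_unity:
  fixes n :: int
  assumes "\<bar>n\<bar> < int Q"
  shows "(\<Sum>q<Q. exp (2 * of_real pi * \<i> * of_int n * of_real (real q / real Q))) = (if n = 0 then of_nat Q else 0)"
proof (cases "n = 0")
  case False
  have Q: "Q > 0" using assms by auto
  define z where "z = exp (2 * of_real pi * \<i> * of_int n / of_nat Q)"
  have zpow: "exp (2 * of_real pi * \<i> * of_int n * of_real (real q / real Q)) = z ^ q" for q
    unfolding z_def exp_of_nat_mult[symmetric] by (simp add: field_simps)
  have "z ^ Q = exp (2 * of_real pi * \<i> * of_int n)"
    unfolding z_def exp_of_nat_mult[symmetric] using Q by simp
  also have "\<dots> = 1" unfolding exp_eq_1 by auto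
  finally have zQ: "z ^ Q = 1" .
  \<comment> \<open>Here \<open>|n| < Q\<close> excludes the multiples of \<open>Q\<close> other than \<open>0\<close>.\<close>
  have z1: "z \<noteq> 1"
  proof
    assume "z = 1"
    then obtain m :: int where "Im (2 * of_real pi * \<i> * of_int n / of_nat Q) = of_int (2 * m) * pi"
      unfolding z_def exp_eq_1 by blast
    then have "2 * pi * real_of_int n / real Q = 2 * real_of_int m * pi" by simp
    then have "real_of_int n = real_of_int m * real Q" using Q by (simp add: field_simps)
    then have "n = m * int Q" by (metis of_int_mult of_int_of_nat_eq of_int_eq_iff)
    then have "\<bar>m\<bar> * int Q < 1 * int Q" using assms by (simp add: abs_mult)
    then have "m = 0" using Q by simp
    then show False using False \<open>n = m * int Q\<close> by simp
  qed
  show ?thesis unfolding zpow using False zQ geometric_sum[OF z1, of Q] by simp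
qed simp

text \<open>
  The Fejer kernel of order \<open>N\<close> at \<open>q/Q\<close>, divided by \<open>Q\<close>. A discrete average over \<open>q < Q\<close> in place of an integral keeps
  the convexity argument within finite sums.
\<close>

definition fejer_weight :: "nat \<Rightarrow> nat \<Rightarrow> nat \<Rightarrow> real" where
  "fejer_weight N Q q = (norm (\<Sum>s<N. phase (real q / real Q) s))\<^sup>2 / (real N * real Q)"

definition fejer :: "nat \<Rightarrow> nat \<Rightarrow> complex" where
  "fejer N j = of_nat (N - j) / of_nat N"

lemma phase_triple:
  "phase t a * cnj (phase t b) * phase (- t) j = exp (2 * of_real pi * \<i> * of_int (int a - int b - int j) * of_real t)"
  unfolding phase_def exp_cnj exp_add[symmetric] by (simp add: algebra_simps)

text \<open>
  Expanding the square gives frequencies \<open>a - b - j\<close> with \<open>a, b < N\<close>. For \<open>Q \<ge> N + j\<close> they are all smaller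
  than \<open>Q\<close> in absolute value, so the average over the \<open>Q\<close>-th roots of unity keeps exactly the
  pairs with \<open>a = b + j\<close>; there are \<open>N - j\<close> of them (none if \<open>j \<ge> N\<close>, by truncated subtraction).
\<close>

lemma fejer_multiplier:
  assumes N: "N \<ge> 1" and Q: "Q \<ge> N + j"
  shows "(\<Sum>q<Q. of_real (fejer_weight N Q q) * phase (- (real q / real Q)) j) = fejer N j"
proof -
  let ?E = "\<lambda>n q. exp (2 * of_real pi * \<i> * of_int n * of_real (real q / real Q)) :: complex"
  have "of_real (fejer_weight N Q q) * phase (- (real q / real Q)) j =
      (\<Sum>a<N. \<Sum>b<N. ?E (int a - int b - int j) q) / (of_nat N * of_nat Q)" for q
  proof -
    have "complex_of_real (fejer_weight N Q q) =
        (\<Sum>a<N. \<Sum>b<N. phase (real q / real Q) a * cnj (phase (real q / real Q) b)) / (of_nat N * of_nat Q)"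
      unfolding fejer_weight_def of_real_divide complex_norm_square cnj_sum sum_product by simp
    then show ?thesis
      unfolding phase_triple[symmetric] by (simp only: sum_distrib_right times_divide_eq_left)
  qed
  then have "(\<Sum>q<Q. of_real (fejer_weight N Q q) * phase (- (real q / real Q)) j) =
      (\<Sum>q<Q. \<Sum>a<N. \<Sum>b<N. ?E (int a - int b - int j) q) / (of_nat N * of_nat Q)"
    by (simp only: sum_divide_distrib)
  also have "(\<Sum>q<Q. \<Sum>a<N. \<Sum>b<N. ?E (int a - int b - int j) q) =
      (\<Sum>a<N. \<Sum>q<Q. \<Sum>b<N. ?E (int a - int b - int j) q)"
    by (rule sum.swap)
  also have "\<dots> = (\<Sum>a<N. \<Sum>b<N. \<Sum>q<Q. ?E (int a - int b - int j) q)"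
    by (rule sum.cong[OF refl], rule sum.swap)
  also have "\<dots> = (\<Sum>a<N. \<Sum>b<N. if a = b + j then of_nat Q else 0)"
  proof (intro sum.cong refl)
    fix a b assume "a \<in> {..<N}" "b \<in> {..<N}"
    then have "\<bar>int a - int b - int j\<bar> < int Q" using Q by auto
    moreover have "(int a - int b - int j = 0) = (a = b + j)" by linarith
    ultimately show "(\<Sum>q<Q. ?E (int a - int b - int j) q) = (if a = b + j then of_nat Q else 0)"
      by (simp only: sum_roots_of_unity)
  qed
  also have "\<dots> = (\<Sum>b<N. \<Sum>a<N. if a = b + j then of_nat Q else 0)" by (rule sum.swap)
  also have "\<dots> = (\<Sum>b<N. if b + j < N then of_nat Q else 0)"
    by (rule sum.cong) auto
  also have "\<dots> = (\<Sum>b\<in>{..<N - j}. of_nat Q)"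
    by (rule sum.mono_neutral_cong_right) auto
  also have "\<dots> / (of_nat N * of_nat Q) = fejer N j"
    using N Q by (simp add: fejer_def)
  finally show ?thesis .
qed

lemma fejer_weight_sum: "N \<ge> 1 \<Longrightarrow> Q \<ge> N \<Longrightarrow> (\<Sum>q<Q. fejer_weight N Q q) = 1"
proof -
  assume "N \<ge> 1" "Q \<ge> N"
  then have "(\<Sum>q<Q. of_real (fejer_weight N Q q) * phase (- (real q / real Q)) 0) = fejer N 0"
    by (intro fejer_multiplier) auto
  then have "complex_of_real (\<Sum>q<Q. fejer_weight N Q q) = 1"
    using \<open>N \<ge> 1\<close> by (simp add: phase_def fejer_def)
  then show ?thesis by (simp only: of_real_eq_1_iff)
qed

lemma fejer_weight_nonneg: "fejer_weight N Q q \<ge> 0"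
  by (simp add: fejer_weight_def)

lemma norm_fejer_le: "norm (fejer N j) \<le> 1"
  by (cases "N = 0") (auto simp: fejer_def norm_divide)

text \<open>
  The condition \<open>Q \<ge> N + j\<close> cannot hold for all degrees \<open>j\<close> at once, so the Fejer mean is a limit of
  averages with \<open>Q \<rightarrow> \<infinity>\<close>; lower semicontinuity passes to the limit.
\<close>

lemma energy_fejer_le:
  fixes c :: "nat ^ 'd \<Rightarrow> complex"
  assumes k: "k \<ge> 1" and l: "l \<ge> 1" and c: "ell2 c" and N: "N \<ge> 1"
  shows "energy k l (degree_mult (fejer N) c) \<le> energy k l c"
proof -
  let ?b = "\<lambda>n j. \<Sum>q<N + n. of_real (fejer_weight N (N + n) q) * phase (- (real q / real (N + n))) j"
  have sum1: "(\<Sum>q<N + n. fejer_weight N (N + n) q) = 1" for n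
    by (rule fejer_weight_sum) (use N in auto)
  have lim: "(\<lambda>n. ?b n j) \<longlonglongrightarrow> fejer N j" for j
  proof (rule tendsto_eventually)
    show "eventually (\<lambda>n. ?b n j = fejer N j) sequentially"
      using eventually_ge_at_top[of j] by eventually_elim (rule fejer_multiplier, use N in auto)
  qed
  have nb: "norm (?b n j) \<le> 1" for n j
    using sum1[of n] by (intro order_trans[OF norm_sum]) (simp add: norm_mult fejer_weight_nonneg)
  have "energy k l (degree_mult (fejer N) c) \<le> liminf (\<lambda>n. energy k l (degree_mult (?b n) c))"
    by (rule energy_lsc[OF k c lim nb norm_fejer_le])
  also have "\<dots> \<le> energy k l c"
  proof (intro Liminf_le always_eventually allI)
    fix n
    show "energy k l (degree_mult (?b n) c) \<le> energy k l c"
      by (rule energy_average_le[OF k l c fejer_weight_nonneg sum1]) (simp add: divide_le_eq)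
  qed simp
  finally show ?thesis .
qed

section \<open>The energy of a finite Hermite sum\<close>

text \<open>
  The distributive law with the choice functions written as vectors.
\<close>

lemma prod_sum_vec:
  fixes u :: "'i::finite \<Rightarrow> 'x \<Rightarrow> 'c::comm_semiring_1"
  assumes "finite B"
  shows "(\<Prod>i\<in>UNIV. \<Sum>x\<in>B. u i x) = (\<Sum>q | \<forall>i. q $ i \<in> B. \<Prod>i\<in>UNIV. u i (q $ i))"
proof -
  have "(\<Prod>i\<in>UNIV. \<Sum>x\<in>B. u i x) = (\<Sum>g\<in>Pi\<^sub>E UNIV (\<lambda>_. B). \<Prod>i\<in>UNIV. u i (g i))"
    by (rule prod_sum_PiE) (use assms in auto)
  also have "\<dots> = (\<Sum>q | \<forall>i. q $ i \<in> B. \<Prod>i\<in>UNIV. u i (q $ i))"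
    by (rule sum.reindex_bij_witness[where i = "\<lambda>q. vec_nth q" and j = vec_lambda]) (auto simp: PiE_UNIV_domain)
  finally show ?thesis .
qed

lemma finite_vec_set: "finite B \<Longrightarrow> finite {q :: 'x ^ 'i. \<forall>i. q $ i \<in> B}"
proof -
  assume "finite B"
  have "{q :: 'x ^ 'i. \<forall>i. q $ i \<in> B} \<subseteq> vec_lambda ` Pi\<^sub>E UNIV (\<lambda>_. B)"
  proof
    fix q :: "'x ^ 'i" assume "q \<in> {q. \<forall>i. q $ i \<in> B}"
    then show "q \<in> vec_lambda ` Pi\<^sub>E UNIV (\<lambda>_. B)"
      by (intro image_eqI[of _ _ "\<lambda>i. q $ i"]) auto
  qed
  moreover have "finite (vec_lambda ` Pi\<^sub>E UNIV (\<lambda>_. B) :: ('x ^ 'i) set)"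
    using \<open>finite B\<close> by (intro finite_imageI finite_PiE) auto
  ultimately show ?thesis by (rule finite_subset)
qed

definition matrices_over :: "'x set \<Rightarrow> ('x ^ 'k ^ 'l) set" where
  "matrices_over B = {M. \<forall>i j. M $ i $ j \<in> B}"

lemma matrices_over_eq: "matrices_over B = {M. \<forall>i. M $ i \<in> {v. \<forall>j. v $ j \<in> B}}"
  by (simp add: matrices_over_def)

lemma finite_matrices_over: "finite B \<Longrightarrow> finite (matrices_over B :: ('x ^ 'k ^ 'l) set)"
  unfolding matrices_over_eq by (intro finite_vec_set)

text \<open>
  The function \<open>\<phi>\<close> of the integral identity.
\<close>

definition tensor :: "(nat ^ 'd \<Rightarrow> complex) \<Rightarrow> nat ^ 'd ^ 'k ^ 'l \<Rightarrow> complex" where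
  "tensor c M = (\<Prod>i\<in>UNIV. \<Prod>j\<in>UNIV. c (M $ i $ j))"

lemma sum_matrices_over_prod:
  fixes u :: "'x \<Rightarrow> 'c::comm_semiring_1"
  assumes "finite B"
  shows "(\<Sum>M\<in>(matrices_over B :: ('x ^ 'k ^ 'l) set). \<Prod>i\<in>UNIV. \<Prod>j\<in>UNIV. u (M $ i $ j)) = (\<Sum>x\<in>B. u x) ^ (CARD('k) * CARD('l))"
proof -
  have "(\<Sum>x\<in>B. u x) ^ (CARD('k) * CARD('l)) = (\<Prod>i\<in>(UNIV :: 'l set). \<Prod>j\<in>(UNIV :: 'k set). \<Sum>x\<in>B. u x)"
    by (simp add: power_mult)
  then show ?thesis
    unfolding prod_sum_vec[OF assms] prod_sum_vec[OF finite_vec_set[OF assms]] matrices_over_eq by simp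
qed

text \<open>
  Writing \<open>|f|\<^sup>2\<^sup>k\<close> as a product of \<open>k\<close> factors \<open>f * cnj f\<close> and the \<open>l\<close>-th power of the integral as a product
  of \<open>l\<close> integrals, one expands both: a choice of pairs of multi-indices at all positions \<open>(i,j)\<close> is a
  pair of matrices.
\<close>

lemma power_integral_poly:
  fixes a :: "nat ^ 'd \<Rightarrow> complex" and B :: "(nat ^ 'd) set"
  assumes B: "finite B"
  defines "f \<equiv> \<lambda>x. \<Sum>m\<in>B. a m * of_real (hermite_multi m (dilation_factor CARD('k::finite) *\<^sub>R x))"
  obtains r where "r \<ge> 0" "power_integral CARD('k) f ^ CARD('l::finite) = ennreal r"
    "complex_of_real r = (\<Sum>M\<in>matrices_over B. \<Sum>N\<in>matrices_over B.
       tensor a M * cnj (tensor a N) * of_real (P_kernel (M :: nat ^ 'd ^ 'k ^ 'l) N))"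
proof -
  let ?h = "\<lambda>m x. hermite_multi m (dilation_factor CARD('k) *\<^sub>R x)"
  define A where "A p = (\<Prod>j\<in>UNIV. a (fst (p $ j)) * cnj (a (snd (p $ j))))" for p :: "((nat ^ 'd) \<times> (nat ^ 'd)) ^ 'k"
  define G where "G p x = (\<Prod>j\<in>UNIV. ?h (fst (p $ j)) x * ?h (snd (p $ j)) x)" for p :: "((nat ^ 'd) \<times> (nat ^ 'd)) ^ 'k" and x
  let ?P = "{p :: ((nat ^ 'd) \<times> (nat ^ 'd)) ^ 'k. \<forall>j. p $ j \<in> B \<times> B}"
  have BB: "finite (B \<times> B)" using B by simp
  have finP: "finite ?P" by (rule finite_vec_set[OF BB])
  \<comment> \<open>A pair \<open>p\<close> consists of the index in \<open>f\<close> and the index in \<open>cnj f\<close>.\<close>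
  have f_sq: "f x * cnj (f x) = (\<Sum>p\<in>B \<times> B. a (fst p) * cnj (a (snd p)) * of_real (?h (fst p) x * ?h (snd p) x))" for x
    unfolding f_def cnj_sum sum_product sum.cartesian_product
    by (rule sum.cong) (auto simp: mult_ac)
  have pow: "complex_of_real (norm (f x) ^ (2 * CARD('k))) = (\<Sum>p\<in>?P. A p * of_real (G p x))" for x
  proof -
    have "complex_of_real (norm (f x) ^ (2 * CARD('k))) = (\<Prod>j\<in>(UNIV :: 'k set). f x * cnj (f x))"
      by (simp add: power_mult complex_norm_square[symmetric])
    also have "\<dots> = (\<Sum>p\<in>?P. \<Prod>j\<in>UNIV. a (fst (p $ j)) * cnj (a (snd (p $ j))) * of_real (?h (fst (p $ j)) x * ?h (snd (p $ j)) x))"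
      unfolding f_sq by (rule prod_sum_vec[OF BB])
    finally show ?thesis by (simp only: A_def G_def prod.distrib of_real_prod of_real_mult)
  qed
  have intG: "integrable gauss (G p)" for p
    using P_kernel_integrals(1)[where M = "\<chi> i j. fst (p $ j) :: nat ^ 'd ^ 'k ^ 'l" and N = "\<chi> i j. snd (p $ j)" and i = undefined]
    by (simp add: G_def[abs_def] dilation_factor_def)
  have intc: "integrable gauss (\<lambda>x. A p * complex_of_real (G p x))" for p
    by (intro integrable_mult_right integrable_of_real intG)
  have int2: "integrable gauss (\<lambda>x. complex_of_real (norm (f x) ^ (2 * CARD('k))))"
    unfolding pow by (intro Bochner_Integration.integrable_sum intc)
  then have "integrable gauss (\<lambda>x. Re (complex_of_real (norm (f x) ^ (2 * CARD('k)))))" by (rule integrable_Re)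
  then have int: "integrable gauss (\<lambda>x. norm (f x) ^ (2 * CARD('k)))" by (simp only: Re_complex_of_real)
  define I where "I = (\<integral>x. norm (f x) ^ (2 * CARD('k)) \<partial>gauss)"
  have I0: "I \<ge> 0" unfolding I_def by simp
  have power_integral: "power_integral CARD('k) f = ennreal I"
    unfolding power_integral_def I_def by (rule nn_integral_eq_integral[OF int]) simp
  have "complex_of_real I = (\<integral>x. complex_of_real (norm (f x) ^ (2 * CARD('k))) \<partial>gauss)"
    unfolding I_def by (rule integral_complex_of_real[symmetric])
  also have "\<dots> = (\<Sum>p\<in>?P. A p * of_real (\<integral>x. G p x \<partial>gauss))"
    unfolding pow by (simp only: Bochner_Integration.integral_sum intc integral_mult_right_zero integral_complex_of_real)
  finally have I: "complex_of_real I = (\<Sum>p\<in>?P. A p * of_real (\<integral>x. G p x \<partial>gauss))" .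
  have "complex_of_real (I ^ CARD('l)) = (\<Prod>i\<in>(UNIV :: 'l set). \<Sum>p\<in>?P. A p * of_real (\<integral>x. G p x \<partial>gauss))"
    by (simp add: I)
  also have "\<dots> = (\<Sum>q | \<forall>i :: 'l. q $ i \<in> ?P. \<Prod>i\<in>UNIV. A (q $ i) * of_real (\<integral>x. G (q $ i) x \<partial>gauss))"
    by (rule prod_sum_vec[OF finP])
  also have "\<dots> = (\<Sum>(M, N)\<in>matrices_over B \<times> matrices_over B. tensor a M * cnj (tensor a N) * of_real (P_kernel (M :: nat ^ 'd ^ 'k ^ 'l) N))"
  proof (rule sum.reindex_bij_witness[where i = "\<lambda>(M, N). \<chi> i j. (M $ i $ j, N $ i $ j)"
        and j = "\<lambda>q. (\<chi> i j. fst (q $ i $ j), \<chi> i j. snd (q $ i $ j))"], goal_cases)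
    case (5 q)
    let ?M = "\<chi> i j. fst (q $ i $ j) :: nat ^ 'd ^ 'k ^ 'l" and ?N = "\<chi> i j. snd (q $ i $ j) :: nat ^ 'd ^ 'k ^ 'l"
    have "P_kernel ?M ?N = (\<Prod>i\<in>UNIV. \<integral>x. G (q $ i) x \<partial>gauss)"
      unfolding P_kernel_integrals(2) G_def dilation_factor_def by simp
    moreover have "tensor a ?M * cnj (tensor a ?N) = (\<Prod>i\<in>UNIV. A (q $ i))"
      by (simp add: tensor_def A_def prod.distrib)
    ultimately show ?case by (simp add: prod.distrib)
  qed (auto simp: matrices_over_def vec_eq_iff mem_Times_iff)
  finally have "complex_of_real (I ^ CARD('l)) = (\<Sum>M\<in>matrices_over B. \<Sum>N\<in>matrices_over B.
       tensor a M * cnj (tensor a N) * of_real (P_kernel (M :: nat ^ 'd ^ 'k ^ 'l) N))"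
    by (simp only: sum.cartesian_product)
  then show ?thesis
    using that[of "I ^ CARD('l)"] I0 by (simp add: power_integral ennreal_power)
qed

lemma integral_phase:
  "(\<integral>t. indicator {-1/2..1/2} t *\<^sub>R (phase t a * cnj (phase t b)) \<partial>lborel) = (if a = b then 1 else 0)"
proof -
  define w where "w = 2 * of_real pi * \<i> * of_int (int a - int b)"
  have eq: "phase t a * cnj (phase t b) = exp (w * of_real t)" for t
    using phase_triple[of t a b 0] by (simp add: w_def phase_def[of _ 0])
  show ?thesis
  proof (cases "a = b")
    case True
    have "(\<integral>t. indicator {-1/2..1/2 :: real} t *\<^sub>R (1 :: complex) \<partial>lborel) = 1" by simp
    then show ?thesis unfolding eq using True by (simp add: w_def)
  next
    case False
    then have w: "w \<noteq> 0" by (simp add: w_def)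
    have "(\<integral>t. indicator {-1/2..1/2} t *\<^sub>R exp (w * of_real t) \<partial>lborel) =
        exp (w * of_real (1/2)) / w - exp (w * of_real (-1/2)) / w"
    proof (rule integral_FTC_atLeastAtMost)
      fix t :: real
      have "((\<lambda>z. exp (w * z) / w) has_field_derivative exp (w * of_real t)) (at (of_real t))"
        using w by (auto intro!: derivative_eq_intros)
      then show "((\<lambda>t. exp (w * of_real t) / w) has_vector_derivative exp (w * of_real t)) (at t within {-1/2..1/2})"
        by (rule has_vector_derivative_real_field)
    qed (auto intro!: continuous_intros)
    also have "exp (w * of_real (1/2)) = exp w * exp (w * of_real (-1/2))"
      unfolding exp_add[symmetric] by (simp add: field_simps)
    also have "exp w = 1" unfolding exp_eq_1 w_def by (auto intro!: exI[of _ "int a - int b"])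
    finally show ?thesis using False by (simp add: eq)
  qed
qed

lemma integrable_phase:
  "integrable lborel (\<lambda>t. indicator {-1/2..1/2 :: real} t *\<^sub>R (phase t a * cnj (phase t b)))"
proof (rule borel_integrable_compact)
  show "continuous_on {-1/2..1/2} (\<lambda>t. phase t a * cnj (phase t b))"
    unfolding phase_def by (intro continuous_intros)
qed simp

lemma P_block_double:
  fixes \<phi> :: "nat ^ 'd ^ 'k ^ 'l \<Rightarrow> complex"
  shows "P_block S \<phi> = (\<Sum>M | Mdeg M = S. \<Sum>N | Mdeg N = S. \<phi> M * cnj (\<phi> N) * of_real (P_kernel M N))"
  unfolding P_block_def
proof (rule sum.cong[OF refl])
  fix M :: "nat ^ 'd ^ 'k ^ 'l" assume "M \<in> {M. Mdeg M = S}"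
  then have M: "Mdeg M = S" by simp
  have "\<phi> M * cnj (P_op \<phi> M) * of_real (Mfact M) = \<phi> M * cnj (P_op \<phi> M * of_real (Mfact M))"
    by simp
  also have "\<dots> = (\<Sum>N | Mdeg N = S. \<phi> M * cnj (\<phi> N) * of_real (P_kernel M N))"
    unfolding P_op_scaled M by (simp add: sum_distrib_left mult.assoc)
  finally show "\<phi> M * cnj (P_op \<phi> M) * of_real (Mfact M) =
      (\<Sum>N | Mdeg N = S. \<phi> M * cnj (\<phi> N) * of_real (P_kernel M N))" .
qed

lemma mdeg_le_Mdeg: "mdeg (M $ i $ j) \<le> Mdeg M"
proof -
  have "mdeg (M $ i $ j) \<le> (\<Sum>j\<in>UNIV. mdeg (M $ i $ j))" by (rule member_le_sum) auto
  also have "\<dots> \<le> Mdeg M" unfolding Mdeg_def by (rule member_le_sum) auto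
  finally show ?thesis .
qed

lemma phase_sum: "finite A \<Longrightarrow> phase t (\<Sum>i\<in>A. f i) = (\<Prod>i\<in>A. phase t (f i))"
proof (induction rule: finite_induct)
  case empty
  show ?case by (simp add: phase_def)
next
  case (insert i A)
  have "phase t (a + b) = phase t a * phase t b" for a b
    unfolding phase_def by (simp add: exp_add[symmetric] algebra_simps)
  then show ?case using insert by simp
qed

lemma tensor_twist: "tensor (twist t c) M = phase t (Mdeg M) * tensor c M"
  by (simp add: tensor_def twist_def prod.distrib Mdeg_def phase_sum)

lemma represents_finite:
  assumes "\<And>m. c m \<noteq> 0 \<Longrightarrow> mdeg m < n"
  shows "represents k (dilated_sum (dilation_factor k) c n) c"
proof -
  have ext: "dilated_sum (dilation_factor k) c n' x = dilated_sum (dilation_factor k) c n x" if "n \<le> n'" for n' x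
    unfolding dilated_sum_def by (rule sum.mono_neutral_right) (use assms that in \<open>auto intro: le_less_trans\<close>)
  have "eventually (\<lambda>n'. 0 = L2_sq (\<lambda>x. dilated_sum (dilation_factor k) c n x - dilated_sum (dilation_factor k) c n' x)) sequentially"
    using eventually_ge_at_top[of n]
  proof eventually_elim
    case (elim n')
    show ?case by (simp add: ext[OF elim])
  qed
  then show ?thesis unfolding represents_def by (intro conjI dilated_sum_measurable Lim_transform_eventually[OF tendsto_const])
qed

lemma ell2_finite:
  assumes "\<And>m. c m \<noteq> 0 \<Longrightarrow> mdeg m < n"
  shows "ell2 c"
  unfolding ell2_def
proof (rule summable_finite[of "{..<n}"])
  fix j assume "j \<notin> {..<n}"
  then have "c m = 0" if "mdeg m = j" for m using assms[of m] that by auto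
  then show "degree_weight c j = 0" by (auto simp: degree_weight_def)
qed simp

text \<open>
  Rotation multiplies the term of \<open>(M,N)\<close> by the character of frequency \<open>|M| - |N|\<close>, and integration
  over a period leaves the blocks with \<open>|M| = |N|\<close>.
\<close>

lemma energy_finite:
  fixes c :: "nat ^ 'd \<Rightarrow> complex"
  assumes k: "CARD('k::finite) \<ge> 2" and c: "\<And>m. c m \<noteq> 0 \<Longrightarrow> mdeg m < n"
  shows "energy CARD('k) CARD('l::finite) c = P_form (tensor c :: nat ^ 'd ^ 'k ^ 'l \<Rightarrow> complex)"
proof -
  let ?k = "CARD('k)" and ?l = "CARD('l)"
  have k1: "?k \<ge> 1" using k by simp
  define B where "B = {m :: nat ^ 'd. mdeg m < n}"
  have B: "finite B" by (simp add: B_def)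
  let ?\<phi> = "tensor c :: nat ^ 'd ^ 'k ^ 'l \<Rightarrow> complex"
  define K where "K M N = ?\<phi> M * cnj (?\<phi> N) * of_real (P_kernel M N)" for M N
  let ?Ms = "matrices_over B :: (nat ^ 'd ^ 'k ^ 'l) set"
  have finMs: "finite ?Ms" by (rule finite_matrices_over[OF B])
  \<comment> \<open>The integrand at time \<open>t\<close>, a trigonometric polynomial with nonnegative values.\<close>
  define W where "W t = (\<Sum>M\<in>?Ms. \<Sum>N\<in>?Ms. K M N * (phase t (Mdeg M) * cnj (phase t (Mdeg N))))" for t
  have power_integral: "Re (W t) \<ge> 0 \<and> power_integral ?k (series_sum ?k (twist t c)) ^ ?l = ennreal (Re (W t)) \<and> complex_of_real (Re (W t)) = W t" for t
  proof -
    have ct: "twist t c m \<noteq> 0 \<Longrightarrow> mdeg m < n" for m using c by (auto simp: twist_def)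
    have "AE x in gauss. series_sum ?k (twist t c) x = dilated_sum (dilation_factor ?k) (twist t c) n x"
      by (rule represents_unique[OF k1 represents_series_sum[OF k1 ell2_finite[OF ct]] represents_finite[OF ct] ell2_finite[OF ct]])
    then have A: "power_integral ?k (series_sum ?k (twist t c)) = power_integral ?k (\<lambda>x. \<Sum>m\<in>B. twist t c m * of_real (hermite_multi m (dilation_factor ?k *\<^sub>R x)))"
      unfolding dilated_sum_def B_def by (rule power_integral_cong_AE)
    obtain r where r: "r \<ge> 0" "power_integral ?k (\<lambda>x. \<Sum>m\<in>B. twist t c m * of_real (hermite_multi m (dilation_factor ?k *\<^sub>R x))) ^ ?l = ennreal r"
      "complex_of_real r = (\<Sum>M\<in>?Ms. \<Sum>N\<in>?Ms. tensor (twist t c) M * cnj (tensor (twist t c) N) * of_real (P_kernel M N))"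
      by (rule power_integral_poly[OF B])
    have "complex_of_real r = W t"
      unfolding r(3) W_def K_def tensor_twist by (simp add: mult_ac)
    then have "W t = complex_of_real r" by simp
    then show ?thesis using r(1,2) unfolding A by simp
  qed
  have int: "integrable lborel (\<lambda>t. K M N * (indicator {-1/2..1/2} t *\<^sub>R (phase t (Mdeg M) * cnj (phase t (Mdeg N)))))" for M N
    by (intro integrable_mult_right integrable_phase)
  have Weq: "indicator {-1/2..1/2} t *\<^sub>R W t =
      (\<Sum>M\<in>?Ms. \<Sum>N\<in>?Ms. K M N * (indicator {-1/2..1/2} t *\<^sub>R (phase t (Mdeg M) * cnj (phase t (Mdeg N)))))" for t
    unfolding W_def by (simp add: scaleR_sum_right)
  have intW: "integrable lborel (\<lambda>t. indicator {-1/2..1/2} t *\<^sub>R W t)"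
    unfolding Weq by (intro Bochner_Integration.integrable_sum int)
  have "(\<integral>t. indicator {-1/2..1/2} t *\<^sub>R W t \<partial>lborel) =
      (\<Sum>M\<in>?Ms. \<Sum>N\<in>?Ms. K M N * (if Mdeg M = Mdeg N then 1 else 0))"
    unfolding Weq by (simp only: Bochner_Integration.integral_sum Bochner_Integration.integrable_sum int
        integral_mult_right_zero integral_phase)
  also have "\<dots> = (\<Sum>M\<in>?Ms. \<Sum>N\<in>{N\<in>?Ms. Mdeg N = Mdeg M}. K M N)"
    by (intro sum.cong refl sum.mono_neutral_cong_right) (auto intro: finMs)
  finally have W_int: "(\<integral>t. indicator {-1/2..1/2} t *\<^sub>R W t \<partial>lborel) =
      (\<Sum>M\<in>?Ms. \<Sum>N\<in>{N\<in>?Ms. Mdeg N = Mdeg M}. K M N)" .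
  have K0: "K M N = 0" if "M \<notin> ?Ms \<or> N \<notin> ?Ms" for M N
  proof -
    have "?\<phi> M = 0" if "M \<notin> ?Ms" for M
    proof -
      note M = that
      obtain i j where "M $ i $ j \<notin> B" using M unfolding matrices_over_def by blast
      then have "c (M $ i $ j) = 0" using c by (auto simp: B_def)
      then show ?thesis unfolding tensor_def by (intro prod_zero) (auto intro: prod_zero)
    qed
    then show ?thesis using that by (auto simp: K_def)
  qed
  define D where "D = Suc (\<Sum>M\<in>?Ms. Mdeg M)"
  have D: "Mdeg M < D" if "M \<in> ?Ms" for M
    unfolding D_def using member_le_sum[OF that, of Mdeg] finMs by simp
  have block: "P_block S ?\<phi> = (\<Sum>M\<in>{M\<in>?Ms. Mdeg M = S}. \<Sum>N\<in>{N\<in>?Ms. Mdeg N = Mdeg M}. K M N)" for S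
    unfolding P_block_double K_def[symmetric]
  proof (rule sum.mono_neutral_cong_right)
    fix M assume "M \<in> {M\<in>?Ms. Mdeg M = S}"
    then show "(\<Sum>N | Mdeg N = S. K M N) = (\<Sum>N\<in>{N\<in>?Ms. Mdeg N = Mdeg M}. K M N)"
      by (intro sum.mono_neutral_right) (use K0[of M] in auto)
  next
    show "\<forall>M\<in>{M. Mdeg M = S} - {M \<in> ?Ms. Mdeg M = S}. (\<Sum>N | Mdeg N = S. K M N) = 0"
      by (intro ballI sum.neutral) (use K0 in auto)
  qed auto
  have total: "(\<Sum>M\<in>?Ms. \<Sum>N\<in>{N\<in>?Ms. Mdeg N = Mdeg M}. K M N) = (\<Sum>S<D. P_block S ?\<phi>)"
    unfolding block by (rule sum.group[symmetric]) (use finMs D in auto)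
  have "energy ?k ?l c = (\<integral>\<^sup>+t. ennreal (indicator {-1/2..1/2} t * Re (W t)) \<partial>lborel)"
    unfolding energy_def using power_integral by (intro nn_integral_cong) (auto split: split_indicator)
  also have "\<dots> = ennreal (\<integral>t. indicator {-1/2..1/2} t * Re (W t) \<partial>lborel)"
    using integrable_Re[OF intW] power_integral by (intro nn_integral_eq_integral) auto
  also have "(\<integral>t. indicator {-1/2..1/2} t * Re (W t) \<partial>lborel) = Re (\<integral>t. indicator {-1/2..1/2} t *\<^sub>R W t \<partial>lborel)"
    using integral_Re[OF intW] by simp
  also have "\<dots> = (\<Sum>S<D. Re (P_block S ?\<phi>))"
    unfolding W_int total by simp
  also have "ennreal \<dots> = (\<Sum>S<D. ennreal (Re (P_block S ?\<phi>)))"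
    by (rule sum_ennreal[symmetric]) (rule P_block_nonneg[OF k refl])
  also have "\<dots> = P_form ?\<phi>"
    unfolding P_form_def
  proof (rule suminf_finite[symmetric])
    fix S assume "S \<notin> {..<D}"
    then have "{M\<in>?Ms. Mdeg M = S} = {}" using D by auto
    then show "ennreal (Re (P_block S ?\<phi>)) = 0" unfolding block by (simp only: sum.empty) simp
  qed simp
  finally show ?thesis .
qed

section \<open>Tensor powers of square summable sequences\<close>

lemma has_sum_exhaustion:
  fixes f :: "'x \<Rightarrow> real"
  assumes nn: "\<And>x. f x \<ge> 0" and fin: "\<And>n. finite (A n)" and ex: "\<And>x. eventually (\<lambda>n. x \<in> A n) sequentially"
    and lim: "(\<lambda>n. sum f (A n)) \<longlonglongrightarrow> L"
  shows "(f has_sum L) UNIV"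
proof -
  have sub: "eventually (\<lambda>n. F \<subseteq> A n) sequentially" if "finite F" for F
    using eventually_ball_finite[OF that, of "\<lambda>n x. x \<in> A n"] ex by (simp add: subset_eq)
  have le: "sum f F \<le> L" if "finite F" for F
  proof (rule tendsto_lowerbound[OF lim])
    show "eventually (\<lambda>n. sum f F \<le> sum f (A n)) sequentially"
      using sub[OF that] by eventually_elim (auto intro!: sum_mono2 fin nn)
  qed simp
  have "f summable_on UNIV"
    by (rule nonneg_bdd_above_summable_on) (auto intro!: bdd_aboveI2 le nn)
  then have hs: "(f has_sum infsum f UNIV) UNIV" by simp
  have "filterlim A (finite_subsets_at_top UNIV) sequentially"
    unfolding filterlim_def le_filter_def eventually_filtermap
  proof (intro allI impI)
    fix P assume "eventually P (finite_subsets_at_top (UNIV :: 'x set))"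
    then obtain X where X: "finite X" "\<And>Y. finite Y \<Longrightarrow> X \<subseteq> Y \<Longrightarrow> P Y"
      unfolding eventually_finite_subsets_at_top by auto
    show "eventually (\<lambda>n. P (A n)) sequentially"
      using sub[OF X(1)] by eventually_elim (rule X(2)[OF fin])
  qed
  from filterlim_compose[OF hs[unfolded has_sum_def] this]
  have "infsum f UNIV = L" by (rule LIMSEQ_unique[OF _ lim])
  then show ?thesis using hs by simp
qed

text \<open>
  The weight of a tensor is a product over the positions, so its sum over matrices with entries of
  degree less than \<open>n\<close> is a power of a partial sum. These sets of matrices, rather than the sets of
  matrices of bounded total degree, factorize.
\<close>

lemma tensor_has_sum:
  fixes c :: "nat ^ 'd \<Rightarrow> complex"
  assumes "degree_weight c sums s"
  shows "((\<lambda>M. (norm (tensor c M))\<^sup>2 * Mfact (M :: nat ^ 'd ^ 'k ^ 'l)) has_sum s ^ (CARD('k) * CARD('l))) UNIV"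
proof (rule has_sum_exhaustion)
  let ?B = "\<lambda>n. {m :: nat ^ 'd. mdeg m < n}"
  show "0 \<le> (norm (tensor c M))\<^sup>2 * Mfact M" for M :: "nat ^ 'd ^ 'k ^ 'l"
    using Mfact_pos[of M] by simp
  show "finite (matrices_over (?B n) :: (nat ^ 'd ^ 'k ^ 'l) set)" for n by (rule finite_matrices_over) simp
  show "eventually (\<lambda>n. M \<in> matrices_over (?B n)) sequentially" for M :: "nat ^ 'd ^ 'k ^ 'l"
    using eventually_gt_at_top[of "Mdeg M"]
    by eventually_elim (auto simp: matrices_over_def intro: le_less_trans[OF mdeg_le_Mdeg])
  have eq: "(norm (tensor c M))\<^sup>2 * Mfact M = (\<Prod>i\<in>UNIV. \<Prod>j\<in>UNIV. (norm (c (M $ i $ j)))\<^sup>2 * multi_fact (M $ i $ j))"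
    for M :: "nat ^ 'd ^ 'k ^ 'l"
    by (simp add: tensor_def Mfact_def multi_fact_def prod.distrib prod_power_distrib prod_norm[symmetric])
  have "(\<lambda>n. (\<Sum>j<n. degree_weight c j) ^ (CARD('k) * CARD('l))) \<longlonglongrightarrow> s ^ (CARD('k) * CARD('l))"
    using assms unfolding sums_def by (intro tendsto_power)
  then show "(\<lambda>n. \<Sum>M\<in>(matrices_over (?B n) :: (nat ^ 'd ^ 'k ^ 'l) set). (norm (tensor c M))\<^sup>2 * Mfact M) \<longlonglongrightarrow> s ^ (CARD('k) * CARD('l))"
    unfolding eq sum_matrices_over_prod[OF finite_mdeg_less, where u = "\<lambda>m. (norm (c m))\<^sup>2 * multi_fact m"] sum_mdeg_less degree_weight_def .
qed

lemma tensor_F_space: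
  fixes c :: "nat ^ 'd \<Rightarrow> complex"
  assumes "degree_weight c sums s"
  shows "(tensor c :: nat ^ 'd ^ 'k ^ 'l \<Rightarrow> complex) \<in> F_space"
    and "(F_norm (tensor c :: nat ^ 'd ^ 'k ^ 'l \<Rightarrow> complex))\<^sup>2 = s ^ (CARD('k) * CARD('l))"
proof -
  note hs = tensor_has_sum[OF assms, where 'k = 'k and 'l = 'l]
  show "(tensor c :: nat ^ 'd ^ 'k ^ 'l \<Rightarrow> complex) \<in> F_space"
    unfolding F_space_def using has_sum_imp_summable[OF hs] by simp
  have "s \<ge> 0" by (rule sums_le[OF degree_weight_nonneg sums_zero assms])
  then show "(F_norm (tensor c :: nat ^ 'd ^ 'k ^ 'l \<Rightarrow> complex))\<^sup>2 = s ^ (CARD('k) * CARD('l))"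
    unfolding F_norm_def infsumI[OF hs] by simp
qed

section \<open>The energy equals the quadratic form\<close>

text \<open>
  The Fejer means of \<open>c\<close> are finite, so \<open>energy_finite\<close> applies to them, and their energy is at most that
  of \<open>c\<close>. A fixed number of blocks depends continuously on \<open>c\<close> and survives the limit \<open>N \<rightarrow> \<infinity>\<close>.
\<close>

lemma P_form_le_energy:
  fixes c :: "nat ^ 'd \<Rightarrow> complex"
  assumes k: "CARD('k::finite) \<ge> 2" and c: "ell2 c"
  shows "P_form (tensor c :: nat ^ 'd ^ 'k ^ 'l::finite \<Rightarrow> complex) \<le> energy CARD('k) CARD('l) c"
proof -
  let ?k = "CARD('k)" and ?l = "CARD('l)"
  let ?\<phi> = "\<lambda>N. (tensor (degree_mult (fejer N) c) :: nat ^ 'd ^ 'k ^ 'l \<Rightarrow> complex)"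
  let ?\<psi> = "tensor c :: nat ^ 'd ^ 'k ^ 'l \<Rightarrow> complex"
  have fejer_1: "(\<lambda>N. fejer N j) \<longlonglongrightarrow> 1" for j
  proof (rule Lim_transform_eventually)
    show "(\<lambda>N. complex_of_real (1 - real j / real N)) \<longlonglongrightarrow> 1"
    proof -
      have "(\<lambda>N. 1 - real j / real N) \<longlonglongrightarrow> 1" by real_asymp
      then have "(\<lambda>N. complex_of_real (1 - real j / real N)) \<longlonglongrightarrow> complex_of_real 1" by (rule tendsto_of_real)
      then show ?thesis by simp
    qed
    show "eventually (\<lambda>N. complex_of_real (1 - real j / real N) = fejer N j) sequentially"
      using eventually_gt_at_top[of j]
      by eventually_elim (simp add: fejer_def field_simps of_nat_diff)
  qed
  have tens: "(\<lambda>N. ?\<phi> N M) \<longlonglongrightarrow> ?\<psi> M" for M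
  proof -
    have "(\<lambda>N. \<Prod>i\<in>UNIV. \<Prod>j\<in>UNIV. fejer N (mdeg (M $ i $ j)) * c (M $ i $ j)) \<longlonglongrightarrow>
        (\<Prod>i\<in>UNIV. \<Prod>j\<in>UNIV. 1 * c (M $ i $ j))"
      by (intro tendsto_prod tendsto_mult fejer_1 tendsto_const)
    then show ?thesis by (simp add: tensor_def degree_mult_def)
  qed
  have block: "(\<lambda>N. ennreal (Re (P_block S (?\<phi> N)))) \<longlonglongrightarrow> ennreal (Re (P_block S ?\<psi>))" for S
    unfolding P_block_double by (intro tendsto_intros tens)
  have fejer_energy: "P_form (?\<phi> N) \<le> energy ?k ?l c" if "N \<ge> 1" for N
  proof -
    have "energy ?k ?l (degree_mult (fejer N) c) = P_form (?\<phi> N)"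
    proof (rule energy_finite[OF k])
      fix m assume "degree_mult (fejer N) c m \<noteq> 0"
      then show "mdeg m < N" by (auto simp: degree_mult_def fejer_def split: if_splits)
    qed
    then show ?thesis using energy_fejer_le[OF _ _ c that, of ?k ?l] k by simp
  qed
  have "(\<Sum>S<n. ennreal (Re (P_block S ?\<psi>))) \<le> energy ?k ?l c" for n
  proof (rule LIMSEQ_le_const2)
    show "(\<lambda>N. \<Sum>S<n. ennreal (Re (P_block S (?\<phi> N)))) \<longlonglongrightarrow> (\<Sum>S<n. ennreal (Re (P_block S ?\<psi>)))"
      by (intro tendsto_sum block)
    show "\<exists>N0. \<forall>N\<ge>N0. (\<Sum>S<n. ennreal (Re (P_block S (?\<phi> N)))) \<le> energy ?k ?l c"
    proof (intro exI[of _ 1] allI impI)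
      fix N :: nat assume "N \<ge> 1"
      have "(\<Sum>S<n. ennreal (Re (P_block S (?\<phi> N)))) \<le> P_form (?\<phi> N)"
        unfolding P_form_def by (rule sum_le_suminf) auto
      also have "\<dots> \<le> energy ?k ?l c" by (rule fejer_energy[OF \<open>N \<ge> 1\<close>])
      finally show "(\<Sum>S<n. ennreal (Re (P_block S (?\<phi> N)))) \<le> energy ?k ?l c" .
    qed
  qed
  then show ?thesis unfolding P_form_def suminf_eq_SUP by (intro SUP_least)
qed

text \<open>
  The norms of the blocks grow polynomially.
\<close>

lemma eigenvalue_times_exp_tendsto_0:
  assumes "\<mu> > 0" "\<delta> > 0"
  shows "(\<lambda>S. max 1 (eigenvalue \<mu> (S div 2)) * (exp (- \<delta> * real S))\<^sup>2) \<longlonglongrightarrow> 0"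
proof -
  define K where "K = 2 powr (\<mu> - 1) * Gamma \<mu>"
  have K: "K > 0" using assms(1) by (simp add: K_def Gamma_real_pos)
  have "(\<lambda>S. real S powr (\<mu> - 1) / K * (exp (- \<delta> * real S))\<^sup>2) \<longlonglongrightarrow> 0"
    using assms(2) K by real_asymp
  moreover have "(\<lambda>S. eigenvalue \<mu> (S div 2) * (exp (- \<delta> * real S))\<^sup>2) \<sim>[sequentially]
      (\<lambda>S. real S powr (\<mu> - 1) / K * (exp (- \<delta> * real S))\<^sup>2)"
    unfolding K_def by (intro asymp_equiv_mult eigenvalue_half_asymp assms asymp_equiv_refl)
  ultimately have 1: "(\<lambda>S. eigenvalue \<mu> (S div 2) * (exp (- \<delta> * real S))\<^sup>2) \<longlonglongrightarrow> 0"
    by (simp only: tendsto_asymp_equiv_cong)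
  have 2: "(\<lambda>S. (exp (- \<delta> * real S))\<^sup>2) \<longlonglongrightarrow> 0" using assms(2) by real_asymp
  have "(\<lambda>S. (exp (- \<delta> * real S))\<^sup>2 + eigenvalue \<mu> (S div 2) * (exp (- \<delta> * real S))\<^sup>2) \<longlonglongrightarrow> 0 + 0"
    by (intro tendsto_add 1 2)
  moreover have pos: "eigenvalue \<mu> p > 0" for p
    unfolding eigenvalue_def using assms(1) by (simp add: pochhammer_pos)
  have "max 1 (eigenvalue \<mu> (S div 2)) * (exp (- \<delta> * real S))\<^sup>2 \<le>
      (1 + eigenvalue \<mu> (S div 2)) * (exp (- \<delta> * real S))\<^sup>2" for S
    by (intro mult_right_mono) (use pos[of "S div 2"] in auto)
  then have "eventually (\<lambda>S. norm (max 1 (eigenvalue \<mu> (S div 2)) * (exp (- \<delta> * real S))\<^sup>2) \<le>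
      (exp (- \<delta> * real S))\<^sup>2 + eigenvalue \<mu> (S div 2) * (exp (- \<delta> * real S))\<^sup>2) sequentially"
    by (intro always_eventually allI) (simp add: abs_mult distrib_right)
  ultimately show ?thesis by (simp only: add_0_left) (rule Lim_null_comparison)
qed

text \<open>
  Truncating \<open>c\<close> at degree \<open>n\<close> leaves the blocks below \<open>n\<close> unchanged but cuts through the higher
  ones, where the form could increase. With the additional weights \<open>e\<close> to the \<open>- \<delta> j\<close> a block of
  degree \<open>S\<close> carries the factor \<open>e\<close> to the \<open>- 2 \<delta> S\<close>, which compensates the norm of the operator on it, so the
  damaged blocks contribute little for large \<open>n\<close>. Lower semicontinuity removes first the truncation
  and then the damping.
\<close>

lemma energy_le_P_form:
  fixes c :: "nat ^ 'd \<Rightarrow> complex"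
  assumes k: "CARD('k::finite) \<ge> 2" and c: "ell2 c"
  shows "energy CARD('k) CARD('l) c \<le> P_form (tensor c :: nat ^ 'd ^ 'k ^ 'l::finite \<Rightarrow> complex)"
proof -
  let ?k = "CARD('k)" and ?l = "CARD('l)"
  define \<mu> where "\<mu> = (real CARD('k) - 1) * real CARD('l) * real CARD('d) / 2"
  have k1: "?k \<ge> 1" using k by simp
  let ?\<phi> = "tensor c :: nat ^ 'd ^ 'k ^ 'l \<Rightarrow> complex"
  have "degree_weight c sums (\<Sum>j. degree_weight c j)" using c by (simp add: ell2_def summable_sums)
  from tensor_F_space(1)[OF this, where 'k = 'k and 'l = 'l]
  have F: "?\<phi> \<in> F_space" .
  define T where "T = (F_norm ?\<phi>)\<^sup>2"
  have T: "(\<lambda>S. deg_nsq S ?\<phi>) sums T" unfolding T_def by (rule F_space_norm[OF F])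
  have T0: "T \<ge> 0" by (simp add: T_def)
  have damp: "energy ?k ?l (degree_mult (\<lambda>j. of_real (exp (- \<delta> * real j))) c) \<le> P_form ?\<phi>" if \<delta>: "\<delta> > 0" for \<delta>
  proof (rule ennreal_le_epsilon)
    fix e :: real assume e: "0 < e"
    \<comment> \<open>The total error \<open>\<epsilon> T\<close> has to stay below \<open>e\<close>; the term \<open>+ 1\<close> covers \<open>T = 0\<close>.\<close>
    define \<epsilon> where "\<epsilon> = e / (T + 1)"
    have \<epsilon>: "\<epsilon> > 0" "\<epsilon> * T \<le> e" using e T0 by (simp_all add: \<epsilon>_def field_simps)
    define b where "b n j = (if j < n then complex_of_real (exp (- \<delta> * real j)) else 0)" for n j
    have "eventually (\<lambda>S. max 1 (eigenvalue \<mu> (S div 2)) * (exp (- \<delta> * real S))\<^sup>2 < \<epsilon>) sequentially"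
      using order_tendstoD(2)[OF eigenvalue_times_exp_tendsto_0[OF mu_gt_0[OF k \<mu>_def] \<delta>] \<epsilon>(1)] .
    then obtain n0 where n0: "\<And>S. S \<ge> n0 \<Longrightarrow> max 1 (eigenvalue \<mu> (S div 2)) * (exp (- \<delta> * real S))\<^sup>2 < \<epsilon>"
      by (auto simp: eventually_sequentially)
    have le: "energy ?k ?l (degree_mult (b n) c) \<le> P_form ?\<phi> + ennreal e" if n: "n \<ge> n0" for n
    proof -
      let ?\<psi> = "tensor (degree_mult (b n) c) :: nat ^ 'd ^ 'k ^ 'l \<Rightarrow> complex"
      have "energy ?k ?l (degree_mult (b n) c) = P_form ?\<psi>"
      proof (rule energy_finite[OF k])
        fix m :: "nat ^ 'd" assume "degree_mult (b n) c m \<noteq> 0"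
        then show "mdeg m < n" by (simp add: degree_mult_def b_def split: if_splits)
      qed
      also have "\<dots> \<le> (\<Sum>S. ennreal (Re (P_block S ?\<phi>)) + ennreal (\<epsilon> * deg_nsq S ?\<phi>))"
        unfolding P_form_def
      proof (intro suminf_le summableI)
        fix S
        have exp_prod: "(\<Prod>i\<in>UNIV. \<Prod>j\<in>UNIV. exp (- \<delta> * real (mdeg (M $ i $ j)))) = exp (- \<delta> * real (Mdeg M))"
          for M :: "nat ^ 'd ^ 'k ^ 'l"
          by (simp add: exp_sum[symmetric] Mdeg_def sum_distrib_left)
        have "Re (P_block S ?\<psi>) \<le> Re (P_block S ?\<phi>) + \<epsilon> * deg_nsq S ?\<phi>"
        \<comment> \<open>For \<open>S < n\<close> no entry of a matrix of degree \<open>S\<close> is cut off.\<close>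
        proof (cases "S < n")
          case True
          have eq: "?\<psi> M = of_real (exp (- \<delta> * real S)) * ?\<phi> M" if "Mdeg M = S" for M
          proof -
            have "mdeg (M $ i $ j) < n" for i j
              using mdeg_le_Mdeg[of M i j] that True by simp
            then have "?\<psi> M = (\<Prod>i\<in>UNIV. \<Prod>j\<in>UNIV. complex_of_real (exp (- \<delta> * real (mdeg (M $ i $ j))))) * ?\<phi> M"
              by (simp add: tensor_def degree_mult_def b_def prod.distrib)
            also have "(\<Prod>i\<in>UNIV. \<Prod>j\<in>UNIV. complex_of_real (exp (- \<delta> * real (mdeg (M $ i $ j))))) = of_real (exp (- \<delta> * real S))"
              using exp_prod[of M] that by (simp only: of_real_prod[symmetric])
            finally show ?thesis .
          qed
          have "P_block S ?\<psi> = of_real ((exp (- \<delta> * real S))\<^sup>2) * P_block S ?\<phi>"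
            unfolding P_block_double sum_distrib_left
            by (intro sum.cong refl) (simp add: eq power2_eq_square mult_ac)
          then have "Re (P_block S ?\<psi>) = (exp (- \<delta> * real S))\<^sup>2 * Re (P_block S ?\<phi>)" by simp
          also have "\<dots> \<le> 1 * Re (P_block S ?\<phi>)"
            using P_block_nonneg[OF k \<mu>_def, of S ?\<phi>] \<delta>
            by (intro mult_right_mono) (auto simp: power_le_one)
          also have "\<dots> \<le> Re (P_block S ?\<phi>) + \<epsilon> * deg_nsq S ?\<phi>"
            using \<epsilon> deg_nsq_nonneg[of S ?\<phi>] by simp
          finally show ?thesis .
        next
          case False
          \<comment> \<open>A block beyond the cutoff is only bounded by the norm of the operator.\<close>
          have "deg_nsq S ?\<psi> \<le> (exp (- \<delta> * real S))\<^sup>2 * deg_nsq S ?\<phi>"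
            unfolding deg_nsq_def sum_distrib_left
          proof (rule sum_mono)
            fix M :: "nat ^ 'd ^ 'k ^ 'l" assume "M \<in> {M. Mdeg M = S}"
            then have M: "Mdeg M = S" by simp
            have "norm (?\<psi> M) = (\<Prod>i\<in>UNIV. \<Prod>j\<in>UNIV. norm (b n (mdeg (M $ i $ j)))) * norm (?\<phi> M)"
              by (simp add: tensor_def degree_mult_def norm_mult prod_norm[symmetric] prod.distrib)
            also have "\<dots> \<le> exp (- \<delta> * real S) * norm (?\<phi> M)"
              unfolding M[symmetric] exp_prod[symmetric]
              by (intro mult_right_mono prod_mono conjI prod_nonneg) (auto simp: b_def)
            finally have "(norm (?\<psi> M))\<^sup>2 \<le> (exp (- \<delta> * real S) * norm (?\<phi> M))\<^sup>2" by (intro power_mono) auto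
            then have "(norm (?\<psi> M))\<^sup>2 * Mfact M \<le> (exp (- \<delta> * real S) * norm (?\<phi> M))\<^sup>2 * Mfact M"
              by (rule mult_right_mono) (simp add: less_imp_le[OF Mfact_pos])
            then show "(norm (?\<psi> M))\<^sup>2 * Mfact M \<le> (exp (- \<delta> * real S))\<^sup>2 * ((norm (?\<phi> M))\<^sup>2 * Mfact M)"
              by (simp add: power_mult_distrib mult.assoc)
          qed
          then have "max 1 (eigenvalue \<mu> (S div 2)) * deg_nsq S ?\<psi> \<le>
              max 1 (eigenvalue \<mu> (S div 2)) * ((exp (- \<delta> * real S))\<^sup>2 * deg_nsq S ?\<phi>)"
            by (rule mult_left_mono) simp
          also have "\<dots> = max 1 (eigenvalue \<mu> (S div 2)) * (exp (- \<delta> * real S))\<^sup>2 * deg_nsq S ?\<phi>"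
            by (simp only: mult.assoc)
          also have "\<dots> \<le> \<epsilon> * deg_nsq S ?\<phi>"
            using n0[of S] False n by (intro mult_right_mono deg_nsq_nonneg) auto
          finally have "max 1 (eigenvalue \<mu> (S div 2)) * deg_nsq S ?\<psi> \<le> \<epsilon> * deg_nsq S ?\<phi>" .
          then show ?thesis
            using P_block_le[OF k \<mu>_def, of S ?\<psi>] P_block_nonneg[OF k \<mu>_def, of S ?\<phi>] by linarith
        qed
        then have "ennreal (Re (P_block S ?\<psi>)) \<le> ennreal (Re (P_block S ?\<phi>) + \<epsilon> * deg_nsq S ?\<phi>)"
          by (rule ennreal_leI)
        also have "\<dots> = ennreal (Re (P_block S ?\<phi>)) + ennreal (\<epsilon> * deg_nsq S ?\<phi>)"
          using P_block_nonneg[OF k \<mu>_def, of S ?\<phi>] deg_nsq_nonneg[of S ?\<phi>] \<epsilon>(1) by (intro ennreal_plus) auto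
        finally show "ennreal (Re (P_block S ?\<psi>)) \<le> ennreal (Re (P_block S ?\<phi>)) + ennreal (\<epsilon> * deg_nsq S ?\<phi>)" .
      qed
      also have "\<dots> = P_form ?\<phi> + (\<Sum>S. ennreal (\<epsilon> * deg_nsq S ?\<phi>))"
        unfolding P_form_def by (rule suminf_add[symmetric]) auto
      also have "(\<Sum>S. ennreal (\<epsilon> * deg_nsq S ?\<phi>)) = ennreal (\<epsilon> * T)"
      proof -
        have "0 \<le> \<epsilon> * deg_nsq S ?\<phi>" for S
          using \<epsilon>(1) by (intro mult_nonneg_nonneg deg_nsq_nonneg) simp
        then show ?thesis
          using sums_mult[OF T, of \<epsilon>] by (simp only: suminf_ennreal2 sums_iff)
      qed
      also have "P_form ?\<phi> + ennreal (\<epsilon> * T) \<le> P_form ?\<phi> + ennreal e"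
        by (intro add_left_mono ennreal_leI \<epsilon>)
      finally show ?thesis .
    qed
    have nb: "norm (b n j) \<le> 1" "norm (complex_of_real (exp (- \<delta> * real j))) \<le> 1" for n j
      using \<delta> by (auto simp: b_def)
    have "energy ?k ?l (degree_mult (\<lambda>j. of_real (exp (- \<delta> * real j))) c) \<le> liminf (\<lambda>n. energy ?k ?l (degree_mult (b n) c))"
    proof (rule energy_lsc[OF k1 c _ nb])
      fix j
      show "(\<lambda>n. b n j) \<longlonglongrightarrow> complex_of_real (exp (- \<delta> * real j))"
      proof (rule tendsto_eventually)
        show "eventually (\<lambda>n. b n j = complex_of_real (exp (- \<delta> * real j))) sequentially"
          using eventually_gt_at_top[of j] by eventually_elim (simp add: b_def)
      qed
    qed
    also have "\<dots> \<le> P_form ?\<phi> + ennreal e"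
    proof (rule Liminf_le)
      show "eventually (\<lambda>n. energy ?k ?l (degree_mult (b n) c) \<le> P_form ?\<phi> + ennreal e) sequentially"
        using eventually_ge_at_top[of n0] by eventually_elim (rule le)
    qed simp
    finally show "energy ?k ?l (degree_mult (\<lambda>j. of_real (exp (- \<delta> * real j))) c) \<le> P_form ?\<phi> + ennreal e" .
  qed
  \<comment> \<open>The choice \<open>\<delta> = 1/(n + 1)\<close> removes the damping.\<close>
  let ?r = "\<lambda>n j. complex_of_real (exp (- (1 / real (Suc n)) * real j))"
  have "energy ?k ?l (degree_mult (\<lambda>j. 1) c) \<le> liminf (\<lambda>n. energy ?k ?l (degree_mult (?r n) c))"
  proof (rule energy_lsc[OF k1 c, where B = 1])
    fix j
    have "(\<lambda>n. exp (- (1 / real (Suc n)) * real j)) \<longlonglongrightarrow> 1" by real_asymp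
    then have "(\<lambda>n. ?r n j) \<longlonglongrightarrow> complex_of_real 1" by (rule tendsto_of_real)
    then show "(\<lambda>n. ?r n j) \<longlonglongrightarrow> 1" by simp
  qed auto
  also have "\<dots> \<le> P_form ?\<phi>"
    by (intro Liminf_le always_eventually allI damp) auto
  finally show ?thesis by (simp add: degree_mult_def[abs_def])
qed

lemma energy_eq_P_form:
  fixes c :: "nat ^ 'd \<Rightarrow> complex"
  assumes "CARD('k::finite) \<ge> 2" "ell2 c"
  shows "energy CARD('k) CARD('l) c = P_form (tensor c :: nat ^ 'd ^ 'k ^ 'l::finite \<Rightarrow> complex)"
  using energy_le_P_form[OF assms] P_form_le_energy[OF assms] by (rule antisym)

text \<open>
  By \<open>flow_represents\<close> the integral is the energy of \<open>\<alpha>\<close>, whichever flow is selected. The norms agree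
  by Parseval's identity and the multiplicativity of weights.
\<close>

lemma strichartz_identity:
  fixes g :: "real ^ 'd \<Rightarrow> complex" and \<phi> :: "nat ^ 'd ^ 'k ^ 'l \<Rightarrow> complex"
  assumes k: "CARD('k::finite) \<ge> 2" and g: "g \<in> L2" "hermite_expansion g \<alpha>"
    and \<phi>: "\<And>M. \<phi> M = (\<Prod>i\<in>UNIV. \<Prod>j\<in>UNIV. \<alpha> (M $ i $ j))"
  defines "I \<equiv> \<integral>\<^sup>+t\<in>{-1/2..1/2}.
      (\<integral>\<^sup>+x. ennreal (norm (hermite_flow CARD('k) t g x) ^ (2 * CARD('k))) \<partial>gauss) ^ CARD('l) \<partial>lborel"
  shows "\<phi> \<in> F_space"
    and "(\<integral>x. (norm (g x))\<^sup>2 \<partial>gauss) ^ (CARD('k) * CARD('l)) = (F_norm \<phi>)\<^sup>2"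
    and "I = P_form \<phi>"
proof -
  have k1: "CARD('k) \<ge> 1" using k by simp
  have \<phi>': "\<phi> = tensor \<alpha>" by (rule ext) (simp add: \<phi> tensor_def)
  note lim = hermite_expansion_dilated_sum[OF g(2,1)]
  note pars = hermite_parseval[OF g(1) lim]
  have ell: "ell2 \<alpha>" using pars by (auto simp: ell2_def sums_iff)
  show "\<phi> \<in> F_space" unfolding \<phi>' by (rule tensor_F_space(1)[OF pars])
  show "(\<integral>x. (norm (g x))\<^sup>2 \<partial>gauss) ^ (CARD('k) * CARD('l)) = (F_norm \<phi>)\<^sup>2"
    unfolding \<phi>' tensor_F_space(2)[OF pars] L2_norm_sq ..
  have "power_integral CARD('k) (hermite_flow CARD('k) t g) = power_integral CARD('k) (series_sum CARD('k) (twist t \<alpha>))" for t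
  proof (rule power_integral_cong_AE, rule represents_unique[OF k1])
    have "is_hermite_flow CARD('k) t (hermite_flow CARD('k) t :: (real ^ 'd \<Rightarrow> complex) \<Rightarrow> _)"
      unfolding hermite_flow_def by (rule someI_ex[OF hermite_flow_exists[OF k1]])
    then show "represents CARD('k) (hermite_flow CARD('k) t g) (twist t \<alpha>)" by (rule flow_represents[OF _ g(1) lim])
    show "represents CARD('k) (series_sum CARD('k) (twist t \<alpha>)) (twist t \<alpha>)" by (rule represents_series_sum[OF k1]) (simp add: ell)
  qed (simp add: ell)
  then have "I = energy CARD('k) CARD('l) \<alpha>" unfolding I_def energy_def power_integral_def by simp
  then show "I = P_form \<phi>" unfolding \<phi>' by (simp only: energy_eq_P_form[OF k ell])
qed

text \<open>
  An unconditionally convergent double series may be summed by degree; its blocks are nonnegative, so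
  their sum in \<open>[0,\<infinity>]\<close> is the real one.
\<close>

lemma P_form_eq_F_inner:
  fixes \<phi> :: "nat ^ 'd ^ 'k ^ 'l \<Rightarrow> complex"
  assumes k: "CARD('k::finite) \<ge> 2" and s: "(\<lambda>M. \<phi> M * cnj (P_op \<phi> M) * of_real (Mfact M)) summable_on UNIV"
  shows "P_form \<phi> < \<infinity>" "complex_of_real (enn2real (P_form \<phi>)) = F_inner \<phi> (P_op \<phi>)"
proof -
  have "(\<lambda>S. P_block S \<phi>) sums F_inner \<phi> (P_op \<phi>)"
    using F_inner_sums[OF s] by (simp add: P_block_def deg_inner_def)
  moreover have real: "P_block S \<phi> = complex_of_real (Re (P_block S \<phi>))" for S
    using P_block_real[OF k refl, of S \<phi>] by (simp add: complex_is_Real_iff complex_eq_iff)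
  ultimately have "(\<lambda>S. complex_of_real (Re (P_block S \<phi>))) sums F_inner \<phi> (P_op \<phi>)" by simp
  note s' = this
  have sr: "(\<lambda>S. Re (P_block S \<phi>)) sums Re (F_inner \<phi> (P_op \<phi>))" "Im (F_inner \<phi> (P_op \<phi>)) = 0"
    using sums_Re[OF s'] sums_Im[OF s'] sums_unique2[OF _ sums_zero] by simp_all
  have eq: "P_form \<phi> = ennreal (Re (F_inner \<phi> (P_op \<phi>)))"
    unfolding P_form_def using sr(1) P_block_nonneg[OF k refl]
    by (subst suminf_ennreal2) (auto simp: sums_iff)
  have "Re (F_inner \<phi> (P_op \<phi>)) \<ge> 0"
    using sums_le[OF _ sums_zero sr(1)] P_block_nonneg[OF k refl] by blast
  then show "P_form \<phi> < \<infinity>" "complex_of_real (enn2real (P_form \<phi>)) = F_inner \<phi> (P_op \<phi>)"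
    using eq sr(2) by (auto simp: complex_eq_iff)
qed

theorem theorem3:
  fixes \<mu> :: real
  assumes "CARD('k::finite) \<ge> 2"
    and "\<mu> = (real CARD('k) - 1) * real CARD('l::finite) * real CARD('d::finite) / 2"
  shows
    "(\<forall>(g :: real ^ 'd \<Rightarrow> complex) \<alpha> (\<phi> :: nat ^ 'd ^ 'k ^ 'l \<Rightarrow> complex).
        g \<in> L2 \<and> hermite_expansion g \<alpha> \<and> (\<forall>M. \<phi> M = (\<Prod>i\<in>UNIV. \<Prod>j\<in>UNIV. \<alpha> (M $ i $ j))) \<longrightarrow>
        (let I = (\<integral>\<^sup>+t\<in>{-1/2..1/2}.
                   (\<integral>\<^sup>+x. ennreal (norm (hermite_flow CARD('k) t g x) ^ (2 * CARD('k))) \<partial>gauss)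
                     ^ CARD('l) \<partial>lborel)
         in (\<forall>S. P_block S \<phi> \<in> \<real> \<and> Re (P_block S \<phi>) \<ge> 0) \<and>
            I = P_form \<phi> \<and>
            ((\<lambda>M. \<phi> M * cnj (P_op \<phi> M) * of_real (Mfact M)) summable_on UNIV \<longrightarrow>
               I < \<infinity> \<and> complex_of_real (enn2real I) = F_inner \<phi> (P_op \<phi>))) \<and>
        \<phi> \<in> F_space \<and>
        (\<integral>x. (norm (g x))\<^sup>2 \<partial>gauss) ^ (CARD('k) * CARD('l)) = (F_norm \<phi>)\<^sup>2)
     \<and>
     ((\<forall>S. \<forall>\<phi> \<in> (F_deg S :: (nat ^ 'd ^ 'k ^ 'l \<Rightarrow> complex) set). P_op (P_op \<phi>) = P_op \<phi>)
        \<longleftrightarrow> \<mu> = 1) \<and>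
     (\<forall>S\<ge>2. (\<forall>\<phi> \<in> (F_deg S :: (nat ^ 'd ^ 'k ^ 'l \<Rightarrow> complex) set). P_op (P_op \<phi>) = P_op \<phi>)
        \<longleftrightarrow> \<mu> = 1) \<and>
     (\<mu> = 1 \<longrightarrow>
        (\<forall>S. is_projection_on (F_deg S :: (nat ^ 'd ^ 'k ^ 'l \<Rightarrow> complex) set) P_op) \<and>
        is_projection_on (F_space :: (nat ^ 'd ^ 'k ^ 'l \<Rightarrow> complex) set) P_op)
     \<and>
     (\<mu> > 1 \<longrightarrow>
        (\<forall>S. bounded_on (F_deg S :: (nat ^ 'd ^ 'k ^ 'l \<Rightarrow> complex) set) P_op \<and>
             op_norm_on (F_deg S :: (nat ^ 'd ^ 'k ^ 'l \<Rightarrow> complex) set) P_op =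
               (\<Prod>i<S div 2. \<mu> + real i) / fact (S div 2)) \<and>
        (\<lambda>S. op_norm_on (F_deg S :: (nat ^ 'd ^ 'k ^ 'l \<Rightarrow> complex) set) P_op)
          \<sim>[sequentially] (\<lambda>S. real S powr (\<mu> - 1) / (2 powr (\<mu> - 1) * Gamma \<mu>)) \<and>
        \<not> bounded_on {\<phi> \<in> (F_space :: (nat ^ 'd ^ 'k ^ 'l \<Rightarrow> complex) set). P_op \<phi> \<in> F_space} P_op)"
proof (intro conjI allI impI ballI, goal_cases)
  case (1 g \<alpha> \<phi>)
  then have g: "g \<in> L2" "hermite_expansion g \<alpha>"
    and \<phi>: "\<And>M. \<phi> M = (\<Prod>i\<in>UNIV. \<Prod>j\<in>UNIV. \<alpha> (M $ i $ j))" by auto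
  show ?case
    unfolding Let_def strichartz_identity(3)[OF assms(1) g \<phi>]
    using P_block_real[OF assms] P_block_nonneg[OF assms] P_form_eq_F_inner[OF assms(1)] by blast
next
  case (2 g \<alpha> \<phi>)
  then show ?case using strichartz_identity(1)[OF assms(1)] by blast
next
  case (3 g \<alpha> \<phi>)
  then show ?case using strichartz_identity(2)[OF assms(1)] by blast
next
  \<comment> \<open>Degree \<open>2\<close> is the first one with the eigenvalue \<open>\<mu>\<close>, and idempotence there forces \<open>\<mu> = 1\<close>.\<close>
  case 4
  show ?case using projection_imp_mu_1[OF assms, of 2] P_op_idem[OF assms] by blast
next
  case (5 S)
  then show ?case using projection_imp_mu_1[OF assms, of S] P_op_idem[OF assms] by blast
next
  case (6 S)
  show ?case by (rule P_op_projection[OF assms 6]) (auto intro: F_deg_subset P_op_F_deg)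
next
  case 7
  show ?case by (rule P_op_projection[OF assms 7]) (auto intro: P_op_F_space[OF assms 7])
next
  case (8 S)
  show ?case unfolding bounded_on_def using P_op_F_norm_le[OF assms] by blast
next
  case (9 S)
  show ?case by (simp only: op_norm_P_op[OF assms 9] eigenvalue_prod)
next
  case 10
  show ?case unfolding op_norm_P_op[OF assms 10] by (rule eigenvalue_half_asymp) (use 10 in simp)
next
  case 11
  show ?case by (rule P_op_unbounded[OF assms 11])
qed

end
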